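(* Let $a>0$, $\gamma>1$, and let $\nu,\lambda\in\mathbb{R}$ satisfy $\nu>0$ and $\lambda+\frac{2}{3}\nu>0$. Suppose that $(\rho,\mathbf{u})$ is a smooth solution on $\mathbb{R}^3$ of the stationary barotropic compressible Navier-Stokes equations $$\operatorname{div}(\rho\mathbf{u})=0,\qquad \operatorname{div}(\rho\mathbf{u}\otimes\mathbf{u})-\nu\Delta\mathbf{u}-(\lambda+\nu)\nabla\operatorname{div}\mathbf{u}+\nabla P=0,\qquad P=a\rho^{\gamma},$$ with $\rho\in L^\infty(\mathbb{R}^3)$ and $\nabla\mathbf{u}\in L^2(\mathbb{R}^3)$. Let $\frac{9}{2}\le p<\infty$ and $3\le q\le\infty$, and for $R>0$ set $$M_{p,q}(R):=R^{\frac{2}{3}-\frac{3}{p}}\,\|\mathbf{u}\|_{L^{p,q}(\{R\le|x|\le 2R\})}.$$ Assume that $$\liminf_{R\to\infty}M_{p,q}(R)<\infty.$$ Then there is a constant $C_0>0$, independent of $R$, such that $$D(\mathbf{u}):=\int_{\mathbb{R}^3}|\nabla\mathbf{u}|^2\,dx\le C_0\liminf_{R\to\infty}M_{p,q}^3(R),$$ and, if moreover $$\liminf_{R\to\infty}M_{p,q}^3(R)\le\delta\,D(\mathbf{u})$$ for some $0<\delta<1/C_0$, then $\mathbf{u}\equiv 0$ and $\rho$ is constant on $\mathbb{R}^3$.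
   Context: Here $\mathbf{u}=(u_1,u_2,u_3):\mathbb{R}^3\to\mathbb{R}^3$ is the velocity field and $\rho:\mathbb{R}^3\to[0,\infty)$ is the density. A smooth solution means that $\rho$ and $\mathbf{u}$ are smooth functions on $\mathbb{R}^3$ satisfying the equations. The $i$-th component of $\operatorname{div}(\rho\mathbf{u}\otimes\mathbf{u})$ is $\sum_j\partial_j(\rho u_iu_j)$, and $|\nabla\mathbf{u}|^2=\sum_{i,j}(\partial_ju_i)^2$. Lorentz space: for a measurable $E\subseteq\mathbb{R}^3$, $1\le p<\infty$, $1\le q\le\infty$, and a measurable function $f$ on $E$ (scalar- or vector-valued), define $$\|f\|_{L^{p,q}(E)}:=\left(\int_0^\infty t^{q-1}\,|\{x\in E:|f(x)|>t\}|^{q/p}\,dt\right)^{1/q}\ \text{ if } q<\infty,\qquad \|f\|_{L^{p,\infty}(E)}:=\sup_{t>0}t\,|\{x\in E:|f(x)|>t\}|^{1/p},$$ where $|\cdot|$ of a set is Lebesgue measure. *)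

theory Defs
  imports "HOL-Analysis.Analysis"
begin

definition pd :: "3 \<Rightarrow> (real^3 \<Rightarrow> real) \<Rightarrow> real^3 \<Rightarrow> real" where
  "pd j f x = frechet_derivative f (at x) (axis j 1)"

text \<open>Requiring differentiability at every level excludes the junk values of
  \<open>frechet_derivative\<close>; it adds nothing to the classical notion, since functions with
  continuous partial derivatives are differentiable.\<close>

primrec C_k :: "nat \<Rightarrow> (real^3 \<Rightarrow> real) \<Rightarrow> bool" where
  "C_k 0 f \<longleftrightarrow> continuous_on UNIV f"
| "C_k (Suc k) f \<longleftrightarrow> (\<forall>x. f differentiable (at x)) \<and> (\<forall>j. C_k k (pd j f))"

definition smooth :: "(real^3 \<Rightarrow> real) \<Rightarrow> bool" where
  "smooth f \<longleftrightarrow> (\<forall>k. C_k k f)"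

definition smooth_vec :: "(real^3 \<Rightarrow> real^3) \<Rightarrow> bool" where
  "smooth_vec v \<longleftrightarrow> (\<forall>i. smooth (\<lambda>x. v x $ i))"

definition grad :: "(real^3 \<Rightarrow> real) \<Rightarrow> real^3 \<Rightarrow> real^3" where
  "grad f x = (\<chi> i. pd i f x)"

definition divergence :: "(real^3 \<Rightarrow> real^3) \<Rightarrow> real^3 \<Rightarrow> real" where
  "divergence v x = (\<Sum>j\<in>UNIV. pd j (\<lambda>y. v y $ j) x)"

definition outer :: "real^3 \<Rightarrow> real^3 \<Rightarrow> real^3^3" where
  "outer v w = (\<chi> i j. v $ i * w $ j)"

text \<open>The divergence of a matrix field is taken row by row.\<close>

definition tensor_div :: "(real^3 \<Rightarrow> real^3^3) \<Rightarrow> real^3 \<Rightarrow> real^3" where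
  "tensor_div T x = (\<chi> i. divergence (\<lambda>y. T y $ i) x)"

definition vec_laplacian :: "(real^3 \<Rightarrow> real^3) \<Rightarrow> real^3 \<Rightarrow> real^3" where
  "vec_laplacian v x = (\<chi> i. \<Sum>j\<in>UNIV. pd j (pd j (\<lambda>y. v y $ i)) x)"

definition grad_sq :: "(real^3 \<Rightarrow> real^3) \<Rightarrow> real^3 \<Rightarrow> real" where
  "grad_sq u x = (\<Sum>i\<in>UNIV. \<Sum>j\<in>UNIV. (pd j (\<lambda>y. u y $ i) x)\<^sup>2)"

definition dirichlet :: "(real^3 \<Rightarrow> real^3) \<Rightarrow> real" where
  "dirichlet u = (LINT x|lebesgue. grad_sq u x)"

text \<open>At vacuum points \<open>0 powr \<gamma> = 0\<close>, the intended value for positive exponents. For smooth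
  nonnegative densities and \<open>\<gamma> > 1\<close> the pressure is continuously differentiable, so its gradient
  below is a genuine one.\<close>

definition pressure :: "real \<Rightarrow> real \<Rightarrow> (real^3 \<Rightarrow> real) \<Rightarrow> real^3 \<Rightarrow> real" where
  "pressure a \<gamma> \<rho> x = a * \<rho> x powr \<gamma>"

definition smooth_stationary_NS ::
  "real \<Rightarrow> real \<Rightarrow> real \<Rightarrow> real \<Rightarrow> (real^3 \<Rightarrow> real) \<Rightarrow> (real^3 \<Rightarrow> real^3) \<Rightarrow> bool" where
  "smooth_stationary_NS a \<gamma> \<nu> l \<rho> u \<longleftrightarrow>
     smooth \<rho> \<and> smooth_vec u \<and> (\<forall>x. 0 \<le> \<rho> x) \<and>
     (\<forall>x. divergence (\<lambda>y. \<rho> y *\<^sub>R u y) x = 0) \<and>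
     (\<forall>x. tensor_div (\<lambda>y. \<rho> y *\<^sub>R outer (u y) (u y)) x
          - \<nu> *\<^sub>R vec_laplacian u x
          - (l + \<nu>) *\<^sub>R grad (divergence u) x
          + grad (pressure a \<gamma> \<rho>) x = 0)"

definition in_Linfinity :: "(real^3 \<Rightarrow> real) \<Rightarrow> bool" where
  "in_Linfinity f \<longleftrightarrow>
     f \<in> borel_measurable lebesgue \<and> (\<exists>K. AE x in lebesgue. \<bar>f x\<bar> \<le> K)"

text \<open>Real powers on \<open>[0, \<infinity>]\<close>; only positive exponents are used, for which
  \<open>\<infinity>\<close> is sent to \<open>\<infinity>\<close>.\<close>

definition ennpowr :: "ennreal \<Rightarrow> real \<Rightarrow> ennreal" where
  "ennpowr x r = (if x = \<infinity> then \<infinity> else ennreal (enn2real x powr r))"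

definition distr_fun ::
  "'a::euclidean_space set \<Rightarrow> ('a \<Rightarrow> 'b::real_normed_vector) \<Rightarrow> real \<Rightarrow> ennreal" where
  "distr_fun E f t = emeasure lebesgue {x \<in> E. norm (f x) > t}"

definition lorentz_norm ::
  "real \<Rightarrow> ennreal \<Rightarrow> 'a::euclidean_space set \<Rightarrow> ('a \<Rightarrow> 'b::real_normed_vector) \<Rightarrow> ennreal" where
  "lorentz_norm p q E f =
     (if q = \<infinity> then (SUP t\<in>{0<..}. ennreal t * ennpowr (distr_fun E f t) (1 / p))
      else let r = enn2real q in
        ennpowr (\<integral>\<^sup>+t\<in>{0<..}. (ennreal (t powr (r - 1)) * ennpowr (distr_fun E f t) (r / p)) \<partial>lborel)
          (1 / r))"

definition annulus :: "real \<Rightarrow> (real^3) set" where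
  "annulus R = {x. R \<le> norm x \<and> norm x \<le> 2 * R}"

definition M_pq :: "real \<Rightarrow> ennreal \<Rightarrow> (real^3 \<Rightarrow> real^3) \<Rightarrow> real \<Rightarrow> ennreal" where
  "M_pq p q u R = ennreal (R powr (2/3 - 3/p)) * lorentz_norm p q (annulus R) u"

end

theory Submission
  imports Defs
begin

text \<open>
  The theorem is a Caccioppoli estimate whose right-hand side is scale invariant in terms of the
  Lorentz norm on the annulus.

  For any constant \<open>\<kappa>\<close> a smooth solution satisfies the local energy identity
  \<open>div e = - \<nu> |\<nabla>u|^2 - (l + \<nu>) (div u)^2\<close>, where the flux \<open>e\<close> consists of \<open>\<rho> |u|^2 u / 2\<close>, viscous
  terms of the form \<open>u \<nabla>u\<close>, and \<open>\<gamma> / (\<gamma> - 1) (P - \<kappa> \<rho>) u\<close> (\<open>energy_algebra\<close>,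
  \<open>local_energy_identity\<close>). The freedom in \<open>\<kappa>\<close> comes from \<open>div (\<rho> u) = 0\<close>. Testing with a cutoff
  whose gradient lives in \<open>{3R/2 \<le> |x| \<le> 19R/10}\<close> bounds the energy in a ball by \<open>1/R\<close> times the integral
  of \<open>|e|\<close> over that shell. The convective and viscous parts are immediate. The pressure part is not:
  \<open>P\<close> is only bounded, and \<open>1/R\<close> times the integral of \<open>|u|\<close> grows with \<open>R\<close>.

  Choosing \<open>\<kappa>\<close> suitably makes \<open>|P - \<kappa> \<rho>| \<le> |P - c|\<close> for any prescribed constant \<open>c \<ge> 0\<close>
  (\<open>pressure_oscillation_bound\<close>), so only the oscillation of \<open>P\<close> on the shell matters. The momentum
  equation says \<open>\<nabla>P = div G\<close> with \<open>G = \<nu> \<nabla>u + (l + \<nu>) (div u) I - \<rho> u \<otimes> u\<close>, and the key analytic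
  fact is \<open>pressure_L2_annulus\<close>: for some \<open>c\<close>, the \<open>L^2\<close> norm of \<open>P - c\<close> on the shell is at most a
  scale-independent multiple of the \<open>L^2\<close> norm of \<open>G\<close> on \<open>{R \<le> |x| \<le> 2R}\<close>. Working in \<open>L^2\<close> is enough
  because \<open>p \<ge> 9/2 > 4\<close> controls \<open>u \<otimes> u\<close> in \<open>L^2\<close>, and it makes the singular integral theory
  elementary. The pressure is split into its mollification at scale \<open>r = R/20\<close> and the rest.
  The rest is a limit of sums of \<open>\<partial>_i \<partial>_j (\<Psi> * G_ij)\<close>, where \<open>\<Psi>\<close> is a regularised Newtonian potential
  at scale \<open>e \<rightarrow> 0\<close> minus the one at scale \<open>r\<close>, hence compactly supported with \<open>\<Delta>\<Psi>\<close> a difference of two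
  positive bumps; integrating by parts twice gives \<open>\<parallel>\<partial>_i \<partial>_j v\<parallel> \<le> \<parallel>\<Delta>v\<parallel>\<close>, and Young's inequality
  finishes (\<open>Hessian_L2_bound\<close>, \<open>truncated_Riesz_L2\<close>). The mollified pressure has a gradient
  bounded by \<open>G\<close>, and any two points of the shell are joined inside the annulus by two
  segments through a point orthogonal to both (\<open>mollified_oscillation\<close>).

  Finally \<open>L^{p,q}\<close> embeds into weak \<open>L^p\<close>, hence into \<open>L^4\<close> of the annulus, with the scaling
  \<open>\<integral> |u|^4 \<le> C M(R)^4 R^{1/3}\<close> (\<open>annulus_L4_bound\<close>). Inserting this into the Caccioppoli estimate
  gives energy \<open>\<le> C (M(R)^3 + M(R) D^{1/2} R^{-1/6})\<close> (\<open>energy_growth\<close>); the last term dies along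
  a sequence realising the limit inferior, so \<open>D \<le> C liminf M(R)^3\<close>. The smallness condition
  then forces \<open>D = 0\<close>, so \<open>u\<close> is constant; a nonzero constant would make \<open>M(R)\<close> grow like \<open>R^{2/3}\<close>,
  so \<open>u = 0\<close>, and the momentum equation reduces to \<open>\<nabla>P = 0\<close>.
\<close>

section \<open>Directional derivatives\<close>

text \<open>Integration by parts, difference quotients and the bound along a segment all use only the
  derivative along a line, so this is the notion of derivative in everything that does not involve
  the equations. It is a relation because the derivatives of the kernels below are
  given by explicit formulas.\<close>
definition has_dd :: "'a::real_normed_vector \<Rightarrow> ('a \<Rightarrow> real) \<Rightarrow> ('a \<Rightarrow> real) \<Rightarrow> bool" where
  "has_dd h f f' \<longleftrightarrow> (\<forall>x. ((\<lambda>t. f (x + t *\<^sub>R h)) has_real_derivative f' x) (at 0))"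

lemma has_dd_at:
  assumes "has_dd h f f'"
  shows "((\<lambda>t. f (x + t *\<^sub>R h)) has_real_derivative f' (x + s *\<^sub>R h)) (at s)"
proof -
  have "((\<lambda>t. f (x + (s + t) *\<^sub>R h)) has_real_derivative f' (x + s *\<^sub>R h)) (at 0)"
    using assms[unfolded has_dd_def, rule_format, of "x + s *\<^sub>R h"]
    by (simp add: algebra_simps)
  then show ?thesis
    using DERIV_shift[of "\<lambda>t. f (x + t *\<^sub>R h)" "f' (x + s *\<^sub>R h)" 0 s]
    by (simp add: add.commute)
qed

lemma has_dd_of_derivative:
  assumes "\<And>x. (f has_derivative f' x) (at x)"
  shows "has_dd h f (\<lambda>x. f' x h)"
  unfolding has_dd_def
proof
  fix x
  have g: "((\<lambda>t. x + t *\<^sub>R h) has_derivative (\<lambda>t. t *\<^sub>R h)) (at 0)"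
    by (auto intro!: derivative_eq_intros)
  have "((\<lambda>t. f (x + t *\<^sub>R h)) has_derivative (\<lambda>t. f' x (t *\<^sub>R h))) (at 0)"
    using has_derivative_compose[OF g, of f "f' x"] assms[of x] by simp
  moreover have "f' x (t *\<^sub>R h) = f' x h * t" for t
    using has_derivative_linear[OF assms[of x]] by (simp add: linear_cmul)
  ultimately show "((\<lambda>t. f (x + t *\<^sub>R h)) has_real_derivative f' x h) (at 0)"
    by (simp add: has_field_derivative_def)
qed

lemma has_dd_unique: "has_dd h f f1 \<Longrightarrow> has_dd h f f2 \<Longrightarrow> f1 = f2"
  unfolding has_dd_def using DERIV_unique by (intro ext) blast

lemma has_dd_mult:
  "has_dd h f f' \<Longrightarrow> has_dd h g g' \<Longrightarrow> has_dd h (\<lambda>x. f x * g x) (\<lambda>x. f' x * g x + f x * g' x)"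
  unfolding has_dd_def
  by (auto intro!: derivative_eq_intros simp: algebra_simps)

lemma has_dd_add:
  "has_dd h f f' \<Longrightarrow> has_dd h g g' \<Longrightarrow> has_dd h (\<lambda>x. f x + g x) (\<lambda>x. f' x + g' x)"
  unfolding has_dd_def by (auto intro!: derivative_eq_intros)

lemma has_dd_diff:
  "has_dd h f f' \<Longrightarrow> has_dd h g g' \<Longrightarrow> has_dd h (\<lambda>x. f x - g x) (\<lambda>x. f' x - g' x)"
  unfolding has_dd_def by (auto intro!: derivative_eq_intros)

lemma has_dd_cmult: "has_dd h f f' \<Longrightarrow> has_dd h (\<lambda>x. c * f x) (\<lambda>x. c * f' x)"
  unfolding has_dd_def by (auto intro!: derivative_eq_intros)

lemma has_dd_const: "has_dd h (\<lambda>x. c) (\<lambda>x. 0)"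
  unfolding has_dd_def by auto

lemma has_dd_sum:
  "(\<And>i. i \<in> I \<Longrightarrow> has_dd h (f i) (f' i)) \<Longrightarrow>
    has_dd h (\<lambda>x. \<Sum>i\<in>I. f i x) (\<lambda>x. \<Sum>i\<in>I. f' i x)"
  unfolding has_dd_def by (auto intro!: derivative_eq_intros)

lemma has_dd_chain:
  assumes "\<And>t. (g has_real_derivative g' t) (at t)" "has_dd h f f'"
  shows "has_dd h (\<lambda>x. g (f x)) (\<lambda>x. g' (f x) * f' x)"
  unfolding has_dd_def
proof
  fix x
  show "((\<lambda>t. g (f (x + t *\<^sub>R h))) has_real_derivative g' (f x) * f' x) (at 0)"
    using DERIV_chain2[of g "g' (f x)" "\<lambda>t. f (x + t *\<^sub>R h)" 0 "f' x"] assms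
    by (simp add: has_dd_def)
qed

lemma has_dd_reflect:
  assumes "has_dd h g g'"
  shows "has_dd h (\<lambda>y. g (x - y)) (\<lambda>y. - g' (x - y))"
  unfolding has_dd_def
proof
  fix y
  have "((\<lambda>t. g ((x - y) + t *\<^sub>R h)) has_real_derivative g' (x - y)) (at (-0))"
    using assms by (simp add: has_dd_def)
  from DERIV_chain2[of _ _ uminus, OF this DERIV_minus[OF DERIV_ident]]
  show "((\<lambda>t. g (x - (y + t *\<^sub>R h))) has_real_derivative - g' (x - y)) (at 0)"
    by (simp add: algebra_simps)
qed

lemma has_dd_segment_bound:
  assumes "has_dd h f f'" "\<And>s. s \<in> {0..1} \<Longrightarrow> \<bar>f' (x + s *\<^sub>R h)\<bar> \<le> C"
  shows "\<bar>f (x + h) - f x\<bar> \<le> C"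
proof -
  have "norm (f (x + 1 *\<^sub>R h) - f (x + 0 *\<^sub>R h)) \<le> C * norm (1 - 0 :: real)"
    by (rule field_differentiable_bound[of "{0..1::real}" "\<lambda>t. f (x + t *\<^sub>R h)"
          "\<lambda>t. f' (x + t *\<^sub>R h)"])
      (use has_dd_at[OF assms(1)] assms(2) in \<open>simp_all add: has_field_derivative_at_within\<close>)
  then show ?thesis by simp
qed

lemma has_dd_increment_bound:
  assumes "has_dd h f f'" "\<And>x. \<bar>f' x\<bar> \<le> C"
  shows "\<bar>f (x + t *\<^sub>R h) - f x\<bar> \<le> C * \<bar>t\<bar>"
proof -
  have "norm (f (x + t *\<^sub>R h) - f (x + 0 *\<^sub>R h)) \<le> C * norm (t - 0)"
    by (rule field_differentiable_bound[of UNIV "\<lambda>t. f (x + t *\<^sub>R h)"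
          "\<lambda>t. f' (x + t *\<^sub>R h)"])
      (use has_dd_at[OF assms(1)] assms(2) in simp_all)
  then show ?thesis by simp
qed

lemma has_dd_quotient_tendsto:
  assumes "has_dd h f f'" "r \<longlonglongrightarrow> 0" "\<And>n. r n \<noteq> 0"
  shows "(\<lambda>n. (f (x + r n *\<^sub>R h) - f x) / r n) \<longlonglongrightarrow> f' x"
proof -
  have "((\<lambda>t. (f (x + t *\<^sub>R h) - f x) / t) \<longlongrightarrow> f' x) (at 0)"
    using assms(1) by (simp add: has_dd_def DERIV_def)
  moreover have "filterlim r (at 0) sequentially"
    using assms(2,3) by (simp add: filterlim_at)
  ultimately show ?thesis
    by (rule filterlim_compose)
qed

section \<open>Continuous functions of compact support\<close>

text \<open>The class of test functions and kernels: everything that is integrated by parts has a factor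
  in it, so boundary terms never appear.\<close>
definition cont_cpt :: "('a::euclidean_space \<Rightarrow> real) \<Rightarrow> bool" where
  "cont_cpt f \<longleftrightarrow> continuous_on UNIV f \<and> (\<exists>B. \<forall>x. B < norm x \<longrightarrow> f x = 0)"

lemma cont_cpt_continuous: "cont_cpt f \<Longrightarrow> continuous_on UNIV f"
  by (simp add: cont_cpt_def)

lemma cont_cpt_measurable: "cont_cpt f \<Longrightarrow> f \<in> borel_measurable borel"
  by (simp add: cont_cpt_def borel_measurable_continuous_onI)

lemma cont_cpt_integrable:
  assumes "cont_cpt f"
  shows "integrable lborel f"
proof -
  obtain B where B: "\<And>x. B < norm x \<Longrightarrow> f x = 0" and c: "continuous_on UNIV f"
    using assms by (auto simp: cont_cpt_def)
  have "integrable lborel (\<lambda>x. indicator (cball 0 B) x *\<^sub>R f x)"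
    using continuous_on_subset[OF c] by (intro borel_integrable_compact) auto
  moreover have "(\<lambda>x. indicator (cball 0 B) x *\<^sub>R f x) = f"
    using B by (auto simp: fun_eq_iff indicator_def not_le)
  ultimately show ?thesis by simp
qed

lemma cont_cpt_bounded:
  assumes "cont_cpt f"
  obtains C where "C \<ge> 0" "\<And>x. \<bar>f x\<bar> \<le> C"
proof -
  obtain B where B: "\<And>x. B < norm x \<Longrightarrow> f x = 0" and c: "continuous_on UNIV f"
    using assms by (auto simp: cont_cpt_def)
  have "compact (f ` cball 0 B)"
    using continuous_on_subset[OF c] by (intro compact_continuous_image) auto
  then obtain C where C: "\<And>x. x \<in> cball 0 B \<Longrightarrow> \<bar>f x\<bar> \<le> C"
    by (force dest!: compact_imp_bounded simp: bounded_iff)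
  have "\<bar>f x\<bar> \<le> max C 0" for x
    using B[of x] C[of x] by (cases "B < norm x") auto
  then show thesis by (intro that[of "max C 0"]) auto
qed

lemma cont_cpt_mult_left:
  assumes "cont_cpt f" "continuous_on UNIV g" shows "cont_cpt (\<lambda>x. f x * g x)"
proof -
  obtain B where "\<And>x. B < norm x \<Longrightarrow> f x = 0" using assms by (auto simp: cont_cpt_def)
  then show ?thesis using assms unfolding cont_cpt_def
    by (intro conjI exI[of _ B]) (auto intro!: continuous_intros)
qed

lemma cont_cpt_mult_right:
  assumes "continuous_on UNIV f" "cont_cpt g" shows "cont_cpt (\<lambda>x. f x * g x)"
  using cont_cpt_mult_left[OF assms(2,1)] by (simp add: mult.commute)

lemma cont_cpt_add:
  assumes "cont_cpt f" "cont_cpt g" shows "cont_cpt (\<lambda>x. f x + g x)"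
proof -
  obtain B where "\<And>x. B < norm x \<Longrightarrow> f x = 0" using assms by (auto simp: cont_cpt_def)
  moreover obtain C where "\<And>x. C < norm x \<Longrightarrow> g x = 0" using assms by (auto simp: cont_cpt_def)
  ultimately show ?thesis using assms unfolding cont_cpt_def
    by (intro conjI exI[of _ "max B C"]) (auto intro!: continuous_intros)
qed

lemma cont_cpt_cmult: "cont_cpt f \<Longrightarrow> cont_cpt (\<lambda>x. c * f x)"
  by (rule cont_cpt_mult_right) auto

lemma cont_cpt_diff: "cont_cpt f \<Longrightarrow> cont_cpt g \<Longrightarrow> cont_cpt (\<lambda>x. f x - g x)"
  using cont_cpt_add[of f "\<lambda>x. (-1) * g x"] cont_cpt_cmult[of g "-1"] by simp

lemma cont_cpt_zero: "cont_cpt (\<lambda>x. 0)"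
  by (simp add: cont_cpt_def)

lemma cont_cpt_sum: "(\<And>i. i \<in> I \<Longrightarrow> cont_cpt (f i)) \<Longrightarrow> cont_cpt (\<lambda>x. \<Sum>i\<in>I. f i x)"
  by (induction I rule: infinite_finite_induct) (simp_all add: cont_cpt_zero cont_cpt_add)

lemma cont_cpt_reflect:
  assumes "cont_cpt g" shows "cont_cpt (\<lambda>y. g (x - y))"
proof -
  obtain B where B: "\<And>x. B < norm x \<Longrightarrow> g x = 0" using assms by (auto simp: cont_cpt_def)
  have "g (x - y) = 0" if "B + norm x < norm y" for y
    using norm_triangle_ineq2[of y x] that by (intro B) (simp add: norm_minus_commute)
  moreover have "continuous_on UNIV (\<lambda>y. g (x - y))"
    by (rule continuous_on_compose2[OF cont_cpt_continuous[OF assms]])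
      (auto intro: continuous_intros)
  ultimately show ?thesis unfolding cont_cpt_def by blast
qed

lemma has_dd_zero_outside:
  assumes "has_dd h f f'" "\<And>x. B < norm x \<Longrightarrow> f x = 0" "B < norm x"
  shows "f' x = 0"
proof -
  have op: "open {t. B < norm (x + t *\<^sub>R h)}"
    by (intro open_Collect_less continuous_intros)
  have "((\<lambda>t. f (x + t *\<^sub>R h)) has_real_derivative 0) (at 0)"
    by (rule has_field_derivative_transform_within_open[OF _ op, of "\<lambda>_. 0"])
      (use assms in auto)
  then show ?thesis using assms(1) DERIV_unique unfolding has_dd_def by blast
qed

lemma cont_cpt_dd:
  assumes "cont_cpt f" "has_dd h f f'" "continuous_on UNIV f'"
  shows "cont_cpt f'"
  using assms has_dd_zero_outside[OF assms(2)] unfolding cont_cpt_def by blast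

lemma integrable_indicator_continuous:
  fixes f :: "'a::euclidean_space \<Rightarrow> real"
  assumes "compact A" "continuous_on UNIV f"
  shows "integrable lborel (\<lambda>x. indicator A x * f x)"
  using borel_integrable_compact[OF assms(1) continuous_on_subset[OF assms(2)]] by simp

lemma continuous_AE_zero:
  fixes f :: "'a::euclidean_space \<Rightarrow> real"
  assumes f: "continuous_on UNIV f" and ae: "AE x in lborel. f x = 0"
  shows "f x = 0"
proof -
  have op: "open {x. f x \<noteq> 0}"
    by (intro open_Collect_neq f continuous_on_const)
  have "AE x in lebesgue. x \<notin> {x. f x \<noteq> 0}"
    using AE_completion[OF ae] by simp
  then have "negligible {x. f x \<noteq> 0}"
    unfolding negligible_iff_null_sets using op by (subst AE_iff_null_sets) auto
  then have "{x. f x \<noteq> 0} = {}" using open_not_negligible[OF op] by blast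
  then show ?thesis by blast
qed

section \<open>Integration by parts\<close>

lemma integral_lborel_affine:
  fixes f :: "'a::euclidean_space \<Rightarrow> real"
  assumes [measurable]: "f \<in> borel_measurable borel" and c: "c \<noteq> 0"
  shows "(\<integral>x. f x \<partial>lborel) = \<bar>c\<bar> ^ DIM('a) * (\<integral>x. f (t + c *\<^sub>R x) \<partial>lborel)"
proof -
  have "(\<integral>x. f x \<partial>lborel)
      = (\<integral>x. f x \<partial>density (distr lborel borel (\<lambda>x. t + c *\<^sub>R x)) (\<lambda>_. \<bar>c\<bar> ^ DIM('a)))"
    using lborel_affine[OF c, of t] by simp
  also have "\<dots> = (\<integral>x. \<bar>c\<bar> ^ DIM('a) *\<^sub>R f x \<partial>distr lborel borel (\<lambda>x. t + c *\<^sub>R x))"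
    by (rule integral_density) auto
  also have "\<dots> = (\<integral>x. \<bar>c\<bar> ^ DIM('a) *\<^sub>R f (t + c *\<^sub>R x) \<partial>lborel)"
    by (rule integral_distr) auto
  finally show ?thesis by simp
qed

lemma integral_lborel_translation:
  fixes f :: "'a::euclidean_space \<Rightarrow> real"
  assumes "f \<in> borel_measurable borel"
  shows "(\<integral>x. f (c + x) \<partial>lborel) = (\<integral>x. f x \<partial>lborel)"
  using integral_lborel_affine[OF assms, of 1 c] by simp

lemma integral_reflect:
  fixes k :: "'a::euclidean_space \<Rightarrow> real"
  assumes "k \<in> borel_measurable borel"
  shows "(\<integral>y. k (x - y) \<partial>lborel) = (\<integral>y. k y \<partial>lborel)"
  using integral_lborel_affine[OF assms, of "-1" x] by simp

text \<open>The difference quotients have integral zero because Lebesgue measure is translation invariant;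
  they are dominated because \<open>f'\<close> is bounded and \<open>f\<close> has compact support.\<close>
lemma integral_dd_eq_0:
  fixes f :: "'a::euclidean_space \<Rightarrow> real"
  assumes f: "cont_cpt f" and d: "has_dd h f f'" and f': "continuous_on UNIV f'"
  shows "(\<integral>x. f' x \<partial>lborel) = 0"
proof -
  have cf': "cont_cpt f'" by (rule cont_cpt_dd[OF f d f'])
  obtain C where C: "C \<ge> 0" "\<And>x. \<bar>f' x\<bar> \<le> C" using cont_cpt_bounded[OF cf'] by blast
  obtain B where B: "\<And>x. B < norm x \<Longrightarrow> f x = 0" using f by (auto simp: cont_cpt_def)
  have [measurable]: "f \<in> borel_measurable borel" using f by (rule cont_cpt_measurable)
  have [measurable]: "f' \<in> borel_measurable borel" using cf' by (rule cont_cpt_measurable)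
  define r where "r n = 1 / real (Suc n)" for n
  have r0: "r \<longlonglongrightarrow> 0" "\<And>n. r n \<noteq> 0" "\<And>n. 0 < r n" "\<And>n. r n \<le> 1"
    unfolding r_def using LIMSEQ_Suc[OF lim_1_over_n] by auto
  define q where "q n x = (f (x + r n *\<^sub>R h) - f x) / r n" for n x
  have "(\<lambda>n. \<integral>x. q n x \<partial>lborel) \<longlonglongrightarrow> (\<integral>x. f' x \<partial>lborel)"
  proof (rule integral_dominated_convergence[where w = "\<lambda>x. C * indicator (cball 0 (B + norm h)) x"])
    show "integrable lborel (\<lambda>x::'a. C * indicator (cball 0 (B + norm h)) x)"
      by (intro integrable_mult_right integrable_real_indicator)
        (use emeasure_lborel_cball_finite[of "0::'a" "B + norm h"] in auto)
    show "AE x in lborel. (\<lambda>n. q n x) \<longlonglongrightarrow> f' x"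
      unfolding q_def using has_dd_quotient_tendsto[OF d r0(1,2)] by auto
    show "AE x in lborel. norm (q n x) \<le> C * indicator (cball 0 (B + norm h)) x" for n
    proof (rule AE_I2)
      fix x
      have "\<bar>q n x\<bar> \<le> C"
        using has_dd_increment_bound[OF d C(2), of x "r n"] r0(3)[of n]
        by (simp add: q_def divide_le_eq)
      moreover have "q n x = 0" if "B + norm h < norm x"
      proof -
        have "norm (r n *\<^sub>R h) \<le> norm h" using r0(3,4)[of n] by (simp add: mult_left_le_one_le)
        then have "B < norm (x + r n *\<^sub>R h)"
          using norm_triangle_ineq2[of x "- (r n *\<^sub>R h)"] that by simp
        moreover have "B < norm x" using that norm_ge_zero[of h] by linarith
        ultimately show ?thesis using B by (simp add: q_def)
      qed
      ultimately show "norm (q n x) \<le> C * indicator (cball 0 (B + norm h)) x"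
        by (auto simp: indicator_def)
    qed
  qed (auto simp: q_def)
  moreover have "(\<integral>x. q n x \<partial>lborel) = 0" for n
  proof -
    have "integrable lborel f" by (rule cont_cpt_integrable[OF f])
    moreover have "integrable lborel (\<lambda>x. f (r n *\<^sub>R h + x))"
    proof -
      have "integrable (distr lborel borel ((+) (r n *\<^sub>R h))) f"
        using cont_cpt_integrable[OF f] by (simp add: lborel_distr_plus)
      then show ?thesis by (subst (asm) integrable_distr_eq) auto
    qed
    ultimately show ?thesis
      using integral_lborel_translation[of f "r n *\<^sub>R h"]
      by (simp add: q_def add.commute)
  qed
  ultimately show ?thesis by (simp add: LIMSEQ_const_iff)
qed

lemma integral_by_parts:
  fixes f g :: "'a::euclidean_space \<Rightarrow> real"
  assumes f: "cont_cpt f" "has_dd h f f'" "continuous_on UNIV f'"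
    and g: "continuous_on UNIV g" "has_dd h g g'" "continuous_on UNIV g'"
  shows "(\<integral>x. f' x * g x \<partial>lborel) = - (\<integral>x. f x * g' x \<partial>lborel)"
proof -
  have f': "cont_cpt f'" by (rule cont_cpt_dd[OF f])
  have "(\<integral>x. f' x * g x + f x * g' x \<partial>lborel) = 0"
    by (rule integral_dd_eq_0[OF cont_cpt_mult_left[OF f(1) g(1)] has_dd_mult[OF f(2) g(2)]])
      (use f g cont_cpt_continuous[OF f(1)] in \<open>auto intro!: continuous_intros\<close>)
  moreover have "integrable lborel (\<lambda>x. f' x * g x)" "integrable lborel (\<lambda>x. f x * g' x)"
    using f' f g by (auto intro!: cont_cpt_integrable cont_cpt_mult_left)
  ultimately show ?thesis by simp
qed

section \<open>The Cauchy-Schwarz inequality\<close>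

lemma Cauchy_Schwarz_integral:
  fixes f g :: "'a \<Rightarrow> real"
  assumes f: "integrable M (\<lambda>x. (f x)^2)" and g: "integrable M (\<lambda>x. (g x)^2)"
    and fg: "integrable M (\<lambda>x. f x * g x)"
  shows "(\<integral>x. f x * g x \<partial>M)^2 \<le> (\<integral>x. (f x)^2 \<partial>M) * (\<integral>x. (g x)^2 \<partial>M)"
proof -
  define a where "a = (\<integral>x. (f x)^2 \<partial>M)"
  define b where "b = (\<integral>x. f x * g x \<partial>M)"
  define c where "c = (\<integral>x. (g x)^2 \<partial>M)"
  have pos: "0 \<le> t^2 * a + 2 * t * b + c" for t
  proof -
    have "0 \<le> (\<integral>x. (t * f x + g x)^2 \<partial>M)"
      by (intro integral_nonneg_AE) auto
    also have "(\<lambda>x. (t * f x + g x)^2) = (\<lambda>x. t^2 * (f x)^2 + (2 * t) * (f x * g x) + (g x)^2)"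
      by (auto simp: power2_eq_square algebra_simps)
    also have "integral\<^sup>L M \<dots> = t^2 * a + 2 * t * b + c"
      unfolding a_def b_def c_def using f g fg by simp
    finally show ?thesis .
  qed
  have a0: "a \<ge> 0" unfolding a_def by (intro integral_nonneg_AE) auto
  have "b^2 \<le> a * c"
  proof (cases "a = 0")
    case True
    have "b = 0"
    proof (rule ccontr)
      assume "b \<noteq> 0"
      \<comment> \<open>For \<open>a = 0\<close> the quadratic is affine in \<open>t\<close>, and this \<open>t\<close> gives it the value \<open>-1\<close>.\<close>
      with pos[of "- (c + 1) / (2 * b)"] True show False by (simp add: field_simps)
    qed
    with True show ?thesis by simp
  next
    case False
    then have "a > 0" using a0 by simp
    have "0 \<le> a * ((- b / a)^2 * a + 2 * (- b / a) * b + c)"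
      using pos[of "- b / a"] a0 by (rule_tac mult_nonneg_nonneg)
    also have "\<dots> = a * c - b^2"
      using \<open>a > 0\<close> by (simp add: field_simps power2_eq_square)
    finally show ?thesis by simp
  qed
  then show ?thesis unfolding a_def b_def c_def .
qed

lemma Cauchy_Schwarz_indicator:
  fixes F G :: "'a::euclidean_space \<Rightarrow> real"
  assumes A: "compact A" "compact B" and F: "continuous_on UNIV F" and G: "continuous_on UNIV G"
  shows "integrable lborel (\<lambda>x. (indicator A x * F x) * (indicator B x * G x))"
    and "(\<integral>x. (indicator A x * F x) * (indicator B x * G x) \<partial>lborel)
      \<le> sqrt (\<integral>x. indicator A x * (F x)^2 \<partial>lborel) * sqrt (\<integral>x. indicator B x * (G x)^2 \<partial>lborel)"
proof -
  have "integrable lborel (\<lambda>x. indicator (A \<inter> B) x * (F x * G x))"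
    by (intro integrable_indicator_continuous compact_Int A continuous_on_mult F G)
  moreover have "(\<lambda>x. indicator (A \<inter> B) x * (F x * G x))
      = (\<lambda>x. (indicator A x * F x) * (indicator B x * G x))"
    by (auto simp: indicator_def fun_eq_iff)
  ultimately show i: "integrable lborel (\<lambda>x. (indicator A x * F x) * (indicator B x * G x))"
    by simp
  have sq: "(indicator S x * y)^2 = indicator S x * y^2" for S and x :: 'a and y :: real
    by (auto simp: indicator_def)
  have "(\<integral>x. (indicator A x * F x) * (indicator B x * G x) \<partial>lborel)^2
      \<le> (\<integral>x. (indicator A x * F x)^2 \<partial>lborel) * (\<integral>x. (indicator B x * G x)^2 \<partial>lborel)"
    by (rule Cauchy_Schwarz_integral[OF _ _ i])
      (unfold sq, (intro integrable_indicator_continuous A continuous_on_power F G)+)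
  then show "(\<integral>x. (indicator A x * F x) * (indicator B x * G x) \<partial>lborel)
      \<le> sqrt (\<integral>x. indicator A x * (F x)^2 \<partial>lborel) * sqrt (\<integral>x. indicator B x * (G x)^2 \<partial>lborel)"
    unfolding sq real_sqrt_mult[symmetric] by (rule real_le_rsqrt)
qed

section \<open>Convolution\<close>

text \<open>The second argument is a kernel of compact support, which is what makes the integral
  meaningful when the first one is only continuous, as the pressure is.\<close>
definition conv :: "('a::euclidean_space \<Rightarrow> real) \<Rightarrow> ('a \<Rightarrow> real) \<Rightarrow> 'a \<Rightarrow> real" where
  "conv H g x = (\<integral>y. H y * g (x - y) \<partial>lborel)"

lemma integrable_mult_cont_cpt:
  fixes H g :: "'a::euclidean_space \<Rightarrow> real"
  assumes H: "integrable lborel H" and g: "cont_cpt g"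
  shows "integrable lborel (\<lambda>y. H y * g y)"
proof -
  obtain C where C: "C \<ge> 0" "\<And>x. \<bar>g x\<bar> \<le> C" using cont_cpt_bounded[OF g] by blast
  have [measurable]: "g \<in> borel_measurable borel" using g by (rule cont_cpt_measurable)
  show ?thesis
  proof (rule Bochner_Integration.integrable_bound)
    show "integrable lborel (\<lambda>y. C * H y)" using H by simp
    show "AE y in lborel. norm (H y * g y) \<le> norm (C * H y)"
      using C by (intro AE_I2) (simp add: abs_mult mult.commute[of C] mult_left_mono)
  qed (use H in measurable)
qed

lemma integrable_conv:
  assumes "integrable lborel H" "cont_cpt g"
  shows "integrable lborel (\<lambda>y. H y * g (x - y))"
  by (rule integrable_mult_cont_cpt[OF assms(1) cont_cpt_reflect[OF assms(2)]])

lemma conv_has_dd: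
  fixes H g :: "'a::euclidean_space \<Rightarrow> real"
  assumes H: "integrable lborel H" and g: "cont_cpt g"
    and d: "has_dd h g g'" and g': "continuous_on UNIV g'"
  shows "has_dd h (conv H g) (conv H g')"
  unfolding has_dd_def DERIV_def tendsto_at_iff_sequentially
proof (intro allI impI)
  fix x and r :: "nat \<Rightarrow> real"
  assume r: "\<forall>i. r i \<in> UNIV - {0}" "r \<longlonglongrightarrow> 0"
  have cg': "cont_cpt g'" by (rule cont_cpt_dd[OF g d g'])
  obtain C where C: "C \<ge> 0" "\<And>x. \<bar>g' x\<bar> \<le> C" using cont_cpt_bounded[OF cg'] by blast
  have [measurable]: "g \<in> borel_measurable borel" "g' \<in> borel_measurable borel"
    "H \<in> borel_measurable borel"
    using g cg' H cont_cpt_measurable by auto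
  let ?q = "\<lambda>n y. H y * ((g (x - y + r n *\<^sub>R h) - g (x - y)) / r n)"
  have "(\<lambda>n. \<integral>y. ?q n y \<partial>lborel) \<longlonglongrightarrow> (\<integral>y. H y * g' (x - y) \<partial>lborel)"
  proof (rule integral_dominated_convergence[where w = "\<lambda>y. C * norm (H y)"])
    show "integrable lborel (\<lambda>y. C * norm (H y))" using H by simp
    show "AE y in lborel. (\<lambda>n. ?q n y) \<longlonglongrightarrow> H y * g' (x - y)"
      using r(1) by (intro AE_I2 tendsto_mult tendsto_const has_dd_quotient_tendsto[OF d r(2)]) auto
    show "AE y in lborel. norm (?q n y) \<le> C * norm (H y)" for n
    proof (rule AE_I2)
      fix y
      have "\<bar>(g (x - y + r n *\<^sub>R h) - g (x - y)) / r n\<bar> \<le> C"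
        using has_dd_increment_bound[OF d C(2), of "x - y" "r n"] r(1)
        by (simp add: abs_divide divide_le_eq)
      then show "norm (?q n y) \<le> C * norm (H y)"
        using mult_right_mono[OF _ abs_ge_zero[of "H y"]]
        by (simp only: real_norm_def abs_mult mult.commute[of "\<bar>H y\<bar>"])
    qed
  qed auto
  moreover have q_eq: "(\<integral>y. ?q n y \<partial>lborel)
      = (conv H g (x + (0 + r n) *\<^sub>R h) - conv H g (x + 0 *\<^sub>R h)) / r n" for n
  proof -
    have "?q n = (\<lambda>y. (H y * g (x + r n *\<^sub>R h - y) - H y * g (x - y)) / r n)"
      by (simp add: fun_eq_iff algebra_simps diff_divide_distrib)
    then show ?thesis
      unfolding conv_def using integrable_conv[OF H g] by simp
  qed
  ultimately show "((\<lambda>s. (conv H g (x + (0 + s) *\<^sub>R h) - conv H g (x + 0 *\<^sub>R h)) / s) \<circ> r)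
      \<longlonglongrightarrow> conv H g' x"
    unfolding q_eq by (simp only: o_def conv_def[of H g' x])
qed

lemma conv_continuous:
  fixes H g :: "'a::euclidean_space \<Rightarrow> real"
  assumes H: "integrable lborel H" and g: "cont_cpt g"
  shows "continuous_on UNIV (conv H g)"
  unfolding continuous_on_sequentially
proof (intro allI ballI impI, elim conjE)
  fix x and a :: "nat \<Rightarrow> 'a"
  assume a: "a \<longlonglongrightarrow> x"
  obtain C where C: "C \<ge> 0" "\<And>x. \<bar>g x\<bar> \<le> C" using cont_cpt_bounded[OF g] by blast
  have [measurable]: "g \<in> borel_measurable borel" "H \<in> borel_measurable borel"
    using g H cont_cpt_measurable by auto
  have c: "isCont g z" for z
    using cont_cpt_continuous[OF g] by (simp add: continuous_on_eq_continuous_at)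
  have "(\<lambda>n. \<integral>y. H y * g (a n - y) \<partial>lborel) \<longlonglongrightarrow> (\<integral>y. H y * g (x - y) \<partial>lborel)"
  proof (rule integral_dominated_convergence[where w = "\<lambda>y. C * norm (H y)"])
    show "integrable lborel (\<lambda>y. C * norm (H y))" using H by simp
    show "AE y in lborel. (\<lambda>n. H y * g (a n - y)) \<longlonglongrightarrow> H y * g (x - y)"
      by (intro AE_I2 tendsto_intros isCont_tendsto_compose[OF c] a)
    show "AE y in lborel. norm (H y * g (a n - y)) \<le> C * norm (H y)" for n
      using C by (intro AE_I2) (simp add: abs_mult mult.commute[of C] mult_left_mono)
  qed auto
  then show "(conv H g \<circ> a) \<longlonglongrightarrow> conv H g x" by (simp add: o_def conv_def)
qed

lemma conv_by_parts:
  fixes f g :: "'a::euclidean_space \<Rightarrow> real"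
  assumes f: "continuous_on UNIV f" "has_dd h f f'" "continuous_on UNIV f'"
    and g: "cont_cpt g" "has_dd h g g'" "continuous_on UNIV g'"
  shows "conv f' g x = conv f g' x"
proof -
  have "(\<integral>y. - g' (x - y) * f y \<partial>lborel) = - (\<integral>y. g (x - y) * f' y \<partial>lborel)"
  proof (rule integral_by_parts[OF cont_cpt_reflect[OF g(1)] has_dd_reflect[OF g(2)] _ f])
    show "continuous_on UNIV (\<lambda>y. - g' (x - y))"
      by (intro continuous_on_minus continuous_on_compose2[OF g(3)]) (auto intro!: continuous_intros)
  qed
  then show ?thesis by (simp add: conv_def mult.commute)
qed

lemma conv_cont_cpt:
  assumes H: "integrable lborel H" and g: "cont_cpt g" and B: "\<And>y. B < norm y \<Longrightarrow> H y = 0"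
  shows "cont_cpt (conv H g)"
proof -
  obtain B' where B': "\<And>x. B' < norm x \<Longrightarrow> g x = 0" using g by (auto simp: cont_cpt_def)
  have "conv H g x = 0" if "B + B' < norm x" for x
  proof -
    have "H y * g (x - y) = 0" for y
    proof (cases "B < norm y")
      case False
      then have "B' < norm (x - y)" using norm_triangle_ineq2[of x y] that by simp
      then show ?thesis using B' by simp
    qed (simp add: B)
    then show ?thesis by (simp only: conv_def integral_zero)
  qed
  then show ?thesis using conv_continuous[OF H g] by (auto simp: cont_cpt_def)
qed

lemma conv_diff:
  "integrable lborel H \<Longrightarrow> cont_cpt f \<Longrightarrow> cont_cpt g \<Longrightarrow>
    conv H (\<lambda>x. f x - g x) x = conv H f x - conv H g x"
  using integrable_conv[of H f x] integrable_conv[of H g x]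
  by (simp add: conv_def right_diff_distrib)

lemma conv_sum:
  "integrable lborel H \<Longrightarrow> (\<And>i. i \<in> I \<Longrightarrow> cont_cpt (f i)) \<Longrightarrow>
    conv H (\<lambda>x. \<Sum>i\<in>I. f i x) x = (\<Sum>i\<in>I. conv H (f i) x)"
  using integrable_conv[of H _ x] by (simp add: conv_def sum_distrib_left)

text \<open>Only the values of the convolved function within the range of the kernel matter. This allows
  the pressure and the stress to be cut off to an annulus without differentiating the cutoff.\<close>
lemma conv_local:
  assumes "\<And>y. g (x - y) \<noteq> 0 \<Longrightarrow> y \<in> A"
  shows "conv (\<lambda>y. indicator A y * F y) g x = conv F g x"
  unfolding conv_def using assms by (intro Bochner_Integration.integral_cong) (auto simp: indicator_def)

text \<open>Jensen's inequality for the measure \<open>k (x - y) dy\<close>, by splitting \<open>k\<close> into two square roots.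
  Integrated in \<open>x\<close> it gives Young's inequality for a nonnegative kernel.\<close>
lemma conv_square_bound:
  fixes H k :: "'a::euclidean_space \<Rightarrow> real"
  assumes H: "integrable lborel H" "integrable lborel (\<lambda>y. (H y)^2)"
    and k: "cont_cpt k" "\<And>x. k x \<ge> 0"
  shows "(conv H k x)^2 \<le> (\<integral>y. k y \<partial>lborel) * conv (\<lambda>y. (H y)^2) k x"
proof -
  have [measurable]: "k \<in> borel_measurable borel" using k cont_cpt_measurable by auto
  have e1: "sqrt (k z) * (sqrt (k z) * c) = c * k z" for z c
  proof -
    have "sqrt (k z) * (sqrt (k z) * c) = (sqrt (k z))^2 * c"
      by (simp only: power2_eq_square mult.assoc)
    then show ?thesis using k(2) by simp
  qed
  have e2: "(sqrt (k z) * c)^2 = c^2 * k z" for z c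
    using k(2) by (simp add: power_mult_distrib)
  have e3: "(sqrt (k z))^2 = k z" for z
    using k(2) by simp
  have "(\<integral>y. sqrt (k (x - y)) * (sqrt (k (x - y)) * H y) \<partial>lborel)^2 \<le>
      (\<integral>y. (sqrt (k (x - y)))^2 \<partial>lborel) * (\<integral>y. (sqrt (k (x - y)) * H y)^2 \<partial>lborel)"
    by (rule Cauchy_Schwarz_integral; unfold e1 e2 e3)
      (fact cont_cpt_integrable[OF cont_cpt_reflect[OF k(1)]] integrable_conv[OF H(2) k(1)]
        integrable_conv[OF H(1) k(1)])+
  then show ?thesis
    unfolding e1 e2 e3 conv_def by (simp add: integral_reflect)
qed

lemma conv_bound:
  fixes H g :: "'a::euclidean_space \<Rightarrow> real"
  assumes H: "integrable lborel H" "integrable lborel (\<lambda>y. (H y)^2)" and g: "cont_cpt g"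
  shows "(conv H g x)^2 \<le> (\<integral>y. (H y)^2 \<partial>lborel) * (\<integral>y. (g y)^2 \<partial>lborel)"
proof -
  have g2: "cont_cpt (\<lambda>y. (g y)^2)"
    unfolding power2_eq_square by (intro cont_cpt_mult_left g cont_cpt_continuous)
  have "(\<integral>y. H y * g (x - y) \<partial>lborel)^2
      \<le> (\<integral>y. (H y)^2 \<partial>lborel) * (\<integral>y. (g (x - y))^2 \<partial>lborel)"
    by (rule Cauchy_Schwarz_integral[OF H(2)])
      (fact cont_cpt_integrable[OF cont_cpt_reflect[OF g2]] integrable_conv[OF H(1) g])+
  also have "(\<integral>y. (g (x - y))^2 \<partial>lborel) = (\<integral>y. (g y)^2 \<partial>lborel)"
    using integral_reflect[of "\<lambda>y. (g y)^2" x] cont_cpt_measurable[OF g2] by simp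
  finally show ?thesis by (simp add: conv_def)
qed

lemma integral_conv:
  fixes F k :: "'a::euclidean_space \<Rightarrow> real"
  assumes F: "integrable lborel F" and k: "cont_cpt k"
  shows "integrable lborel (conv F k)"
    and "(\<integral>x. conv F k x \<partial>lborel) = (\<integral>y. k y \<partial>lborel) * (\<integral>y. F y \<partial>lborel)"
proof -
  have [measurable]: "k \<in> borel_measurable borel" "F \<in> borel_measurable borel"
    using k F cont_cpt_measurable by auto
  have sh: "(\<integral>x. g (x - y) \<partial>lborel) = (\<integral>x. g x \<partial>lborel)" if "g \<in> borel_measurable borel"
    for g :: "'a \<Rightarrow> real" and y
    using integral_lborel_translation[of g "- y"] that by simp
  have ik: "integrable lborel (\<lambda>x. k (x - y))" for y
  proof -
    have "cont_cpt (\<lambda>x. k (- (y - x)))"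
      using cont_cpt_reflect[OF cont_cpt_reflect[OF k, of 0], of y] by simp
    from cont_cpt_integrable[OF this] show ?thesis by simp
  qed
  have prod: "integrable (lborel \<Otimes>\<^sub>M lborel) (\<lambda>(y, x). F y * k (x - y))"
  proof (rule lborel_pair.Fubini_integrable)
    have "(\<integral>x. norm (F y * k (x - y)) \<partial>lborel) = (\<integral>x. \<bar>k x\<bar> \<partial>lborel) * norm (F y)" for y
      using sh[of "\<lambda>x. \<bar>k x\<bar>" y] by (simp add: abs_mult mult.commute)
    then show "integrable lborel (\<lambda>y. \<integral>x. norm (case (y, x) of (y, x) \<Rightarrow> F y * k (x - y)) \<partial>lborel)"
      using F by simp
    show "AE y in lborel. integrable lborel (\<lambda>x. case (y, x) of (y, x) \<Rightarrow> F y * k (x - y))"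
      using ik by simp
  qed measurable
  have "integrable lborel (\<lambda>x. \<integral>y. F y * k (x - y) \<partial>lborel)"
    using lborel_pair.integrable_snd[OF prod] by simp
  then show "integrable lborel (conv F k)" by (simp add: conv_def[abs_def])
  have "(\<integral>x. conv F k x \<partial>lborel) = (\<integral>y. (\<integral>x. F y * k (x - y) \<partial>lborel) \<partial>lborel)"
    unfolding conv_def using lborel_pair.Fubini_integral[OF prod] by simp
  also have "\<dots> = (\<integral>y. k y \<partial>lborel) * (\<integral>y. F y \<partial>lborel)"
    using sh[of k] by (simp add: mult.commute)
  finally show "(\<integral>x. conv F k x \<partial>lborel) = (\<integral>y. k y \<partial>lborel) * (\<integral>y. F y \<partial>lborel)" .
qed

lemma conv_L2_bound:
  fixes H k :: "'a::euclidean_space \<Rightarrow> real"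
  assumes H: "integrable lborel H" "integrable lborel (\<lambda>y. (H y)^2)"
    and k: "cont_cpt k" "\<And>x. k x \<ge> 0"
  shows "integrable lborel (\<lambda>x. (conv H k x)^2)"
    and "(\<integral>x. (conv H k x)^2 \<partial>lborel) \<le> (\<integral>y. k y \<partial>lborel)^2 * (\<integral>y. (H y)^2 \<partial>lborel)"
proof -
  have [measurable]: "conv H k \<in> borel_measurable borel"
    using conv_continuous[OF H(1) k(1)] by (rule borel_measurable_continuous_onI)
  note ic = integral_conv[OF H(2) k(1)]
  have b: "(conv H k x)^2 \<le> (\<integral>y. k y \<partial>lborel) * conv (\<lambda>y. (H y)^2) k x" for x
    by (rule conv_square_bound[OF H k])
  show i: "integrable lborel (\<lambda>x. (conv H k x)^2)"
  proof (rule Bochner_Integration.integrable_bound)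
    show "integrable lborel (\<lambda>x. (\<integral>y. k y \<partial>lborel) * conv (\<lambda>y. (H y)^2) k x)"
      using ic(1) by simp
    show "AE x in lborel. norm ((conv H k x)^2) \<le> norm ((\<integral>y. k y \<partial>lborel) * conv (\<lambda>y. (H y)^2) k x)"
      using b by (intro AE_I2) (simp add: order_trans[OF b abs_ge_self])
  qed measurable
  have "(\<integral>x. (conv H k x)^2 \<partial>lborel) \<le> (\<integral>x. (\<integral>y. k y \<partial>lborel) * conv (\<lambda>y. (H y)^2) k x \<partial>lborel)"
    by (intro integral_mono i b) (use ic(1) in simp)
  also have "\<dots> = (\<integral>y. k y \<partial>lborel)^2 * (\<integral>y. (H y)^2 \<partial>lborel)"
    using ic(2) by (simp add: power2_eq_square)
  finally show "(\<integral>x. (conv H k x)^2 \<partial>lborel) \<le> (\<integral>y. k y \<partial>lborel)^2 * (\<integral>y. (H y)^2 \<partial>lborel)" .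
qed

section \<open>The Hessian and the Laplacian\<close>

text \<open>For \<open>v\<close> with gradient \<open>v1\<close>, Hessian \<open>v2\<close> and third derivatives \<open>v3\<close>, two integrations by parts
  turn \<open>\<integral> \<partial>_a^2 v \<partial>_b^2 v\<close> into \<open>\<integral> (\<partial>_a \<partial>_b v)^2\<close>; summing over \<open>a\<close> and \<open>b\<close>, the square of the Laplacian has the
  same integral as the full Hessian. This identity takes the place of the Calderon-Zygmund
  theorem.\<close>
lemma Hessian_L2_bound:
  fixes v :: "real^'n \<Rightarrow> real"
  assumes c1: "\<And>i. cont_cpt (v1 i)" and c2: "\<And>i j. cont_cpt (v2 i j)"
    and c3: "\<And>i j k. cont_cpt (v3 i j k)"
    and d1: "\<And>i j. has_dd (axis j 1) (v1 i) (v2 i j)"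
    and d2: "\<And>i j k. has_dd (axis k 1) (v2 i j) (v3 i j k)"
    and sym: "\<And>i j. v3 i i j = v3 j i i"
  shows "(\<integral>x. (v2 i j x)^2 \<partial>lborel) \<le> (\<integral>x. (\<Sum>a\<in>UNIV. v2 a a x)^2 \<partial>lborel)"
proof -
  have int: "integrable lborel (\<lambda>x. v2 a b x * v2 c d x)" for a b c d
    by (intro cont_cpt_integrable cont_cpt_mult_left c2 cont_cpt_continuous)
  have swap: "(\<integral>x. v2 a a x * v2 b b x \<partial>lborel) = (\<integral>x. (v2 a b x)^2 \<partial>lborel)" for a b
  proof -
    have "(\<integral>x. v2 a a x * v2 b b x \<partial>lborel) = - (\<integral>x. v1 a x * v3 b b a x \<partial>lborel)"
      by (rule integral_by_parts[OF c1 d1 _ _ d2])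
        (simp_all add: c2 c3 cont_cpt_continuous)
    also have "\<dots> = - (\<integral>x. v1 a x * v3 a b b x \<partial>lborel)" by (simp add: sym)
    also have "\<dots> = (\<integral>x. v2 a b x * v2 a b x \<partial>lborel)"
      using integral_by_parts[OF c1[of a] d1[of b a] _ _ d2[of b a b]]
      by (simp add: c2 c3 cont_cpt_continuous)
    finally show ?thesis by (simp add: power2_eq_square)
  qed
  have "(\<integral>x. (\<Sum>a\<in>UNIV. v2 a a x)^2 \<partial>lborel) = (\<integral>x. (\<Sum>a\<in>UNIV. \<Sum>b\<in>UNIV. v2 a a x * v2 b b x) \<partial>lborel)"
    by (simp add: power2_eq_square sum_product)
  also have "\<dots> = (\<Sum>a\<in>UNIV. \<Sum>b\<in>UNIV. (\<integral>x. (v2 a b x)^2 \<partial>lborel))"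
    using int by (simp add: swap)
  also have "\<dots> \<ge> (\<Sum>b\<in>UNIV. (\<integral>x. (v2 i b x)^2 \<partial>lborel))"
    by (rule member_le_sum) (auto intro!: sum_nonneg)
  moreover have "(\<Sum>b\<in>UNIV. (\<integral>x. (v2 i b x)^2 \<partial>lborel)) \<ge> (\<integral>x. (v2 i j x)^2 \<partial>lborel)"
    by (rule member_le_sum) auto
  ultimately show ?thesis by linarith
qed

section \<open>Regularised Newtonian potentials\<close>

text \<open>The right-hand formula may be undefined far to the left, as \<open>t powr (- 1/2)\<close> is, so its
  derivative is only assumed from \<open>c\<close> on.\<close>
lemma DERIV_glue:
  fixes f g :: "real \<Rightarrow> real"
  assumes f: "\<And>t. t \<le> c \<Longrightarrow> (f has_real_derivative f' t) (at t)"
    and g: "\<And>t. t \<ge> c \<Longrightarrow> (g has_real_derivative g' t) (at t)"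
    and eq: "f c = g c" "f' c = g' c"
  shows "((\<lambda>t. if t \<le> c then f t else g t) has_real_derivative (if t \<le> c then f' t else g' t)) (at t)"
    (is "(?h has_real_derivative _) _")
proof -
  consider "t < c" | "t > c" | "t = c" by linarith
  then show ?thesis
  proof cases
    case 1
    then have "(?h has_real_derivative f' t) (at t)"
      by (intro has_field_derivative_transform_within_open[OF f, where S = "{..<c}"]) auto
    then show ?thesis using 1 by simp
  next
    case 2
    then have "(?h has_real_derivative g' t) (at t)"
      by (intro has_field_derivative_transform_within_open[OF g, where S = "{c<..}"]) auto
    then show ?thesis using 2 by simp
  next
    case 3
    have "((\<lambda>y. (?h y - ?h c) / (y - c)) \<longlongrightarrow> f' c) (at_left c)"
    proof (rule Lim_transform_eventually)
      show "((\<lambda>y. (f y - f c) / (y - c)) \<longlongrightarrow> f' c) (at_left c)"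
        using f[of c] by (simp add: has_field_derivative_iff filterlim_at_split)
      show "\<forall>\<^sub>F y in at_left c. (f y - f c) / (y - c) = (?h y - ?h c) / (y - c)"
        by (simp add: eventually_at_filter)
    qed
    moreover have "((\<lambda>y. (?h y - ?h c) / (y - c)) \<longlongrightarrow> f' c) (at_right c)"
    proof (rule Lim_transform_eventually)
      show "((\<lambda>y. (g y - g c) / (y - c)) \<longlongrightarrow> f' c) (at_right c)"
        using g[of c] by (simp add: has_field_derivative_iff filterlim_at_split eq)
      show "\<forall>\<^sub>F y in at_right c. (g y - g c) / (y - c) = (?h y - ?h c) / (y - c)"
        by (simp add: eventually_at_filter eq)
    qed
    ultimately show ?thesis
      using 3 by (simp add: has_field_derivative_iff filterlim_at_split)
  qed
qed

definition pos_sq :: "real \<Rightarrow> real" where "pos_sq s = (max 0 s)^2"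

lemma DERIV_pos_sq: "(pos_sq has_real_derivative 2 * max 0 s) (at s)"
proof -
  have "((\<lambda>s. if s \<le> 0 then 0 else s^2) has_real_derivative (if s \<le> 0 then 0 else 2 * s)) (at s)"
    by (rule DERIV_glue) (auto intro!: derivative_eq_intros)
  moreover have "pos_sq = (\<lambda>s. if s \<le> 0 then 0 else s^2)" by (auto simp: pos_sq_def fun_eq_iff)
  moreover have "2 * max 0 s = (if s \<le> 0 then 0 else 2 * s)" by simp
  ultimately show ?thesis by simp
qed

text \<open>The radial profile of a regularised Newtonian potential as a function of \<open>t = |x|^2\<close>. Up to a
  constant factor the Newtonian potential is \<open>- t powr (- 1/2)\<close>; for \<open>t \<le> 1\<close> it is replaced by its Taylor polynomial of degree 3
  at \<open>t = 1\<close>. Third order contact makes the potential three times continuously differentiable, as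
  needed for the Hessian estimate, and the Laplacian turns out to be a nonnegative bump. The
  functions \<open>prof1\<close>, \<open>prof2\<close>, \<open>prof3\<close> are the successive derivatives.\<close>
definition prof0 :: "real \<Rightarrow> real" where
  "prof0 t = (if t \<le> 1 then - (1 + (1 - t) / 2 + 3/8 * (1 - t)^2 + 5/16 * (1 - t)^3)
    else - (t powr (-1/2)))"

definition prof1 :: "real \<Rightarrow> real" where
  "prof1 t = (if t \<le> 1 then 1/2 + 3/4 * (1 - t) + 15/16 * (1 - t)^2 else 1/2 * t powr (-3/2))"

definition prof2 :: "real \<Rightarrow> real" where
  "prof2 t = (if t \<le> 1 then - 3/4 - 15/8 * (1 - t) else - 3/4 * t powr (-5/2))"

definition prof3 :: "real \<Rightarrow> real" where
  "prof3 t = (if t \<le> 1 then 15/8 else 15/8 * t powr (-7/2))"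

lemma DERIV_prof0: "(prof0 has_real_derivative prof1 t) (at t)"
  unfolding prof0_def[abs_def] prof1_def
  by (rule DERIV_glue) (auto intro!: derivative_eq_intros simp: field_simps power2_eq_square)

lemma DERIV_prof1: "(prof1 has_real_derivative prof2 t) (at t)"
  unfolding prof1_def[abs_def] prof2_def
  by (rule DERIV_glue) (auto intro!: derivative_eq_intros simp: field_simps power2_eq_square)

lemma DERIV_prof2: "(prof2 has_real_derivative prof3 t) (at t)"
  unfolding prof2_def[abs_def] prof3_def
  by (rule DERIV_glue) (auto intro!: derivative_eq_intros simp: field_simps power2_eq_square)

lemma continuous_prof:
  "continuous_on UNIV prof0" "continuous_on UNIV prof1" "continuous_on UNIV prof2"
  using DERIV_prof0 DERIV_prof1 DERIV_prof2
  by (auto intro!: continuous_at_imp_continuous_on DERIV_isCont)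

lemma continuous_prof3: "continuous_on UNIV prof3"
proof -
  have "continuous_on ({..1} \<union> {1..}) (\<lambda>t. if t \<le> 1 then 15/8 else 15/8 * t powr (-7/2) :: real)"
    by (rule continuous_on_If) (auto intro!: continuous_intros)
  moreover have "{..1} \<union> {1..} = (UNIV :: real set)" by auto
  ultimately show ?thesis by (simp add: prof3_def[abs_def])
qed

lemma has_dd_coord: "has_dd (axis k 1) (\<lambda>x::real^'n. x $ i) (\<lambda>x. if i = k then 1 else 0)"
  unfolding has_dd_def by (auto intro!: derivative_eq_intros simp: axis_def)

lemma has_dd_inner_self: "has_dd h (\<lambda>x. x \<bullet> x) (\<lambda>x. 2 * (x \<bullet> h))"
  unfolding has_dd_def
proof
  fix x
  have "(x + t *\<^sub>R h) \<bullet> (x + t *\<^sub>R h) = x \<bullet> x + 2 * t * (x \<bullet> h) + t^2 * (h \<bullet> h)" for t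
    by (simp add: inner_add_left inner_add_right power2_eq_square algebra_simps inner_commute)
  then show "((\<lambda>t. (x + t *\<^sub>R h) \<bullet> (x + t *\<^sub>R h)) has_real_derivative 2 * (x \<bullet> h)) (at 0)"
    by (auto intro!: derivative_eq_intros)
qed

text \<open>The potential at scale \<open>s\<close>, with its partial derivatives up to order three. Outside the ball
  of radius \<open>s\<close> it is \<open>- 1 / |x|\<close> for every \<open>s\<close>, so the difference of two of them has compact support.\<close>
definition pot :: "real \<Rightarrow> real^3 \<Rightarrow> real" where
  "pot s x = 1 / s * prof0 (1 / s^2 * (x \<bullet> x))"

definition pot1 :: "real \<Rightarrow> 3 \<Rightarrow> real^3 \<Rightarrow> real" where
  "pot1 s i x = 2 / s^3 * (x $ i * prof1 (1 / s^2 * (x \<bullet> x)))"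

definition pot2 :: "real \<Rightarrow> 3 \<Rightarrow> 3 \<Rightarrow> real^3 \<Rightarrow> real" where
  "pot2 s i j x = 2 / s^3 * ((if i = j then 1 else 0) * prof1 (1 / s^2 * (x \<bullet> x))
     + x $ i * (prof2 (1 / s^2 * (x \<bullet> x)) * (2 / s^2 * x $ j)))"

definition pot3 :: "real \<Rightarrow> 3 \<Rightarrow> 3 \<Rightarrow> 3 \<Rightarrow> real^3 \<Rightarrow> real" where
  "pot3 s i j k x = 4 / s^5 * (((if i = j then x $ k else 0) + (if i = k then x $ j else 0)
       + (if j = k then x $ i else 0)) * prof2 (1 / s^2 * (x \<bullet> x))
     + 2 / s^2 * (x $ i * x $ j * x $ k) * prof3 (1 / s^2 * (x \<bullet> x)))"

text \<open>The Laplacian of \<open>pot s\<close>, an unnormalised mollifier at scale \<open>s\<close>, and its gradient.\<close>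
definition bump :: "real \<Rightarrow> real^3 \<Rightarrow> real" where
  "bump s x = 105 / (8 * s^3) * (max 0 (1 - 1 / s^2 * (x \<bullet> x)))^2"

definition bump1 :: "real \<Rightarrow> 3 \<Rightarrow> real^3 \<Rightarrow> real" where
  "bump1 s i x = - 105 / (2 * s^5) * (max 0 (1 - 1 / s^2 * (x \<bullet> x)) * x $ i)"

lemma has_dd_radial:
  assumes "\<And>t. (b has_real_derivative b' t) (at t)"
  shows "has_dd h (\<lambda>x. b (c * (x \<bullet> x))) (\<lambda>x. b' (c * (x \<bullet> x)) * (c * (2 * (x \<bullet> h))))"
  by (rule has_dd_chain[OF assms has_dd_cmult[OF has_dd_inner_self]])

lemma has_dd_eq: "has_dd h f f' \<Longrightarrow> (\<And>x. f' x = g' x) \<Longrightarrow> has_dd h f g'"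
  by (simp add: has_dd_def)

lemma has_dd_pot:
  assumes "s > 0"
  shows "has_dd (axis i 1) (pot s) (pot1 s i)"
    and "has_dd (axis j 1) (pot1 s i) (pot2 s i j)"
    and "has_dd (axis k 1) (pot2 s i j) (pot3 s i j k)"
proof -
  show "has_dd (axis i 1) (pot s) (pot1 s i)"
    unfolding pot_def[abs_def]
    by (rule has_dd_eq[OF has_dd_cmult[OF has_dd_radial[OF DERIV_prof0]]])
      (use assms in \<open>simp add: inner_axis pot1_def field_simps power3_eq_cube power2_eq_square\<close>)
  show "has_dd (axis j 1) (pot1 s i) (pot2 s i j)"
    unfolding pot1_def[abs_def]
    by (rule has_dd_eq[OF has_dd_cmult[OF has_dd_mult[OF has_dd_coord has_dd_radial[OF DERIV_prof1]]]])
      (simp add: pot2_def inner_axis)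
  show "has_dd (axis k 1) (pot2 s i j) (pot3 s i j k)"
    unfolding pot2_def[abs_def]
    apply (rule has_dd_eq[OF has_dd_cmult[OF has_dd_add[OF
        has_dd_cmult[OF has_dd_radial[OF DERIV_prof1]]
        has_dd_mult[OF has_dd_coord has_dd_mult[OF has_dd_radial[OF DERIV_prof2]
          has_dd_cmult[OF has_dd_coord]]]]]])
    using assms by (auto simp: pot3_def inner_axis field_simps eval_nat_numeral)
qed

lemma has_dd_bump:
  assumes "s > 0"
  shows "has_dd h (bump s) (\<lambda>x. \<Sum>i\<in>UNIV. h $ i * bump1 s i x)"
proof -
  have "((\<lambda>t. (max 0 (1 - t))^2) has_real_derivative - 2 * max 0 (1 - t)) (at t)" for t :: real
  proof -
    have "((\<lambda>t. 1 - t) has_real_derivative - 1) (at t)" by (auto intro!: derivative_eq_intros)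
    from DERIV_chain2[OF DERIV_pos_sq[unfolded pos_sq_def[abs_def]] this] show ?thesis by simp
  qed
  from has_dd_cmult[OF has_dd_radial[OF this]] show ?thesis
    unfolding bump_def[abs_def]
  proof (rule has_dd_eq)
    fix x
    have "(\<Sum>i\<in>UNIV. h $ i * bump1 s i x)
        = (\<Sum>i\<in>UNIV. - 105 / (2 * s^5) * max 0 (1 - 1 / s^2 * (x \<bullet> x)) * (x $ i * h $ i))"
      by (intro sum.cong refl) (simp add: bump1_def)
    also have "\<dots> = - 105 / (2 * s^5) * max 0 (1 - 1 / s^2 * (x \<bullet> x)) * (x \<bullet> h)"
      by (simp only: sum_distrib_left[symmetric] inner_vec_def inner_real_def)
    finally show "105 / (8 * s^3) * (- 2 * max 0 (1 - 1 / s^2 * (x \<bullet> x)) * (1 / s^2 * (2 * (x \<bullet> h))))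
        = (\<Sum>i\<in>UNIV. h $ i * bump1 s i x)"
      using assms by (simp add: field_simps eval_nat_numeral)
  qed
qed

lemma continuous_pot:
  "continuous_on UNIV (pot s)" "continuous_on UNIV (pot1 s i)" "continuous_on UNIV (pot2 s i j)"
  "continuous_on UNIV (pot3 s i j k)" "continuous_on UNIV (bump s)" "continuous_on UNIV (bump1 s i)"
proof -
  have r: "continuous_on UNIV (\<lambda>x::real^3. b (c * (x \<bullet> x)))"
    if "continuous_on UNIV b" for b :: "real \<Rightarrow> real" and c
    by (rule continuous_on_compose2[OF that]) (auto intro!: continuous_intros)
  note r = r[OF continuous_prof(1)] r[OF continuous_prof(2)] r[OF continuous_prof(3)]
    r[OF continuous_prof3]
  have d: "continuous_on UNIV (\<lambda>x::real^3. if Q then x $ m else 0)" for Q m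
    by (cases Q) (auto intro!: continuous_intros)
  show "continuous_on UNIV (pot s)" "continuous_on UNIV (pot1 s i)" "continuous_on UNIV (pot2 s i j)"
    "continuous_on UNIV (pot3 s i j k)" "continuous_on UNIV (bump s)" "continuous_on UNIV (bump1 s i)"
    unfolding pot_def[abs_def] pot1_def[abs_def] pot2_def[abs_def] pot3_def[abs_def]
      bump_def[abs_def] bump1_def[abs_def]
    by (intro r d continuous_on_mult continuous_on_add continuous_on_diff continuous_on_const
        continuous_on_power continuous_on_max continuous_on_component continuous_on_inner continuous_on_id)+
qed

lemma pot_outside:
  assumes "s > 0" "s < norm x"
  shows "pot s x = - 1 / norm x"
proof -
  have "norm x > 0" using assms by linarith
  have gt: "1 < (norm x / s)^2" using assms by (intro one_less_power) auto
  have "((norm x / s)^2) powr (-1/2) = ((norm x / s) powr 2) powr (-1/2)"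
    using assms \<open>norm x > 0\<close> by (simp add: powr_numeral)
  also have "\<dots> = (norm x / s) powr (-1)"
    by (simp only: powr_powr) simp
  also have "\<dots> = s / norm x"
    using assms \<open>norm x > 0\<close> by (subst powr_minus) simp
  finally have pw: "((norm x / s)^2) powr (-1/2) = s / norm x" .
  have t: "1 / s^2 * (x \<bullet> x) = (norm x / s)^2"
    by (simp add: power2_norm_eq_inner[symmetric] power_divide)
  then show ?thesis
    using assms gt unfolding pot_def t prof0_def pw by (simp only: if_not_P not_le) simp
qed

lemma laplacian_pot:
  assumes "s > 0"
  shows "(\<Sum>i\<in>UNIV. pot2 s i i x) = bump s x"
proof -
  define t where "t = 1 / s^2 * (x \<bullet> x)"
  have sx: "(\<Sum>i\<in>UNIV. x $ i * x $ i) = s^2 * t"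
    using assms by (simp add: t_def inner_vec_def)
  have "pot2 s i i x = 2 / s^3 * (prof1 t + x $ i * x $ i * (prof2 t * (2 / s^2)))" for i
    unfolding pot2_def t_def[symmetric] by (simp only: refl if_True) (simp add: mult.assoc mult.left_commute)
  then have "(\<Sum>i\<in>UNIV. pot2 s i i x)
      = 2 / s^3 * (\<Sum>i\<in>(UNIV::3 set). prof1 t + x $ i * x $ i * (prof2 t * (2 / s^2)))"
    by (simp only: sum_distrib_left)
  also have "\<dots> = 2 / s^3 * (3 * prof1 t + 2 * t * prof2 t)"
    unfolding sum.distrib sum_distrib_right[symmetric] sx using assms by simp
  also have "3 * prof1 t + 2 * t * prof2 t = 105 / 16 * (max 0 (1 - t))^2"
  proof (cases "t \<le> 1")
    case True
    then show ?thesis by (simp add: prof1_def prof2_def max_def power2_eq_square field_simps)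
  next
    case False
    \<comment> \<open>Here the potential is harmonic: \<open>6 b' + 4 t b'' = 0\<close> for \<open>b = - t powr (- 1/2)\<close>.\<close>
    then have "t * t powr (-5/2) = t powr (-3/2)"
      using powr_mult_base[of t "-5/2"] by simp
    with False show ?thesis by (simp add: prof1_def prof2_def)
  qed
  finally show ?thesis using assms by (simp add: bump_def t_def)
qed

lemma bump_nonneg: "s > 0 \<Longrightarrow> bump s x \<ge> 0"
  by (simp add: bump_def)

lemma bump_outside:
  assumes "s > 0" "s \<le> norm x"
  shows "bump s x = 0" "bump1 s i x = 0"
proof -
  have "1 - 1 / s^2 * (x \<bullet> x) \<le> 0"
    using power_mono[OF assms(2), of 2] assms by (simp add: power2_norm_eq_inner)
  then show "bump s x = 0" "bump1 s i x = 0" by (simp_all add: bump_def bump1_def max_absorb1)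
qed

lemma cont_cpt_bump: "s > 0 \<Longrightarrow> cont_cpt (bump s)" "s > 0 \<Longrightarrow> cont_cpt (bump1 s i)"
  unfolding cont_cpt_def using continuous_pot bump_outside
  by (auto intro!: exI[of _ s])

lemma bump1_bound:
  assumes "s > 0"
  shows "\<bar>bump1 s i x\<bar> \<le> 53 / s^4"
proof (cases "norm x < s")
  case True
  have "max 0 (1 - 1 / s^2 * (x \<bullet> x)) \<le> 1" by simp
  moreover have "\<bar>x $ i\<bar> \<le> s" using component_le_norm_cart[of x i] True by linarith
  ultimately have "\<bar>max 0 (1 - 1 / s^2 * (x \<bullet> x)) * x $ i\<bar> \<le> 1 * s"
    unfolding abs_mult by (intro mult_mono) auto
  then have "105 / (2 * s^5) * \<bar>max 0 (1 - 1 / s^2 * (x \<bullet> x)) * x $ i\<bar> \<le> 105 / (2 * s^5) * s"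
    using assms by (intro mult_left_mono) auto
  also have "\<dots> \<le> 53 / s^4" using assms by (simp add: field_simps eval_nat_numeral)
  finally show ?thesis using assms by (simp add: bump1_def abs_mult)
qed (use assms bump_outside in simp)

section \<open>Mollification\<close>

text \<open>The common integral of all the kernels \<open>bump s\<close>, carried along as a factor in place of a
  normalisation of the kernels.\<close>
definition bump_mass :: real where
  "bump_mass = (\<integral>x. bump 1 x \<partial>lborel)"

lemma bump_scale: "s > 0 \<Longrightarrow> bump s (s *\<^sub>R z) = bump 1 z / s^3"
  by (simp add: bump_def power2_eq_square field_simps)

lemma bump_uminus: "bump s (- z) = bump s z"
  by (simp add: bump_def)

lemma conv_bump_eq:
  fixes f :: "real^3 \<Rightarrow> real"
  assumes "s > 0" and [measurable]: "f \<in> borel_measurable borel"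
  shows "conv f (bump s) x = (\<integral>z. f (x - s *\<^sub>R z) * bump 1 z \<partial>lborel)"
proof -
  have [measurable]: "bump s \<in> borel_measurable borel"
    using continuous_pot(5) by (rule borel_measurable_continuous_onI)
  \<comment> \<open>The substitution is \<open>y = x - s z\<close>.\<close>
  have "conv f (bump s) x
      = \<bar>-s\<bar> ^ DIM(real^3) * (\<integral>z. f (x + (-s) *\<^sub>R z) * bump s (x - (x + (-s) *\<^sub>R z)) \<partial>lborel)"
    unfolding conv_def by (rule integral_lborel_affine) (use assms in auto)
  also have "\<dots> = s^3 * (\<integral>z. f (x - s *\<^sub>R z) * bump 1 z / s^3 \<partial>lborel)"
    using assms by (simp add: bump_scale)
  finally show ?thesis using assms by simp
qed

lemma integral_bump:
  assumes "s > 0" shows "(\<integral>x. bump s x \<partial>lborel) = bump_mass"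
proof -
  have [measurable]: "bump s \<in> borel_measurable borel"
    using continuous_pot(5) by (rule borel_measurable_continuous_onI)
  have "(\<integral>x. bump s x \<partial>lborel) = conv (\<lambda>_. 1) (bump s) 0"
    by (simp add: conv_def bump_uminus)
  also have "\<dots> = bump_mass"
    using conv_bump_eq[OF assms, of "\<lambda>_. 1" 0] by (simp add: bump_mass_def)
  finally show ?thesis .
qed

lemma bump_mass_pos: "bump_mass > 0"
proof -
  have "bump_mass \<ge> 0" unfolding bump_mass_def by (intro integral_nonneg_AE) (simp add: bump_nonneg)
  moreover have "bump_mass \<noteq> 0"
  proof
    assume "bump_mass = 0"
    then have "AE x in lborel. bump 1 x = 0"
      using integral_nonneg_eq_0_iff_AE[of lborel "bump 1"] cont_cpt_integrable[OF cont_cpt_bump(1)]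
      by (simp add: bump_mass_def bump_nonneg)
    from continuous_AE_zero[OF continuous_pot(5) this, of 0] show False
      by (simp add: bump_def)
  qed
  ultimately show ?thesis by simp
qed

lemma conv_bump_bound:
  fixes f :: "real^3 \<Rightarrow> real"
  assumes s: "s > 0" and f: "continuous_on UNIV f" and C: "\<And>y. dist x y \<le> s \<Longrightarrow> \<bar>f y\<bar> \<le> C"
  shows "\<bar>conv f (bump s) x\<bar> \<le> C * bump_mass"
proof -
  have b: "\<bar>f y * bump s (x - y)\<bar> \<le> C * bump s (x - y)" for y
    using C[of y] bump_outside(1)[OF s, of "x - y"] bump_nonneg[OF s, of "x - y"]
    by (cases "dist x y \<le> s") (auto simp: abs_mult dist_norm intro!: mult_right_mono)
  have i: "integrable lborel (\<lambda>y. bump s (x - y))"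
    by (intro cont_cpt_integrable cont_cpt_reflect cont_cpt_bump s)
  have "\<bar>conv f (bump s) x\<bar> \<le> (\<integral>y. \<bar>f y * bump s (x - y)\<bar> \<partial>lborel)"
    unfolding conv_def using integral_norm_bound[of lborel "\<lambda>y. f y * bump s (x - y)"] by simp
  also have "\<dots> \<le> (\<integral>y. C * bump s (x - y) \<partial>lborel)"
    by (intro integral_mono b integrable_mult_right i integrable_abs cont_cpt_integrable
        cont_cpt_mult_right f cont_cpt_reflect cont_cpt_bump s)
  also have "\<dots> = C * bump_mass"
    using integral_reflect[of "bump s" x] cont_cpt_measurable[OF cont_cpt_bump(1)[OF s]] integral_bump[OF s] by simp
  finally show ?thesis .
qed

lemma conv_bump_tendsto:
  fixes f :: "real^3 \<Rightarrow> real"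
  assumes f: "continuous_on UNIV f" and s: "\<And>n. s n > 0" "s \<longlonglongrightarrow> 0" "\<And>n. s n \<le> r"
  shows "(\<lambda>n. conv f (bump (s n)) x) \<longlonglongrightarrow> bump_mass * f x"
proof -
  have [measurable]: "f \<in> borel_measurable borel" "bump 1 \<in> borel_measurable borel"
    using f continuous_pot(5) borel_measurable_continuous_onI by auto
  have "compact (f ` cball x r)"
    using continuous_on_subset[OF f] by (intro compact_continuous_image) auto
  then obtain C where C: "\<And>y. y \<in> cball x r \<Longrightarrow> \<bar>f y\<bar> \<le> C"
    by (force dest!: compact_imp_bounded simp: bounded_iff)
  have "(\<lambda>n. \<integral>z. f (x - s n *\<^sub>R z) * bump 1 z \<partial>lborel) \<longlonglongrightarrow> (\<integral>z. f x * bump 1 z \<partial>lborel)"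
  proof (rule integral_dominated_convergence[where w = "\<lambda>z. C * bump 1 z"])
    show "integrable lborel (\<lambda>z. C * bump 1 z)"
      by (intro integrable_mult_right cont_cpt_integrable cont_cpt_bump) simp
    have c: "isCont f x" using f by (simp add: continuous_on_eq_continuous_at)
    have "(\<lambda>n. x - s n *\<^sub>R z) \<longlonglongrightarrow> x" for z
      using tendsto_diff[OF tendsto_const[of x] tendsto_scaleR[OF s(2) tendsto_const[of z]]] by simp
    then show "AE z in lborel. (\<lambda>n. f (x - s n *\<^sub>R z) * bump 1 z) \<longlonglongrightarrow> f x * bump 1 z"
      by (intro AE_I2 tendsto_mult tendsto_const isCont_tendsto_compose[OF c])
    show "AE z in lborel. norm (f (x - s n *\<^sub>R z) * bump 1 z) \<le> C * bump 1 z" for n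
    proof (rule AE_I2)
      fix z :: "real^3"
      show "norm (f (x - s n *\<^sub>R z) * bump 1 z) \<le> C * bump 1 z"
      proof (cases "norm z \<le> 1")
        case True
        have "norm (s n *\<^sub>R z) \<le> r"
          using mult_mono[OF s(3) True] s(1,3)[of n] by simp
        then have "\<bar>f (x - s n *\<^sub>R z)\<bar> \<le> C" by (intro C) (simp add: dist_norm)
        then show ?thesis
          using bump_nonneg[of 1 z] by (simp add: abs_mult mult_right_mono)
      qed (simp add: bump_outside)
    qed
  qed auto
  then show ?thesis
    using conv_bump_eq[OF s(1)] by (simp add: bump_mass_def mult.commute)
qed

section \<open>Truncated double Riesz transforms\<close>

text \<open>Only \<open>pot e - pot r\<close> is seen to vanish outside the ball from a formula; its derivatives then vanish
  there without computing them.\<close>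
lemma cutoff_pot:
  assumes e: "0 < e" "e \<le> r"
  shows "cont_cpt (\<lambda>x. pot1 e i x - pot1 r i x)"
    "cont_cpt (\<lambda>x. pot2 e i j x - pot2 r i j x)"
    "cont_cpt (\<lambda>x. pot3 e i j k x - pot3 r i j k x)"
    "r < norm x \<Longrightarrow> pot2 e i j x - pot2 r i j x = 0"
proof -
  have r: "r > 0" using e by simp
  have 0: "pot e x - pot r x = 0" if "r < norm x" for x
    using that e pot_outside[of e x] pot_outside[of r x] by simp
  note 1 = has_dd_zero_outside[OF has_dd_diff[OF has_dd_pot(1)[OF e(1)] has_dd_pot(1)[OF r]] 0]
  note 2 = has_dd_zero_outside[OF has_dd_diff[OF has_dd_pot(2)[OF e(1)] has_dd_pot(2)[OF r]] 1]
  note 3 = has_dd_zero_outside[OF has_dd_diff[OF has_dd_pot(3)[OF e(1)] has_dd_pot(3)[OF r]] 2]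
  show "cont_cpt (\<lambda>x. pot1 e i x - pot1 r i x)"
    "cont_cpt (\<lambda>x. pot2 e i j x - pot2 r i j x)"
    "cont_cpt (\<lambda>x. pot3 e i j k x - pot3 r i j k x)"
    unfolding cont_cpt_def using 1 2 3
    by (auto intro!: continuous_on_diff continuous_pot exI[of _ r])
  show "r < norm x \<Longrightarrow> pot2 e i j x - pot2 r i j x = 0" by (rule 2)
qed

text \<open>Apply the Hessian bound to the convolution of \<open>H\<close> with \<open>pot e - pot r\<close>. Its Laplacian is the difference of two
  mollifications of \<open>H\<close>, each of norm at most \<open>bump_mass\<close> times that of \<open>H\<close>, so the bound
  does not degenerate as \<open>e\<close> tends to zero.\<close>
lemma truncated_Riesz_L2:
  fixes H :: "real^3 \<Rightarrow> real"
  assumes e: "0 < e" "e \<le> r"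
    and H: "integrable lborel H" "integrable lborel (\<lambda>y. (H y)^2)" "\<And>y. B < norm y \<Longrightarrow> H y = 0"
  shows "(\<integral>x. (conv H (\<lambda>x. pot2 e i j x - pot2 r i j x) x)^2 \<partial>lborel)
    \<le> 4 * bump_mass^2 * (\<integral>y. (H y)^2 \<partial>lborel)"
proof -
  have r: "r > 0" using e by simp
  let ?Q1 = "\<lambda>i x. pot1 e i x - pot1 r i x"
  let ?Q2 = "\<lambda>i j x. pot2 e i j x - pot2 r i j x"
  let ?Q3 = "\<lambda>i j k x. pot3 e i j k x - pot3 r i j k x"
  note cc = cutoff_pot[OF e]
  have "(\<integral>x. (conv H (?Q2 i j) x)^2 \<partial>lborel) \<le> (\<integral>x. (\<Sum>a\<in>UNIV. conv H (?Q2 a a) x)^2 \<partial>lborel)"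
  proof (rule Hessian_L2_bound[where ?v1.0 = "\<lambda>i. conv H (?Q1 i)" and ?v2.0 = "\<lambda>i j. conv H (?Q2 i j)"
        and ?v3.0 = "\<lambda>i j k. conv H (?Q3 i j k)"])
    show "has_dd (axis j 1) (conv H (?Q1 i)) (conv H (?Q2 i j))" for i j
      by (intro conv_has_dd H cc has_dd_diff has_dd_pot e r continuous_on_diff continuous_pot)
    show "has_dd (axis k 1) (conv H (?Q2 i j)) (conv H (?Q3 i j k))" for i j k
      by (intro conv_has_dd H cc has_dd_diff has_dd_pot e r continuous_on_diff continuous_pot)
    have sym: "pot3 s i i j = pot3 s j i i" for s i j
      by (auto simp: pot3_def fun_eq_iff)
    show "conv H (?Q3 i i j) = conv H (?Q3 j i i)" for i j
      unfolding sym[of _ i j] ..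
  qed (intro conv_cont_cpt[OF H(1) _ H(3)] cc; assumption)+
  also have "(\<lambda>x. \<Sum>a\<in>UNIV. conv H (?Q2 a a) x) = (\<lambda>x. conv H (bump e) x - conv H (bump r) x)"
  proof
    fix x
    have "(\<Sum>a\<in>UNIV. conv H (?Q2 a a) x) = conv H (\<lambda>x. \<Sum>a\<in>UNIV. ?Q2 a a x) x"
      by (rule conv_sum[symmetric]) (intro H cc)+
    also have "(\<lambda>x. \<Sum>a\<in>UNIV. ?Q2 a a x) = (\<lambda>x. bump e x - bump r x)"
      using laplacian_pot[OF e(1)] laplacian_pot[OF r] by (simp add: sum_subtractf)
    also have "conv H \<dots> x = conv H (bump e) x - conv H (bump r) x"
      by (intro conv_diff H cont_cpt_bump e r)
    finally show "(\<Sum>a\<in>UNIV. conv H (?Q2 a a) x) = conv H (bump e) x - conv H (bump r) x" .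
  qed
  also have "(\<integral>x. (conv H (bump e) x - conv H (bump r) x)^2 \<partial>lborel)
      \<le> (\<integral>x. 2 * (conv H (bump e) x)^2 + 2 * (conv H (bump r) x)^2 \<partial>lborel)"
  proof (rule integral_mono)
    have "cont_cpt (\<lambda>x. conv H (bump e) x - conv H (bump r) x)"
      by (intro cont_cpt_diff conv_cont_cpt[OF H(1) _ H(3)] cont_cpt_bump e r; assumption)
    then show "integrable lborel (\<lambda>x. (conv H (bump e) x - conv H (bump r) x)^2)"
      unfolding power2_eq_square by (intro cont_cpt_integrable cont_cpt_mult_left cont_cpt_continuous)
    show "integrable lborel (\<lambda>x. 2 * (conv H (bump e) x)^2 + 2 * (conv H (bump r) x)^2)"
      by (intro Bochner_Integration.integrable_add integrable_mult_right
          conv_L2_bound(1)[OF H(1,2)] cont_cpt_bump bump_nonneg e r)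
    show "(a - b)^2 \<le> 2 * a^2 + 2 * b^2" for a b :: real
      using zero_le_power2[of "a + b"] by (simp add: power2_eq_square algebra_simps)
  qed
  also have "\<dots> = 2 * (\<integral>x. (conv H (bump e) x)^2 \<partial>lborel) + 2 * (\<integral>x. (conv H (bump r) x)^2 \<partial>lborel)"
    using conv_L2_bound(1)[OF H(1,2)] e r by (simp add: cont_cpt_bump bump_nonneg)
  also have "\<dots> \<le> 2 * (bump_mass^2 * (\<integral>y. (H y)^2 \<partial>lborel)) + 2 * (bump_mass^2 * (\<integral>y. (H y)^2 \<partial>lborel))"
    using conv_L2_bound(2)[OF H(1,2) cont_cpt_bump(1)[OF e(1)] bump_nonneg[OF e(1)]]
      conv_L2_bound(2)[OF H(1,2) cont_cpt_bump(1)[OF r] bump_nonneg[OF r]] integral_bump e r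
    by (intro add_mono mult_left_mono) simp_all
  finally show ?thesis by simp
qed

section \<open>The pressure estimate on an annulus\<close>

text \<open>The equation \<open>\<nabla>P = div G\<close> in the classical sense, with no more regularity than the pressure has at
  vacuum points.\<close>
definition grad_eq_div :: "(real^3 \<Rightarrow> real) \<Rightarrow> (3 \<Rightarrow> 3 \<Rightarrow> real^3 \<Rightarrow> real) \<Rightarrow> bool" where
  "grad_eq_div P G \<longleftrightarrow> continuous_on UNIV P \<and> (\<forall>i j. continuous_on UNIV (G i j)) \<and>
     (\<exists>G'. \<forall>i. (\<forall>j. has_dd (axis j 1) (G i j) (G' i j) \<and> continuous_on UNIV (G' i j)) \<and>
        has_dd (axis i 1) P (\<lambda>x. \<Sum>j\<in>UNIV. G' i j x))"

definition stress_energy :: "(3 \<Rightarrow> 3 \<Rightarrow> real^3 \<Rightarrow> real) \<Rightarrow> (real^3) set \<Rightarrow> real" where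
  "stress_energy G A = (\<Sum>i\<in>UNIV. \<Sum>j\<in>UNIV. \<integral>x. indicator A x * (G i j x)^2 \<partial>lborel)"

text \<open>The derivative on the kernel is moved to \<open>P\<close>, where it becomes a divergence of \<open>G\<close>, and is then
  moved back: a derivative of the mollified pressure is seen by the stress alone.\<close>
lemma conv_grad:
  assumes PG: "grad_eq_div P G"
    and g: "cont_cpt g" "\<And>j. has_dd (axis j 1) g (g1 j)" "\<And>j. continuous_on UNIV (g1 j)"
  shows "conv P (g1 i) x = (\<Sum>j\<in>UNIV. conv (G i j) (g1 j) x)"
proof -
  obtain G' where P: "continuous_on UNIV P" and G: "\<And>i j. continuous_on UNIV (G i j)"
    and dG: "\<And>i j. has_dd (axis j 1) (G i j) (G' i j)" "\<And>i j. continuous_on UNIV (G' i j)"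
    and dP: "\<And>i. has_dd (axis i 1) P (\<lambda>x. \<Sum>j\<in>UNIV. G' i j x)"
    using PG unfolding grad_eq_div_def by blast
  have "conv P (g1 i) x = conv (\<lambda>x. \<Sum>j\<in>UNIV. G' i j x) g x"
    by (rule conv_by_parts[OF P dP _ g(1,2,3), symmetric]) (intro continuous_on_sum dG)
  also have "\<dots> = (\<Sum>j\<in>UNIV. conv (G' i j) g x)"
    unfolding conv_def sum_distrib_right
    by (rule Bochner_Integration.integral_sum)
      (intro cont_cpt_integrable cont_cpt_mult_right dG cont_cpt_reflect g)
  also have "\<dots> = (\<Sum>j\<in>UNIV. conv (G i j) (g1 j) x)"
    by (intro sum.cong refl conv_by_parts[OF G dG g])
  finally show ?thesis .
qed

lemma measure_cball_le:
  assumes "r \<ge> 0"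
  shows "measure lborel (cball (0::real^3) r) \<le> 8 * r^3"
proof -
  have sub: "cball (0::real^3) r \<subseteq> cbox (vec (-r)) (vec r)"
  proof
    fix x :: "real^3" assume "x \<in> cball 0 r"
    then have "\<bar>x $ i\<bar> \<le> r" for i using component_le_norm_cart[of x i] by simp
    then show "x \<in> cbox (vec (-r)) (vec r)"
      by (simp add: mem_box_cart abs_le_iff minus_le_iff)
  qed
  have "measure lborel (cball (0::real^3) r) \<le> measure lborel (cbox (vec (-r)) (vec r) :: (real^3) set)"
    by (rule measure_mono_fmeasurable[OF sub]) (auto simp: fmeasurable_cbox)
  also have "\<dots> = (\<Prod>i\<in>(UNIV::3 set). r - (- r))"
    using assms by (subst content_cbox_cart) (auto simp: interval_ne_empty_cart)
  also have "\<dots> = 8 * r^3" by (simp add: power3_eq_cube)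
  finally show ?thesis .
qed

lemma bump1_L2:
  assumes "r > 0"
  shows "(\<integral>x. (bump1 r j x)^2 \<partial>lborel) \<le> 22472 / r^5"
proof -
  have i: "integrable lborel (indicator (cball 0 r) :: real^3 \<Rightarrow> real)"
    by (intro integrable_real_indicator) (use emeasure_lborel_cball_finite[of "0::real^3" r] in auto)
  have "(\<integral>x. (bump1 r j x)^2 \<partial>lborel) \<le> (\<integral>x. (53 / r^4)^2 * indicator (cball (0::real^3) r) x \<partial>lborel)"
  proof (rule integral_mono)
    show "integrable lborel (\<lambda>x. (bump1 r j x)^2)"
      unfolding power2_eq_square
      by (intro cont_cpt_integrable cont_cpt_mult_left cont_cpt_bump continuous_pot assms)
    show "integrable lborel (\<lambda>x::real^3. (53 / r^4)^2 * indicator (cball 0 r) x)"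
      using i by (rule integrable_mult_right)
    show "(bump1 r j x)^2 \<le> (53 / r^4)^2 * indicator (cball 0 r) x" for x
    proof (cases "norm x \<le> r")
      case True
      have "\<bar>bump1 r j x\<bar>^2 \<le> (53 / r^4)^2" by (intro power_mono bump1_bound assms) auto
      then show ?thesis using True by simp
    qed (use bump_outside(2)[OF assms] in simp)
  qed
  \<comment> \<open>The numerator below is \<open>53^2 * 8\<close>, the 8 coming from the cube around the ball.\<close>
  also have "\<dots> = (53 / r^4)^2 * measure lborel (cball (0::real^3) r)"
    by simp
  also have "\<dots> \<le> (53 / r^4)^2 * (8 * r^3)"
    using assms by (intro mult_left_mono measure_cball_le) auto
  also have "\<dots> = 22472 / r^5"
    using assms by (simp add: field_simps eval_nat_numeral)
  finally show ?thesis .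
qed

text \<open>The geometry on which the pressure estimate rests. The gradient of the cutoff will live in
  \<open>shell R\<close>. Segments between orthogonal points of the shell may come closer to the origin by a factor
  \<open>sqrt 2\<close>, which leads to \<open>wide_shell R\<close> (note \<open>21/20 < 3/2 / sqrt 2\<close>), and enlarging
  that by the mollification radius \<open>R/20\<close> stays within \<open>annulus R\<close>.\<close>
definition shell :: "real \<Rightarrow> (real^3) set" where
  "shell R = {x. 3/2 * R \<le> norm x \<and> norm x \<le> 19/10 * R}"

definition wide_shell :: "real \<Rightarrow> (real^3) set" where
  "wide_shell R = {x. 21/20 * R \<le> norm x \<and> norm x \<le> 39/20 * R}"

lemma compact_annuli: "compact (annulus R)" "compact (shell R)"
proof -
  have "compact {x::real^3. a \<le> norm x \<and> norm x \<le> b}" for a b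
  proof -
    have "{x::real^3. a \<le> norm x \<and> norm x \<le> b} = cball 0 b \<inter> {x. a \<le> norm x}" by auto
    moreover have "closed {x::real^3. a \<le> norm x}"
      by (intro closed_Collect_le continuous_intros)
    ultimately show ?thesis by (simp add: compact_Int_closed)
  qed
  then show "compact (annulus R)" "compact (shell R)" unfolding annulus_def shell_def by blast+
qed

lemma wide_shell_annulus:
  assumes "R > 0" "x \<in> wide_shell R" "dist x y \<le> R / 20"
  shows "y \<in> annulus R"
proof -
  have "\<bar>norm x - norm y\<bar> \<le> R / 20"
    using norm_triangle_ineq3[of x y] assms(3) by (simp add: dist_norm)
  then have "norm x - R / 20 \<le> norm y" "norm y \<le> norm x + R / 20" by linarith+
  moreover have "21/20 * R \<le> norm x" "norm x \<le> 39/20 * R"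
    using assms(2) by (simp_all add: wide_shell_def)
  ultimately show ?thesis using assms(1) unfolding annulus_def mem_Collect_eq by linarith
qed

lemma shell_wide_shell: "R > 0 \<Longrightarrow> shell R \<subseteq> wide_shell R"
  by (auto simp: shell_def wide_shell_def)

lemma shell_annulus: "R > 0 \<Longrightarrow> shell R \<subseteq> annulus R"
  by (auto simp: shell_def annulus_def)

text \<open>By Pythagoras \<open>|(1 - s) x + s z|^2 \<ge> ((1 - s)^2 + s^2) (3R/2)^2 \<ge> (3R/2)^2 / 2\<close>.\<close>
lemma orthogonal_segment_in_wide_shell:
  assumes R: "R > 0" and x: "x \<in> shell R" and z: "z \<in> shell R"
    and xz: "x \<bullet> z = 0" and s: "0 \<le> s" "s \<le> 1"
  shows "x + s *\<^sub>R (z - x) \<in> wide_shell R"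
proof -
  have eq: "x + s *\<^sub>R (z - x) = (1 - s) *\<^sub>R x + s *\<^sub>R z" by (simp add: algebra_simps)
  have up: "norm (x + s *\<^sub>R (z - x)) \<le> 19/10 * R"
  proof -
    have "norm (x + s *\<^sub>R (z - x)) \<le> (1 - s) * norm x + s * norm z"
      unfolding eq using s norm_triangle_ineq[of "(1 - s) *\<^sub>R x" "s *\<^sub>R z"] by simp
    also have "\<dots> \<le> (1 - s) * (19/10 * R) + s * (19/10 * R)"
      using x z s by (intro add_mono mult_left_mono) (auto simp: shell_def)
    also have "\<dots> = 19/10 * R" unfolding distrib_right[symmetric] by simp
    finally show ?thesis .
  qed
  have half: "1/2 \<le> (1 - s)^2 + s^2"
    using zero_le_power2[of "1 - 2 * s"] by (simp add: power2_eq_square algebra_simps)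
  have sq: "(3/2 * R)^2 \<le> (norm w)^2" if "w \<in> shell R" for w
    using that R by (intro power_mono) (auto simp: shell_def)
  have "(21/20 * R)^2 \<le> 1/2 * (3/2 * R)^2" by (simp add: power2_eq_square)
  also have "\<dots> \<le> ((1 - s)^2 + s^2) * (3/2 * R)^2"
    by (rule mult_right_mono[OF half]) simp
  also have "\<dots> \<le> (1 - s)^2 * (norm x)^2 + s^2 * (norm z)^2"
    unfolding distrib_right by (intro add_mono mult_left_mono sq x z) auto
  also have "\<dots> = (norm (x + s *\<^sub>R (z - x)))^2"
    unfolding eq power2_norm_eq_inner using xz
    by (simp add: inner_add_left inner_add_right inner_commute power2_eq_square)
  finally have "21/20 * R \<le> norm (x + s *\<^sub>R (z - x))"
    by (rule power2_le_imp_le) simp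
  with up R show ?thesis by (simp add: wide_shell_def)
qed

lemma orthogonal_pair_exists:
  fixes x y :: "real^3"
  assumes "c \<ge> 0"
  obtains z where "norm z = c" "x \<bullet> z = 0" "y \<bullet> z = 0"
proof -
  have "dim {x, y} \<le> card {x, y}" by (intro dim_le_card') simp
  also have "\<dots> \<le> 2" by (simp add: card_insert_if)
  finally have "dim {x, y} < DIM(real^3)" by simp
  then obtain w where w: "w \<noteq> 0" "\<And>v. v \<in> span {x, y} \<Longrightarrow> orthogonal w v"
    using orthogonal_to_subspace_exists by blast
  have "x \<bullet> w = 0" "y \<bullet> w = 0"
    using w(2)[of x] w(2)[of y] by (simp_all add: span_base orthogonal_def inner_commute)
  then show thesis
    using w(1) assms by (intro that[of "(c / norm w) *\<^sub>R w"]) auto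
qed

lemma pressure_localise:
  assumes R: "R > 0" and x: "x \<in> wide_shell R" and e: "e \<le> R / 20"
    and g: "\<And>z. e < norm z \<Longrightarrow> g z = 0"
  shows "conv (\<lambda>y. indicator (annulus R) y * F y) g x = conv F g x"
proof (rule conv_local)
  fix y assume "g (x - y) \<noteq> 0"
  then have "dist x y \<le> R / 20" using g[of "x - y"] e by (force simp: dist_norm)
  then show "y \<in> annulus R" by (rule wide_shell_annulus[OF R x])
qed

lemma localised_stress:
  assumes "grad_eq_div P G"
  shows "integrable lborel (\<lambda>y. indicator (annulus R) y * G i j y)"
    "integrable lborel (\<lambda>y. (indicator (annulus R) y * G i j y)^2)"
    "(\<integral>y. (indicator (annulus R) y * G i j y)^2 \<partial>lborel) \<le> stress_energy G (annulus R)"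
    "2 * R < norm y \<Longrightarrow> indicator (annulus R) y * G i j y = 0"
proof -
  have G: "continuous_on UNIV (G i j)" for i j using assms by (auto simp: grad_eq_div_def)
  have sq: "(indicator A y * c)^2 = indicator A y * c^2" for A and y :: "real^3" and c :: real
    by (auto simp: indicator_def)
  show "integrable lborel (\<lambda>y. indicator (annulus R) y * G i j y)"
    by (intro integrable_indicator_continuous compact_annuli G)
  show "integrable lborel (\<lambda>y. (indicator (annulus R) y * G i j y)^2)"
    unfolding sq by (intro integrable_indicator_continuous compact_annuli continuous_on_power G)
  have nn: "0 \<le> (\<integral>x. indicator (annulus R) x * (G i j x)^2 \<partial>lborel)" for i j
    by (intro integral_nonneg_AE) auto
  have "(\<integral>x. indicator (annulus R) x * (G i j x)^2 \<partial>lborel)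
      \<le> (\<Sum>j\<in>UNIV. \<integral>x. indicator (annulus R) x * (G i j x)^2 \<partial>lborel)"
    by (rule member_le_sum) (auto intro: nn)
  also have "\<dots> \<le> stress_energy G (annulus R)"
    unfolding stress_energy_def by (rule member_le_sum) (auto intro!: nn sum_nonneg)
  finally show "(\<integral>y. (indicator (annulus R) y * G i j y)^2 \<partial>lborel) \<le> stress_energy G (annulus R)"
    unfolding sq .
  show "2 * R < norm y \<Longrightarrow> indicator (annulus R) y * G i j y = 0"
    by (simp add: annulus_def)
qed

text \<open>Join \<open>x\<close> and \<open>y\<close> by two segments through a point of the shell orthogonal to both; such a
  point exists in three dimensions and spares the discussion of paths around the hole. On each
  segment the derivative of the mollified pressure in direction \<open>h\<close> is a sum of nine terms, each
  at most \<open>|h| \<le> 4R\<close> times the norm of the stress times the norm of \<open>bump1\<close>.\<close>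
lemma mollified_oscillation:
  assumes R: "R > 0" and PG: "grad_eq_div P G" and x: "x \<in> shell R" and y: "y \<in> shell R"
  shows "\<bar>conv P (bump (R/20)) x - conv P (bump (R/20)) y\<bar>
    \<le> 72 * R * sqrt (stress_energy G (annulus R) * (22472 / (R/20)^5))"
proof -
  define r where "r = R/20"
  have r: "r > 0" "r \<le> R/20" using R by (simp_all add: r_def)
  define S where "S = sqrt (stress_energy G (annulus R) * (22472 / r^5))"
  let ?A = "indicator (annulus R) :: real^3 \<Rightarrow> real"
  \<comment> \<open>Cutting \<open>P\<close> off to the annulus makes it integrable, hence \<open>?F\<close> differentiable everywhere, and
    does not change the convolution on the wide shell.\<close>
  let ?F = "conv (\<lambda>y. ?A y * P y) (bump r)"
  have P: "continuous_on UNIV P" using PG by (simp add: grad_eq_div_def)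
  have G: "continuous_on UNIV (G i j)" for i j using PG by (auto simp: grad_eq_div_def)
  have iP: "integrable lborel (\<lambda>y. ?A y * P y)"
    by (intro integrable_indicator_continuous compact_annuli P)
  note H = localised_stress[OF PG, of R]
  have loc: "conv (\<lambda>y. ?A y * K y) (bump r) w = conv K (bump r) w"
    "conv (\<lambda>y. ?A y * K y) (bump1 r j) w = conv K (bump1 r j) w" if "w \<in> wide_shell R" for w K j
    by (intro pressure_localise[OF R that r(2)] bump_outside r less_imp_le; assumption)+
  have comp: "\<bar>conv (G i j) (bump1 r j) w\<bar> \<le> S" if w: "w \<in> wide_shell R" for w i j
  proof -
    have "(conv (\<lambda>y. ?A y * G i j y) (bump1 r j) w)^2
        \<le> (\<integral>y. (?A y * G i j y)^2 \<partial>lborel) * (\<integral>y. (bump1 r j y)^2 \<partial>lborel)"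
      by (intro conv_bound H cont_cpt_bump r)
    also have "\<dots> \<le> stress_energy G (annulus R) * (22472 / r^5)"
      using r(1) by (intro mult_mono H bump1_L2 r integral_nonneg_AE order_trans[OF _ H(3)]) auto
    finally show ?thesis unfolding S_def loc(2)[OF w] by (rule real_le_rsqrt[of "\<bar>_\<bar>", simplified])
  qed
  have seg: "\<bar>?F (a + h) - ?F a\<bar> \<le> 36 * R * S"
    if w: "\<And>s. s \<in> {0..1} \<Longrightarrow> a + s *\<^sub>R h \<in> wide_shell R" and h: "norm h \<le> 4 * R" for a h
  proof (rule has_dd_segment_bound)
    show "has_dd h ?F (conv (\<lambda>y. ?A y * P y) (\<lambda>x. \<Sum>i\<in>UNIV. h $ i * bump1 r i x))"
      by (intro conv_has_dd iP cont_cpt_bump has_dd_bump r continuous_on_sum continuous_on_mult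
          continuous_on_const continuous_pot)
    fix s :: real assume "s \<in> {0..1}"
    then have w: "a + s *\<^sub>R h \<in> wide_shell R" by (rule w)
    have "conv (\<lambda>y. ?A y * P y) (\<lambda>x. \<Sum>i\<in>UNIV. h $ i * bump1 r i x) (a + s *\<^sub>R h)
        = (\<Sum>i\<in>UNIV. conv (\<lambda>y. ?A y * P y) (\<lambda>x. h $ i * bump1 r i x) (a + s *\<^sub>R h))"
      by (intro conv_sum iP cont_cpt_cmult cont_cpt_bump r)
    also have "\<dots> = (\<Sum>i\<in>UNIV. h $ i * conv P (bump1 r i) (a + s *\<^sub>R h))"
    proof (intro sum.cong refl)
      fix i
      have "conv (\<lambda>y. ?A y * P y) (\<lambda>x. h $ i * bump1 r i x) (a + s *\<^sub>R h)
          = h $ i * conv (\<lambda>y. ?A y * P y) (bump1 r i) (a + s *\<^sub>R h)"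
        unfolding conv_def by (simp add: mult.left_commute)
      then show "conv (\<lambda>y. ?A y * P y) (\<lambda>x. h $ i * bump1 r i x) (a + s *\<^sub>R h)
          = h $ i * conv P (bump1 r i) (a + s *\<^sub>R h)"
        unfolding loc(2)[OF w] .
    qed
    also have "\<dots> = (\<Sum>i\<in>UNIV. \<Sum>j\<in>UNIV. h $ i * conv (G i j) (bump1 r j) (a + s *\<^sub>R h))"
    proof (unfold sum_distrib_left[symmetric], intro sum.cong refl arg_cong2[of _ _ _ _ "(*)"])
      fix i
      have "has_dd (axis j 1) (bump r) (bump1 r j)" for j
      proof (rule has_dd_eq[OF has_dd_bump[OF r(1)]])
        show "(\<Sum>i\<in>UNIV. axis j 1 $ i * bump1 r i x) = bump1 r j x" for x
          by (simp add: axis_def if_distrib[of "\<lambda>c. c * _"] cong: if_cong)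
      qed
      then show "conv P (bump1 r i) (a + s *\<^sub>R h) = (\<Sum>j\<in>UNIV. conv (G i j) (bump1 r j) (a + s *\<^sub>R h))"
        by (rule conv_grad[OF PG cont_cpt_bump(1)[OF r(1)]]) (rule continuous_pot)
    qed
    also have "\<bar>\<dots>\<bar> \<le> (\<Sum>i\<in>(UNIV::3 set). \<Sum>j\<in>(UNIV::3 set). (4 * R) * S)"
    proof (intro order_trans[OF sum_abs] sum_mono)
      fix i j :: 3
      have "\<bar>h $ i\<bar> \<le> 4 * R" using component_le_norm_cart[of h i] h by linarith
      then show "\<bar>h $ i * conv (G i j) (bump1 r j) (a + s *\<^sub>R h)\<bar> \<le> (4 * R) * S"
        unfolding abs_mult using comp[OF w, of i j] R by (intro mult_mono) auto
    qed
    also have "\<dots> = 36 * R * S" by simp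
    finally show "\<bar>conv (\<lambda>y. ?A y * P y) (\<lambda>x. \<Sum>i\<in>UNIV. h $ i * bump1 r i x) (a + s *\<^sub>R h)\<bar> \<le> 36 * R * S" .
  qed
  obtain z where z: "norm z = 3/2 * R" "x \<bullet> z = 0" "y \<bullet> z = 0"
    using orthogonal_pair_exists[of "3/2 * R" x y] R by auto
  have zr: "z \<in> shell R" using z R by (simp add: shell_def)
  have one: "\<bar>?F z - ?F w\<bar> \<le> 36 * R * S" if "w \<in> shell R" "w \<bullet> z = 0" for w
  proof -
    have "norm (z - w) \<le> 4 * R"
      using norm_triangle_ineq4[of z w] that(1) z(1) R by (simp add: shell_def)
    then have "\<bar>?F (w + (z - w)) - ?F w\<bar> \<le> 36 * R * S"
      using orthogonal_segment_in_wide_shell[OF R that(1) zr that(2)] by (intro seg) auto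
    then show ?thesis by simp
  qed
  have "\<bar>?F x - ?F y\<bar> \<le> 72 * R * S"
    using one[OF x z(2)] one[OF y z(3)] by linarith
  then show ?thesis
    using loc(1) shell_wide_shell[OF R] x y by (simp add: S_def r_def subset_eq)
qed

lemma sum_sum_squared_le:
  fixes f :: "3 \<Rightarrow> 3 \<Rightarrow> real"
  shows "(\<Sum>i\<in>UNIV. \<Sum>j\<in>UNIV. f i j)^2 \<le> 9 * (\<Sum>i\<in>UNIV. \<Sum>j\<in>UNIV. (f i j)^2)"
proof -
  have "(\<Sum>i\<in>UNIV. \<Sum>j\<in>UNIV. f i j)^2 \<le> (\<Sum>i\<in>UNIV. (\<Sum>j\<in>UNIV. f i j)^2) * 3"
    using sum_squared_le_sum_of_squares[of "\<lambda>i. \<Sum>j\<in>UNIV. f i j" UNIV] by simp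
  also have "\<dots> \<le> (\<Sum>i\<in>UNIV. (\<Sum>j\<in>UNIV. (f i j)^2) * 3) * 3"
    using sum_squared_le_sum_of_squares[of "f _" UNIV] by (intro mult_right_mono sum_mono) simp_all
  finally show ?thesis by (simp add: sum_distrib_right[symmetric])
qed

text \<open>On the shell, \<open>P * (bump e - bump r) = P * \<Delta>(pot e - pot r)\<close>; one derivative turns \<open>P\<close> into the
  divergence of \<open>G\<close>, the other one is moved onto the kernel. The result is a sum of nine truncated Riesz
  transforms of the stress, and the stress may be cut off to the annulus because
  the kernel has range \<open>r\<close>.\<close>
lemma mollified_difference_L2:
  assumes R: "R > 0" and PG: "grad_eq_div P G" and e: "0 < e" "e \<le> R/20"
  shows "(\<integral>x. indicator (shell R) x * (conv P (bump e) x - conv P (bump (R/20)) x)^2 \<partial>lborel)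
    \<le> 36 * bump_mass^2 * stress_energy G (annulus R)"
proof -
  define r where "r = R/20"
  have r: "r > 0" "e \<le> r" using R e by (simp_all add: r_def)
  let ?A = "indicator (annulus R) :: real^3 \<Rightarrow> real"
  let ?H = "\<lambda>i j y. ?A y * G i j y"
  let ?Q1 = "\<lambda>i x. pot1 e i x - pot1 r i x"
  let ?Q2 = "\<lambda>i j x. pot2 e i j x - pot2 r i j x"
  have P: "continuous_on UNIV P" using PG by (simp add: grad_eq_div_def)
  note H = localised_stress[OF PG, of R]
  note cc = cutoff_pot[OF e(1) r(2)]
  have rep: "conv P (bump e) x - conv P (bump r) x = (\<Sum>i\<in>UNIV. \<Sum>j\<in>UNIV. conv (?H i j) (?Q2 i j) x)"
    if x: "x \<in> shell R" for x
  proof -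
    have xw: "x \<in> wide_shell R" using x shell_wide_shell[OF R] by blast
    have i: "integrable lborel (\<lambda>y. P y * g (x - y))" if "cont_cpt g" for g
      by (intro cont_cpt_integrable cont_cpt_mult_right P cont_cpt_reflect that)
    have "conv P (bump e) x - conv P (bump r) x = (\<integral>y. P y * bump e (x - y) - P y * bump r (x - y) \<partial>lborel)"
      unfolding conv_def by (simp add: i cont_cpt_bump e r)
    also have "\<dots> = (\<integral>y. (\<Sum>i\<in>UNIV. P y * ?Q2 i i (x - y)) \<partial>lborel)"
      by (simp only: laplacian_pot[OF e(1), symmetric] laplacian_pot[OF r(1), symmetric]
          right_diff_distrib[symmetric] sum_subtractf[symmetric] sum_distrib_left)
    also have "\<dots> = (\<Sum>i\<in>UNIV. conv P (?Q2 i i) x)"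
      unfolding conv_def by (rule Bochner_Integration.integral_sum) (intro i cc)
    also have "\<dots> = (\<Sum>i\<in>UNIV. \<Sum>j\<in>UNIV. conv (G i j) (?Q2 i j) x)"
    proof (intro sum.cong refl)
      fix i
      show "conv P (?Q2 i i) x = (\<Sum>j\<in>UNIV. conv (G i j) (?Q2 i j) x)"
        by (rule conv_grad[OF PG cc(1)[of i], where ?g1.0 = "?Q2 i"])
          (intro has_dd_diff has_dd_pot e r continuous_on_diff continuous_pot)+
    qed
    also have "\<dots> = (\<Sum>i\<in>UNIV. \<Sum>j\<in>UNIV. conv (?H i j) (?Q2 i j) x)"
      by (intro sum.cong refl pressure_localise[OF R xw, symmetric, of r] cc) (simp add: r_def)
    finally show ?thesis .
  qed
  have c: "cont_cpt (conv (?H i j) (?Q2 i j))" for i j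
    by (rule conv_cont_cpt[OF H(1) cc(2) H(4)])
  have c2: "integrable lborel (\<lambda>x. (conv (?H i j) (?Q2 i j) x)^2)" for i j
    unfolding power2_eq_square by (intro cont_cpt_integrable cont_cpt_mult_left c cont_cpt_continuous)
  have W: "cont_cpt (\<lambda>x. \<Sum>i\<in>UNIV. \<Sum>j\<in>UNIV. conv (?H i j) (?Q2 i j) x)"
    by (intro cont_cpt_sum c)
  have "(\<integral>x. indicator (shell R) x * (conv P (bump e) x - conv P (bump r) x)^2 \<partial>lborel)
      = (\<integral>x. indicator (shell R) x * (\<Sum>i\<in>UNIV. \<Sum>j\<in>UNIV. conv (?H i j) (?Q2 i j) x)^2 \<partial>lborel)"
    by (intro Bochner_Integration.integral_cong refl) (simp add: indicator_def rep)
  also have "\<dots> \<le> (\<integral>x. 9 * (\<Sum>i\<in>UNIV. \<Sum>j\<in>UNIV. (conv (?H i j) (?Q2 i j) x)^2) \<partial>lborel)"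
  proof (rule integral_mono)
    show "integrable lborel (\<lambda>x. indicator (shell R) x *
        (\<Sum>i\<in>UNIV. \<Sum>j\<in>UNIV. conv (?H i j) (?Q2 i j) x)^2)"
      by (intro integrable_indicator_continuous compact_annuli continuous_on_power cont_cpt_continuous W)
    show "integrable lborel (\<lambda>x. 9 * (\<Sum>i\<in>UNIV. \<Sum>j\<in>UNIV. (conv (?H i j) (?Q2 i j) x)^2))"
      by (intro integrable_mult_right Bochner_Integration.integrable_sum c2)
    show "indicator (shell R) x * (\<Sum>i\<in>UNIV. \<Sum>j\<in>UNIV. conv (?H i j) (?Q2 i j) x)^2
        \<le> 9 * (\<Sum>i\<in>UNIV. \<Sum>j\<in>UNIV. (conv (?H i j) (?Q2 i j) x)^2)" for x
      using sum_sum_squared_le[of "\<lambda>i j. conv (?H i j) (?Q2 i j) x"]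
      by (auto simp: indicator_def intro!: sum_nonneg)
  qed
  also have "\<dots> = 9 * (\<Sum>i\<in>UNIV. \<Sum>j\<in>UNIV. (\<integral>x. (conv (?H i j) (?Q2 i j) x)^2 \<partial>lborel))"
    using c2 by simp
  also have "\<dots> \<le> 9 * (\<Sum>i\<in>UNIV. \<Sum>j\<in>UNIV. 4 * bump_mass^2 * (\<integral>y. (?H i j y)^2 \<partial>lborel))"
    by (intro mult_left_mono sum_mono truncated_Riesz_L2[OF e(1) r(2) H(1,2,4)]) auto
  also have "\<dots> = 36 * bump_mass^2 * stress_energy G (annulus R)"
  proof -
    have "(?H i j y)^2 = ?A y * (G i j y)^2" for i j y by (auto simp: indicator_def)
    then show ?thesis
      unfolding stress_energy_def by (simp add: sum_distrib_left mult.assoc)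
  qed
  finally show ?thesis by (simp add: r_def)
qed

text \<open>Let the inner mollification radius tend to zero; on the compact shell the convergence is
  dominated by a constant.\<close>
lemma pressure_minus_mollified_L2:
  assumes R: "R > 0" and PG: "grad_eq_div P G"
  shows "(\<integral>x. indicator (shell R) x * (bump_mass * P x - conv P (bump (R/20)) x)^2 \<partial>lborel)
    \<le> 36 * bump_mass^2 * stress_energy G (annulus R)"
proof -
  define r where "r = R/20"
  have r: "r > 0" using R by (simp add: r_def)
  define s where "s n = r / real (Suc n)" for n
  have s: "s n > 0" "s n \<le> r" for n using r by (simp_all add: s_def field_simps)
  have s0: "s \<longlonglongrightarrow> 0"
    using tendsto_mult_right_zero[OF LIMSEQ_Suc[OF lim_1_over_n], of r] by (simp add: s_def[abs_def])
  have P: "continuous_on UNIV P" using PG by (simp add: grad_eq_div_def)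
  let ?A = "indicator (annulus R) :: real^3 \<Rightarrow> real"
  define F where "F t = conv (\<lambda>y. ?A y * P y) (bump t)" for t
  have F_eq: "F t x = conv P (bump t) x" if "x \<in> shell R" "0 < t" "t \<le> r" for t x
    unfolding F_def
    by (rule pressure_localise[OF R _ that(3)[unfolded r_def]])
      (use that shell_wide_shell[OF R] bump_outside in auto)
  have F_cont: "continuous_on UNIV (F t)" if "0 < t" for t
    unfolding F_def
    by (intro conv_continuous integrable_indicator_continuous compact_annuli P cont_cpt_bump that)
  have [measurable]: "P \<in> borel_measurable borel" "F (s n) \<in> borel_measurable borel"
    "F r \<in> borel_measurable borel" "shell R \<in> sets borel" for n
    using P F_cont s r compact_annuli(2)[of R]
    by (auto intro: borel_measurable_continuous_onI simp: compact_imp_closed)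
  have "compact (P ` annulus R)"
    using continuous_on_subset[OF P] by (intro compact_continuous_image compact_annuli) auto
  then obtain C where C: "\<And>y. y \<in> annulus R \<Longrightarrow> \<bar>P y\<bar> \<le> C"
    by (force dest!: compact_imp_bounded simp: bounded_iff)
  have F_bound: "\<bar>F t x\<bar> \<le> C * bump_mass" if "x \<in> shell R" "0 < t" "t \<le> r" for t x
    unfolding F_eq[OF that]
  proof (rule conv_bump_bound[OF that(2) P])
    fix y assume "dist x y \<le> t"
    then show "\<bar>P y\<bar> \<le> C"
      using that shell_wide_shell[OF R] wide_shell_annulus[OF R, of x y]
      by (intro C) (auto simp: r_def)
  qed
  have "(\<lambda>n. \<integral>x. indicator (shell R) x * (F (s n) x - F r x)^2 \<partial>lborel)
      \<longlonglongrightarrow> (\<integral>x. indicator (shell R) x * (bump_mass * P x - F r x)^2 \<partial>lborel)"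
  proof (rule integral_dominated_convergence[where w = "\<lambda>x. indicator (shell R) x * (2 * (C * bump_mass))^2"])
    show "integrable lborel (\<lambda>x. indicator (shell R) x * (2 * (C * bump_mass))^2)"
      by (intro integrable_indicator_continuous compact_annuli continuous_on_const)
    show "AE x in lborel. (\<lambda>n. indicator (shell R) x * (F (s n) x - F r x)^2)
        \<longlonglongrightarrow> indicator (shell R) x * (bump_mass * P x - F r x)^2"
    proof (rule AE_I2)
      fix x
      show "(\<lambda>n. indicator (shell R) x * (F (s n) x - F r x)^2)
          \<longlonglongrightarrow> indicator (shell R) x * (bump_mass * P x - F r x)^2"
      proof (cases "x \<in> shell R")
        case True
        have "(\<lambda>n. F (s n) x) \<longlonglongrightarrow> bump_mass * P x"
          unfolding F_eq[OF True s] by (rule conv_bump_tendsto[OF P s(1) s0 s(2)])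
        then show ?thesis by (intro tendsto_intros)
      qed simp
    qed
    show "AE x in lborel. norm (indicator (shell R) x * (F (s n) x - F r x)^2)
        \<le> indicator (shell R) x * (2 * (C * bump_mass))^2" for n
    proof (rule AE_I2)
      fix x
      show "norm (indicator (shell R) x * (F (s n) x - F r x)^2)
          \<le> indicator (shell R) x * (2 * (C * bump_mass))^2"
      proof (cases "x \<in> shell R")
        case True
        have "\<bar>F (s n) x - F r x\<bar> \<le> 2 * (C * bump_mass)"
          using F_bound[OF True s, of n] F_bound[OF True r] by (simp add: abs_le_iff)
        then have "\<bar>F (s n) x - F r x\<bar>^2 \<le> (2 * (C * bump_mass))^2" by (intro power_mono) auto
        then show ?thesis using True by simp
      qed simp
    qed
  qed measurable
  moreover have "(\<integral>x. indicator (shell R) x * (F (s n) x - F r x)^2 \<partial>lborel)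
      \<le> 36 * bump_mass^2 * stress_energy G (annulus R)" for n
  proof -
    have "(\<integral>x. indicator (shell R) x * (F (s n) x - F r x)^2 \<partial>lborel)
      = (\<integral>x. indicator (shell R) x * (conv P (bump (s n)) x - conv P (bump (R/20)) x)^2 \<partial>lborel)"
      by (intro Bochner_Integration.integral_cong refl) (use F_eq s r in \<open>simp add: indicator_def r_def\<close>)
    also have "\<dots> \<le> 36 * bump_mass^2 * stress_energy G (annulus R)"
      using s by (intro mollified_difference_L2[OF R PG]) (simp_all add: r_def)
    finally show ?thesis .
  qed
  ultimately have "(\<integral>x. indicator (shell R) x * (bump_mass * P x - F r x)^2 \<partial>lborel)
      \<le> 36 * bump_mass^2 * stress_energy G (annulus R)"
    by (intro LIMSEQ_le_const2) auto
  also have "(\<integral>x. indicator (shell R) x * (bump_mass * P x - F r x)^2 \<partial>lborel)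
      = (\<integral>x. indicator (shell R) x * (bump_mass * P x - conv P (bump (R/20)) x)^2 \<partial>lborel)"
    by (intro Bochner_Integration.integral_cong refl) (use F_eq r in \<open>simp add: indicator_def r_def\<close>)
  finally show ?thesis .
qed

lemma stress_energy_nonneg: "stress_energy G A \<ge> 0"
  unfolding stress_energy_def by (intro sum_nonneg integral_nonneg_AE) auto

lemma measure_annulus_le:
  assumes "R > 0" shows "measure lborel (annulus R) \<le> 64 * R^3"
proof -
  have "measure lborel (annulus R) \<le> measure lborel (cball (0::real^3) (2 * R))"
    by (rule measure_mono_fmeasurable) (use compact_annuli(1)[of R] in \<open>auto simp: annulus_def compact_imp_closed fmeasurable_compact\<close>)
  also have "\<dots> \<le> 8 * (2 * R)^3" using assms by (intro measure_cball_le) auto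
  finally show ?thesis by (simp add: power_mult_distrib)
qed

text \<open>A local form of the Necas inequality \<open>\<parallel>P - c\<parallel> \<le> C \<parallel>\<nabla>P\<parallel>\<close> with the norm of \<open>H^{-1}\<close> on the right. The
  constant \<open>c\<close> is the normalised mollified pressure at a point of the shell, and is nonnegative because \<open>P\<close> is; the constant
  \<open>C\<close> is independent of \<open>R\<close> because every step scales.\<close>
lemma pressure_L2_annulus:
  "\<exists>C>0. \<forall>R P G. R > 0 \<longrightarrow> grad_eq_div P G \<longrightarrow> (\<forall>x. P x \<ge> 0) \<longrightarrow>
    (\<exists>c\<ge>0. (\<integral>x. indicator (shell R) x * (P x - c)^2 \<partial>lborel) \<le> C * stress_energy G (annulus R))"
proof -
  define m where "m = bump_mass"
  have m: "m > 0" using bump_mass_pos by (simp add: m_def)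
  define K where "K = 2 * 72^2 * 22472 * 20^5 * (64::real)"
  have "\<exists>c\<ge>0. (\<integral>x. indicator (shell R) x * (P x - c)^2 \<partial>lborel) \<le> (72 + K / m^2) * stress_energy G (annulus R)"
    if R: "R > 0" and PG: "grad_eq_div P G" and nn: "\<And>x. P x \<ge> 0" for R P G
  proof -
    define r where "r = R/20"
    have r: "r > 0" using R by (simp add: r_def)
    define S where "S = stress_energy G (annulus R)"
    have S: "S \<ge> 0" unfolding S_def by (rule stress_energy_nonneg)
    have P: "continuous_on UNIV P" using PG by (simp add: grad_eq_div_def)
    let ?A = "indicator (annulus R) :: real^3 \<Rightarrow> real"
    define F where "F = conv (\<lambda>y. ?A y * P y) (bump r)"
    have F_eq: "F x = conv P (bump r) x" if "x \<in> shell R" for x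
      unfolding F_def
      by (rule pressure_localise[OF R, of _ r])
        (use that shell_wide_shell[OF R] bump_outside r in \<open>auto simp: r_def\<close>)
    have F_cont: "continuous_on UNIV F"
      unfolding F_def by (intro conv_continuous integrable_indicator_continuous compact_annuli P cont_cpt_bump r)
    define x0 :: "real^3" where "x0 = (3/2 * R) *\<^sub>R axis 1 1"
    have x0: "x0 \<in> shell R" using R by (simp add: x0_def shell_def norm_axis_1)
    define c where "c = F x0 / m"
    have "F x0 \<ge> 0"
      unfolding F_def conv_def by (intro integral_nonneg_AE AE_I2) (simp add: nn bump_nonneg r)
    then have c: "c \<ge> 0" using m by (simp add: c_def)
    have osc: "(F x - F x0)^2 \<le> 72^2 * R^2 * (S * (22472 / r^5))" if "x \<in> shell R" for x
    proof -
      have "\<bar>F x - F x0\<bar>^2 \<le> (72 * R * sqrt (S * (22472 / r^5)))^2"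
        using mollified_oscillation[OF R PG that x0]
        by (intro power_mono) (simp_all add: F_eq that x0 r_def S_def)
      then show ?thesis using S r by (simp add: power_mult_distrib)
    qed
    have "m^2 * (\<integral>x. indicator (shell R) x * (P x - c)^2 \<partial>lborel)
        = (\<integral>x. indicator (shell R) x * (m * P x - F x0)^2 \<partial>lborel)"
    proof -
      have "m^2 * (P x - c)^2 = (m * P x - F x0)^2" for x
        using m by (simp add: c_def power_mult_distrib[symmetric] right_diff_distrib)
      then show ?thesis
        by (subst integral_mult_right_zero[symmetric]) (simp add: mult.left_commute)
    qed
    also have "\<dots> \<le> (\<integral>x. 2 * (indicator (shell R) x * (m * P x - F x)^2)
          + indicator (annulus R) x * (2 * (72^2 * R^2 * (S * (22472 / r^5)))) \<partial>lborel)"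
    proof (rule integral_mono)
      show "integrable lborel (\<lambda>x. indicator (shell R) x * (m * P x - F x0)^2)"
        by (intro integrable_indicator_continuous compact_annuli continuous_intros P)
      show "integrable lborel (\<lambda>x. 2 * (indicator (shell R) x * (m * P x - F x)^2)
          + indicator (annulus R) x * (2 * (72^2 * R^2 * (S * (22472 / r^5)))))"
        by (intro Bochner_Integration.integrable_add integrable_mult_right
            integrable_indicator_continuous compact_annuli continuous_intros P F_cont)
      have sq: "(a - b)^2 \<le> 2 * (a - d)^2 + 2 * (d - b)^2" for a b d :: real
        using zero_le_power2[of "(a - d) - (d - b)"] by (simp add: power2_eq_square algebra_simps)
      show "indicator (shell R) x * (m * P x - F x0)^2 \<le> 2 * (indicator (shell R) x * (m * P x - F x)^2)
          + indicator (annulus R) x * (2 * (72^2 * R^2 * (S * (22472 / r^5))))" for x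
      proof (cases "x \<in> shell R")
        case True
        then have "x \<in> annulus R" using shell_annulus[OF R] by blast
        then show ?thesis using sq[of "m * P x" "F x0" "F x"] osc[OF True] True by simp
      qed (use S r in simp)
    qed
    also have "\<dots> = 2 * (\<integral>x. indicator (shell R) x * (m * P x - F x)^2 \<partial>lborel)
        + 2 * (72^2 * R^2 * (S * (22472 / r^5))) * measure lborel (annulus R)"
    proof -
      have 1: "integrable lborel (\<lambda>x. indicator (shell R) x * (m * P x - F x)^2)"
        by (intro integrable_indicator_continuous compact_annuli continuous_intros P F_cont)
      have 2: "integrable lborel ?A"
        using integrable_indicator_continuous[OF compact_annuli(1), of "\<lambda>_. 1" R] by simp
      have "annulus R \<in> sets borel" using compact_annuli(1)[of R] by (simp add: compact_imp_closed)
      then show ?thesis using 1 2 by simp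
    qed
    also have "\<dots> \<le> 2 * (36 * m^2 * S) + 2 * (72^2 * R^2 * (S * (22472 / r^5))) * (64 * R^3)"
    proof (intro add_mono mult_left_mono measure_annulus_le R)
      have "(\<integral>x. indicator (shell R) x * (m * P x - F x)^2 \<partial>lborel)
          = (\<integral>x. indicator (shell R) x * (bump_mass * P x - conv P (bump (R/20)) x)^2 \<partial>lborel)"
        by (intro Bochner_Integration.integral_cong refl) (simp add: indicator_def F_eq r_def m_def)
      then show "(\<integral>x. indicator (shell R) x * (m * P x - F x)^2 \<partial>lborel) \<le> 36 * m^2 * S"
        using pressure_minus_mollified_L2[OF R PG] by (simp add: m_def S_def)
    qed (use S r in auto)
    also have "\<dots> = m^2 * ((72 + K / m^2) * S)"
      using m R by (simp add: r_def K_def field_simps eval_nat_numeral)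
    finally have "(\<integral>x. indicator (shell R) x * (P x - c)^2 \<partial>lborel) \<le> (72 + K / m^2) * S"
      using m by simp
    with c show ?thesis unfolding S_def by blast
  qed
  moreover have "72 + K / m^2 > 0" by (intro add_pos_nonneg) (auto simp: K_def)
  ultimately show ?thesis by blast
qed

section \<open>Lorentz norms on an annulus\<close>

lemma ennreal_mult_le_cancel:
  assumes "ennreal a * y \<le> ennreal b" "a > 0" "b \<ge> 0"
  shows "y \<le> ennreal (b / a)"
proof (cases y)
  case (real c)
  then have "a * c \<le> b"
    using assms by (simp add: ennreal_mult[symmetric] ennreal_le_iff)
  then show ?thesis using real assms by (simp add: field_simps ennreal_le_iff)
next
  case top
  then show ?thesis using assms by (simp add: ennreal_mult_top top_unique)
qed

lemma ennpowr_le_imp: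
  assumes "ennpowr x r \<le> ennreal c" "r > 0" "c \<ge> 0"
  shows "x \<le> ennreal (c powr (1 / r))"
proof (cases x)
  case (real e)
  then have "e powr r \<le> c" using assms by (simp add: ennpowr_def ennreal_le_iff)
  then have "(e powr r) powr (1 / r) \<le> c powr (1 / r)"
    using assms by (intro powr_mono2) auto
  then show ?thesis using real assms by (simp add: powr_powr ennreal_le_iff)
next
  case top
  then show ?thesis using assms by (simp add: ennpowr_def top_unique)
qed

lemma ennpowr_mono:
  assumes "x \<le> y" "r > 0" shows "ennpowr x r \<le> ennpowr y r"
proof (cases "y = \<infinity>")
  case False
  then have y: "y < top" by (simp add: less_top)
  then have "x < top" using assms(1) by (rule le_less_trans[rotated])
  moreover have "enn2real x \<le> enn2real y" using assms(1) y by (rule enn2real_mono)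
  ultimately show ?thesis using y assms(2)
    by (auto simp: ennpowr_def intro!: ennreal_leI powr_mono2)
qed (simp add: ennpowr_def)

lemma distr_fun_antimono:
  assumes [measurable]: "E \<in> sets lebesgue" "f \<in> borel_measurable lebesgue" and "s \<le> t"
  shows "distr_fun E f t \<le> distr_fun E f s"
proof -
  have "{x \<in> space lebesgue. x \<in> E \<and> norm (f x) > s} \<in> sets lebesgue" by measurable
  then have "{x \<in> E. norm (f x) > s} \<in> sets lebesgue" by simp
  then show ?thesis
    unfolding distr_fun_def using assms(3) by (intro emeasure_mono) auto
qed

text \<open>For finite \<open>q\<close>, keep only the part \<open>t/2 \<le> s \<le> t\<close> of the defining integral, where the
  distribution function is at least its value at \<open>t\<close>. Using only this part costs the factor 2 but gives a bound
  uniform in \<open>q\<close>.\<close>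
lemma lorentz_norm_imp_weak:
  fixes f :: "'a::euclidean_space \<Rightarrow> 'b::real_normed_vector"
  assumes meas: "E \<in> sets lebesgue" "f \<in> borel_measurable lebesgue"
    and p: "p > 0" and q: "1 \<le> q"
    and N: "lorentz_norm p q E f \<le> ennreal N" "N \<ge> 0" and t: "t > 0"
  shows "distr_fun E f t \<le> ennreal ((2 * N / t) powr p)"
proof (cases "q = \<infinity>")
  case True
  have "ennreal t * ennpowr (distr_fun E f t) (1 / p) \<le> lorentz_norm p q E f"
    unfolding lorentz_norm_def using True t by (auto intro: SUP_upper)
  then have "ennreal t * ennpowr (distr_fun E f t) (1 / p) \<le> ennreal N"
    using N(1) by (rule order_trans)
  then have "ennpowr (distr_fun E f t) (1 / p) \<le> ennreal (N / t)"
    by (rule ennreal_mult_le_cancel) (use t N in auto)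
  then have "distr_fun E f t \<le> ennreal ((N / t) powr (1 / (1 / p)))"
    by (rule ennpowr_le_imp) (use t N p in auto)
  also have "\<dots> \<le> ennreal ((2 * N / t) powr p)"
    using t N p by (intro ennreal_leI) (auto intro!: powr_mono2 divide_right_mono)
  finally show ?thesis .
next
  case False
  define r where "r = enn2real q"
  have r: "r \<ge> 1"
    using q False by (cases q) (auto simp: r_def)
  let ?\<mu> = "distr_fun E f"
  define I where "I = (\<integral>\<^sup>+s\<in>{0<..}. (ennreal (s powr (r - 1)) * ennpowr (?\<mu> s) (r / p)) \<partial>lborel)"
  have "ennpowr I (1 / r) \<le> ennreal N"
    using N(1) False by (simp add: lorentz_norm_def I_def r_def Let_def)
  then have "I \<le> ennreal (N powr (1 / (1 / r)))"
    by (rule ennpowr_le_imp) (use r N in auto)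
  then have I: "I \<le> ennreal (N powr r)" by simp
  have "ennreal ((t/2) powr r) * ennpowr (?\<mu> t) (r / p)
      = ennreal ((t/2) powr (r - 1)) * ennpowr (?\<mu> t) (r / p) * ennreal (t/2)"
  proof -
    have "(t/2) powr r = (t/2) powr (r - 1) * (t/2)"
      using t by (simp add: powr_diff)
    then have "ennreal ((t/2) powr r) = ennreal ((t/2) powr (r - 1)) * ennreal (t/2)"
      using t by (simp only: ennreal_mult powr_ge_zero)
    then show ?thesis by (simp only: ac_simps)
  qed
  also have "\<dots> = (\<integral>\<^sup>+s. ennreal ((t/2) powr (r - 1)) * ennpowr (?\<mu> t) (r / p) * indicator {t/2..t} s \<partial>lborel)"
    using t by (subst nn_integral_cmult_indicator) auto
  also have "\<dots> \<le> I"
    unfolding I_def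
  proof (intro nn_integral_mono)
    fix s :: real
    show "ennreal ((t/2) powr (r - 1)) * ennpowr (?\<mu> t) (r / p) * indicator {t/2..t} s
        \<le> ennreal (s powr (r - 1)) * ennpowr (?\<mu> s) (r / p) * indicator {0<..} s"
    proof (cases "s \<in> {t/2..t}")
      case True
      then have "s > 0" using t by auto
      have "ennreal ((t/2) powr (r - 1)) * ennpowr (?\<mu> t) (r / p)
          \<le> ennreal (s powr (r - 1)) * ennpowr (?\<mu> s) (r / p)"
        using True t r p meas
        by (intro mult_mono ennreal_leI powr_mono2 ennpowr_mono distr_fun_antimono) auto
      then show ?thesis using True \<open>s > 0\<close> by simp
    qed simp
  qed
  finally have "ennreal ((t/2) powr r) * ennpowr (?\<mu> t) (r / p) \<le> ennreal (N powr r)"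
    using I by (rule order_trans)
  then have "ennpowr (?\<mu> t) (r / p) \<le> ennreal (N powr r / (t/2) powr r)"
    by (rule ennreal_mult_le_cancel) (use t in auto)
  also have "N powr r / (t/2) powr r = (2 * N / t) powr r"
    using t N(2) by (simp add: powr_divide[symmetric] mult.commute)
  finally have "?\<mu> t \<le> ennreal (((2 * N / t) powr r) powr (1 / (r / p)))"
    by (rule ennpowr_le_imp) (use r p in auto)
  then show ?thesis using r p by (simp add: powr_powr)
qed

lemma dyadic_bound:
  fixes a T :: real
  assumes T: "T > 0" and a: "a \<ge> 0"
  shows "ennreal (a^4) \<le> ennreal (T^4) + (\<Sum>k. ennreal ((2^Suc k * T)^4) * indicator {2^k * T<..} a)"
proof (cases "a \<le> T")
  case True
  then have "ennreal (a^4) \<le> ennreal (T^4)" using a by (intro ennreal_leI power_mono)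
  then show ?thesis by (rule order_trans) simp
next
  case False
  obtain m where "a / T < 2^m" using real_arch_pow[of 2 "a / T"] by auto
  then have ex: "\<exists>m. a \<le> 2^m * T" using T by (intro exI[of _ m]) (simp add: field_simps)
  define n where "n = (LEAST m. a \<le> 2^m * T)"
  have n: "a \<le> 2^n * T" unfolding n_def using ex by (rule LeastI_ex)
  with False obtain k where k: "n = Suc k" by (cases n) auto
  have "\<not> a \<le> 2^k * T" using not_less_Least[of k "\<lambda>m. a \<le> 2^m * T"] k by (simp add: n_def)
  then have ind: "a \<in> {2^k * T<..}" by simp
  have "ennreal (a^4) \<le> ennreal ((2^Suc k * T)^4) * indicator {2^k * T<..} a"
    using n a ind by (auto simp: k intro!: ennreal_leI power_mono)
  also have "\<dots> \<le> (\<Sum>k. ennreal ((2^Suc k * T)^4) * indicator {2^k * T<..} a)"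
  proof -
    have "g k \<le> suminf g" for g :: "nat \<Rightarrow> ennreal"
      using sum_le_suminf[of g "{k}"] by (simp add: summableI)
    then show ?thesis .
  qed
  finally show ?thesis by (rule order_trans) simp
qed

text \<open>Dyadic decomposition of the range above the level \<open>T\<close> at which the weak bound equals the
  measure of \<open>E\<close>. The bounds for successive levels decrease by a factor of at most \<open>2 powr (4 - p) \<le> 3/4\<close>,
  so the total is at most \<open>T^4 m\<close> from below the level and \<open>16 T^4 m \<cdot> 4\<close> from above it.\<close>
lemma weak_imp_L4:
  fixes f :: "'a::euclidean_space \<Rightarrow> 'b::real_normed_vector"
  assumes meas [measurable]: "E \<in> sets lebesgue" "f \<in> borel_measurable lebesgue"
    and p: "9/2 \<le> p" and N: "N > 0" and m: "m > 0" "emeasure lebesgue E \<le> ennreal m"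
    and weak: "\<And>t. t > 0 \<Longrightarrow> distr_fun E f t \<le> ennreal ((N / t) powr p)"
  shows "(\<integral>\<^sup>+x\<in>E. ennreal (norm (f x)^4) \<partial>lebesgue) \<le> ennreal (65 * N^4 * m powr (1 - 4 / p))"
proof -
  define T where "T = N * m powr (- 1 / p)"
  have T: "T > 0" using N m by (simp add: T_def)
  have p0: "p > 0" using p by simp
  have lev [measurable]: "{x \<in> E. 2^k * T < norm (f x)} \<in> sets lebesgue" for k
  proof -
    have "{x \<in> space lebesgue. x \<in> E \<and> 2^k * T < norm (f x)} \<in> sets lebesgue" by measurable
    then show ?thesis by simp
  qed
  have "(\<integral>\<^sup>+x\<in>E. ennreal (norm (f x)^4) \<partial>lebesgue)
      \<le> (\<integral>\<^sup>+x. ennreal (T^4) * indicator E x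
        + (\<Sum>k. ennreal ((2^Suc k * T)^4) * indicator {x \<in> E. 2^k * T < norm (f x)} x) \<partial>lebesgue)"
  proof (intro nn_integral_mono)
    fix x
    show "ennreal (norm (f x)^4) * indicator E x \<le> ennreal (T^4) * indicator E x
        + (\<Sum>k. ennreal ((2^Suc k * T)^4) * indicator {x \<in> E. 2^k * T < norm (f x)} x)"
    proof (cases "x \<in> E")
      case True
      then have "indicator {x \<in> E. 2^k * T < norm (f x)} x = (indicator {2^k * T<..} (norm (f x)) :: ennreal)" for k
        by (simp add: indicator_def)
      then show ?thesis using dyadic_bound[OF T, of "norm (f x)"] True by simp
    qed simp
  qed
  also have "\<dots> = ennreal (T^4) * emeasure lebesgue E
      + (\<Sum>k. ennreal ((2^Suc k * T)^4) * distr_fun E f (2^k * T))"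
    by (subst nn_integral_add, measurable, subst nn_integral_suminf, measurable)
      (simp add: nn_integral_cmult_indicator distr_fun_def)
  also have "\<dots> \<le> ennreal (T^4) * ennreal m + (\<Sum>k. ennreal (16 * T^4 * m * (3/4)^k))"
  proof (intro add_mono mult_left_mono m suminf_le summableI)
    fix k :: nat
    have d: "distr_fun E f (2^k * T) \<le> ennreal ((N / (2^k * T)) powr p)"
      using T by (intro weak) simp
    define b :: real where "b = 1 / 2^k"
    have b: "0 < b" "b \<le> 1" "2^k * b = 1" by (simp_all add: b_def)
    have "N / (2^k * T) = b * m powr (1 / p)"
      using N m powr_minus_divide[of m "1 / p"] by (simp add: T_def b_def)
    then have "(N / (2^k * T)) powr p = b powr p * m"
      using b m p0 by (simp add: powr_mult powr_powr)
    also have "b powr p \<le> b powr (4 + 1/2)"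
      using p b by (intro powr_mono') auto
    also have "b powr (4 + 1/2) = b^4 * sqrt b"
      using b by (simp only: powr_add) (simp add: powr_half_sqrt)
    also have "sqrt b \<le> (3/4)^k"
    proof (rule real_le_lsqrt)
      have "b = (1/2)^k" by (simp add: b_def power_one_over)
      also have "\<dots> \<le> (9/16)^k" by (intro power_mono) auto
      also have "\<dots> = ((3/4)^k)^2" by (simp add: power_mult_distrib power2_eq_square flip: power_mult_distrib)
      finally show "b \<le> ((3/4)^k)^2" .
    qed simp
    finally have "(2^Suc k * T)^4 * (N / (2^k * T)) powr p \<le> (2^Suc k * T)^4 * (b^4 * (3/4)^k * m)"
      using m b by (simp add: mult_left_mono mult_right_mono)
    also have "\<dots> = 16 * T^4 * m * (3/4)^k * (2^k * b)^4"
      by (simp add: power_mult_distrib)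
    finally have n: "(2^Suc k * T)^4 * (N / (2^k * T)) powr p \<le> 16 * T^4 * m * (3/4)^k"
      using b by simp
    have "ennreal ((2^Suc k * T)^4) * distr_fun E f (2^k * T)
        \<le> ennreal ((2^Suc k * T)^4) * ennreal ((N / (2^k * T)) powr p)"
      by (intro mult_left_mono d) simp
    also have "\<dots> = ennreal ((2^Suc k * T)^4 * (N / (2^k * T)) powr p)"
      by (rule ennreal_mult[symmetric]) auto
    also have "\<dots> \<le> ennreal (16 * T^4 * m * (3/4)^k)" by (rule ennreal_leI[OF n])
    finally show "ennreal ((2^Suc k * T)^4) * distr_fun E f (2^k * T) \<le> ennreal (16 * T^4 * m * (3/4)^k)" .
  qed auto
  also have "(\<Sum>k. ennreal (16 * T^4 * m * (3/4)^k)) = ennreal (64 * T^4 * m)"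
  proof -
    have "(\<lambda>k. 16 * T^4 * m * (3/4)^k) sums (16 * T^4 * m * (1 / (1 - 3/4)))"
      by (intro sums_mult geometric_sums) simp
    then have s: "(\<lambda>k. 16 * T^4 * m * (3/4)^k) sums (64 * T^4 * m)" by (simp add: mult.assoc)
    have "(\<Sum>k. ennreal (16 * T^4 * m * (3/4)^k)) = ennreal (\<Sum>k. 16 * T^4 * m * (3/4)^k)"
      using m s by (intro suminf_ennreal2) (auto simp: sums_iff)
    then show ?thesis using s by (simp add: sums_iff)
  qed
  also have "ennreal (T^4) * ennreal m + ennreal (64 * T^4 * m) = ennreal (65 * T^4 * m)"
    using m by (simp add: ennreal_mult[symmetric] ennreal_plus[symmetric] del: ennreal_plus)
  also have "T^4 = N^4 * m powr (- 4 / p)"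
    using m by (simp add: T_def power_mult_distrib powr_power)
  also have "65 * (N^4 * m powr (- 4 / p)) * m = 65 * N^4 * m powr (1 - 4 / p)"
    using m by (simp add: powr_diff powr_minus divide_inverse)
  finally show ?thesis .
qed

text \<open>With \<open>\<parallel>u\<parallel> = R powr (3/p - 2/3) M\<close> and measure of order \<open>R^3\<close>, the power of \<open>R\<close> is
  \<open>4 (3/p - 2/3) + 3 (1 - 4/p) = 1/3\<close>, whatever \<open>p\<close> is. The constant is \<open>65 \<cdot> 2^4 \<cdot> 64\<close>.\<close>
lemma annulus_L4_bound:
  fixes u :: "real^3 \<Rightarrow> real^3"
  assumes p: "9/2 \<le> p" and q: "3 \<le> q" and u: "continuous_on UNIV u"
    and R: "R > 0" and Y: "Y > 0" and M: "M_pq p q u R \<le> ennreal Y"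
  shows "(\<integral>x. indicator (annulus R) x * norm (u x)^4 \<partial>lborel) \<le> 66560 * Y^4 * R powr (1/3)"
proof -
  have p0: "p > 0" using p by simp
  have A [measurable]: "annulus R \<in> sets borel"
    using compact_annuli(1)[of R] by (simp add: compact_imp_closed)
  have [measurable]: "u \<in> borel_measurable borel" using u by (rule borel_measurable_continuous_onI)
  have meas: "annulus R \<in> sets lebesgue" "u \<in> borel_measurable lebesgue"
    by (simp_all add: measurable_completion)
  define N where "N = R powr (3/p - 2/3) * Y"
  have N: "N > 0" using R Y by (simp add: N_def)
  have "lorentz_norm p q (annulus R) u \<le> ennreal (Y / R powr (2/3 - 3/p))"
    using M[unfolded M_pq_def] by (rule ennreal_mult_le_cancel) (use R Y in auto)
  also have "Y / R powr (2/3 - 3/p) = N"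
    unfolding N_def using powr_minus_divide[of R "2/3 - 3/p"] by simp
  finally have L: "lorentz_norm p q (annulus R) u \<le> ennreal N" .
  have "1 \<le> q" using q by (rule order_trans[rotated]) simp
  then have weak: "distr_fun (annulus R) u t \<le> ennreal (((2 * N) / t) powr p)" if "t > 0" for t
    using lorentz_norm_imp_weak[OF meas p0 _ L] N that by simp
  define m where "m = 64 * R^3"
  have m: "m > 0" using R by (simp add: m_def)
  have "emeasure lebesgue (annulus R) = emeasure lborel (annulus R)" by simp
  also have "\<dots> = ennreal (measure lborel (annulus R))"
    using fmeasurable_compact[OF compact_annuli(1)[of R]] by (simp add: emeasure_eq_measure2)
  also have "\<dots> \<le> ennreal m" unfolding m_def by (intro ennreal_leI measure_annulus_le R)
  finally have mE: "emeasure lebesgue (annulus R) \<le> ennreal m" .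
  have int: "integrable lborel (\<lambda>x. indicator (annulus R) x * norm (u x)^4)"
    by (intro integrable_indicator_continuous compact_annuli continuous_on_power continuous_on_norm u)
  have "ennreal (\<integral>x. indicator (annulus R) x * norm (u x)^4 \<partial>lborel)
      = (\<integral>\<^sup>+x. ennreal (indicator (annulus R) x * norm (u x)^4) \<partial>lborel)"
    by (rule nn_integral_eq_integral[OF int, symmetric]) simp
  also have "\<dots> = (\<integral>\<^sup>+x\<in>annulus R. ennreal (norm (u x)^4) \<partial>lebesgue)"
    unfolding nn_integral_completion by (intro nn_integral_cong) (simp add: indicator_def)
  also have "\<dots> \<le> ennreal (65 * (2 * N)^4 * m powr (1 - 4 / p))"
    by (rule weak_imp_L4[OF meas p _ m mE weak]) (use N in simp)
  finally have "(\<integral>x. indicator (annulus R) x * norm (u x)^4 \<partial>lborel) \<le> 65 * (2 * N)^4 * m powr (1 - 4 / p)"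
    using N m by (simp add: ennreal_le_iff)
  also have "m powr (1 - 4 / p) \<le> 64 * R powr (3 - 12/p)"
  proof -
    have "m powr (1 - 4 / p) = 64 powr (1 - 4 / p) * (R powr 3) powr (1 - 4 / p)"
      using R by (simp add: m_def powr_mult powr_numeral)
    also have "(R powr 3) powr (1 - 4 / p) = R powr (3 - 12/p)"
      by (simp add: powr_powr algebra_simps)
    also have "(64::real) powr (1 - 4 / p) \<le> 64 powr 1"
      using p0 by (intro powr_mono) auto
    finally show ?thesis by (simp add: mult_right_mono)
  qed
  also have "65 * (2 * N)^4 * (64 * R powr (3 - 12/p)) = 66560 * Y^4 * (R powr (12/p - 8/3) * R powr (3 - 12/p))"
    using R by (simp add: N_def power_mult_distrib powr_power algebra_simps)
  also have "R powr (12/p - 8/3) * R powr (3 - 12/p) = R powr (1/3)"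
    by (simp flip: powr_add)
  finally show ?thesis using N by (simp add: mult_left_mono)
qed

section \<open>Smooth functions and the pressure law\<close>

lemma smooth_differentiable: "smooth f \<Longrightarrow> f differentiable (at x)"
  unfolding smooth_def using C_k.simps(2)[of 0 f] by blast

lemma smooth_continuous: "smooth f \<Longrightarrow> continuous_on UNIV f"
  unfolding smooth_def using C_k.simps(1)[of f] by blast

lemma smooth_pd: "smooth f \<Longrightarrow> smooth (pd j f)"
  unfolding smooth_def using C_k.simps(2)[of _ f] by blast

lemma has_dd_pd:
  assumes "\<And>x. f differentiable (at x)" shows "has_dd (axis j 1) f (pd j f)"
  unfolding pd_def[abs_def]
  using assms by (intro has_dd_of_derivative) (simp add: frechet_derivative_works[symmetric])

lemma pd_eqI:
  assumes "\<And>x. f differentiable (at x)" "has_dd (axis j 1) f f'" shows "pd j f x = f' x"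
  using has_dd_unique[OF has_dd_pd[OF assms(1)] assms(2)] by simp

text \<open>Since \<open>\<rho> \<ge> 0\<close>, the pressure is \<open>a * max 0 \<rho> powr \<gamma>\<close>, the composition of \<open>\<rho>\<close> with a function that is
  continuously differentiable on the whole line; vacuum points need no separate treatment.\<close>
lemma DERIV_max_powr:
  fixes \<gamma> :: real
  assumes "\<gamma> > 1"
  shows "((\<lambda>s. max 0 s powr \<gamma>) has_real_derivative \<gamma> * max 0 s powr (\<gamma> - 1)) (at s)"
proof -
  consider "s < 0" | "s > 0" | "s = 0" by linarith
  then show ?thesis
  proof cases
    case 1
    have "((\<lambda>s. max 0 s powr \<gamma>) has_real_derivative 0) (at s)"
      by (rule has_field_derivative_transform_within_open[of "\<lambda>_. 0" _ _ "{..<0}"]) (use 1 in auto)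
    then show ?thesis using 1 by simp
  next
    case 2
    have "((\<lambda>s. max 0 s powr \<gamma>) has_real_derivative \<gamma> * s powr (\<gamma> - 1)) (at s)"
      by (rule has_field_derivative_transform_within_open[OF has_real_derivative_powr, of _ "{0<..}"])
        (use 2 in auto)
    then show ?thesis using 2 by simp
  next
    case 3
    have "((\<lambda>h. (max 0 h powr \<gamma>) / h) \<longlongrightarrow> 0) (at 0)"
    proof (rule Lim_null_comparison)
      have "norm (max 0 h powr \<gamma> / h) \<le> \<bar>h\<bar> powr (\<gamma> - 1)" for h :: real
      proof (cases "h > 0")
        case True
        then show ?thesis by (simp add: powr_diff)
      next
        case False
        then have "max 0 h powr \<gamma> / h = 0" by (simp add: max_def)
        then show ?thesis by (simp only: norm_zero powr_ge_zero)
      qed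
      then show "\<forall>\<^sub>F h in at 0. norm (max 0 h powr \<gamma> / h) \<le> \<bar>h\<bar> powr (\<gamma> - 1)" by simp
      show "((\<lambda>h::real. \<bar>h\<bar> powr (\<gamma> - 1)) \<longlongrightarrow> 0) (at 0)"
        using assms by (intro tendsto_zero_powrI tendsto_rabs_zero tendsto_ident_at tendsto_const) auto
    qed
    then show ?thesis using 3 by (simp add: DERIV_def)
  qed
qed

text \<open>Take \<open>\<kappa> = a s0 powr (\<gamma> - 1)\<close> where \<open>s0\<close> is the density of pressure \<open>c\<close>. Then
  \<open>c \<le> \<kappa> s \<le> a s powr \<gamma>\<close> for \<open>s \<ge> s0\<close>, and the reverse inequalities hold for \<open>s \<le> s0\<close>.\<close>
lemma pressure_oscillation_bound:
  fixes a \<gamma> c :: real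
  assumes "a > 0" "\<gamma> > 1" "c \<ge> 0"
  obtains \<kappa> where "\<And>s. s \<ge> 0 \<Longrightarrow> \<bar>a * s powr \<gamma> - \<kappa> * s\<bar> \<le> \<bar>a * s powr \<gamma> - c\<bar>"
proof -
  define s0 where "s0 = (c / a) powr (1 / \<gamma>)"
  define \<kappa> where "\<kappa> = a * s0 powr (\<gamma> - 1)"
  have s0: "s0 \<ge> 0" by (simp add: s0_def)
  have mult: "s powr \<gamma> = s powr (\<gamma> - 1) * s" if "s \<ge> 0" for s
    using that assms by (cases "s = 0") (auto simp: powr_diff)
  have "a * s0 powr \<gamma> = c" using assms by (simp add: s0_def powr_powr)
  then have c: "c = \<kappa> * s0" by (simp add: mult[OF s0] \<kappa>_def)
  have \<kappa>: "\<kappa> \<ge> 0" using assms by (simp add: \<kappa>_def)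
  have "\<bar>a * s powr \<gamma> - \<kappa> * s\<bar> \<le> \<bar>a * s powr \<gamma> - c\<bar>" if s: "s \<ge> 0" for s
  proof -
    have eq: "a * s powr \<gamma> - \<kappa> * s = a * (s powr (\<gamma> - 1) - s0 powr (\<gamma> - 1)) * s"
      by (simp add: mult[OF s] \<kappa>_def algebra_simps)
    show ?thesis
    proof (cases "s0 \<le> s")
      case True
      have "s0 powr (\<gamma> - 1) \<le> s powr (\<gamma> - 1)" using True s0 assms by (intro powr_mono2) auto
      then have "0 \<le> a * s powr \<gamma> - \<kappa> * s" using s assms unfolding eq by simp
      moreover have "\<kappa> * s0 \<le> \<kappa> * s" using True \<kappa> by (rule mult_left_mono)
      ultimately show ?thesis unfolding c by linarith
    next
      case False
      then have "s powr (\<gamma> - 1) \<le> s0 powr (\<gamma> - 1)" using s assms by (intro powr_mono2) auto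
      then have "a * s powr \<gamma> - \<kappa> * s \<le> 0"
        using s assms unfolding eq by (simp add: mult_nonneg_nonpos mult_nonpos_nonneg)
      moreover have "\<kappa> * s \<le> \<kappa> * s0" using False \<kappa> by (intro mult_left_mono) auto
      ultimately show ?thesis unfolding c by linarith
    qed
  qed
  then show thesis by (rule that)
qed

section \<open>The equations of a stationary solution\<close>

abbreviation du :: "(real^3 \<Rightarrow> real^3) \<Rightarrow> 3 \<Rightarrow> 3 \<Rightarrow> real^3 \<Rightarrow> real" where
  "du u i j \<equiv> pd j (\<lambda>y. u y $ i)"

abbreviation ddu :: "(real^3 \<Rightarrow> real^3) \<Rightarrow> 3 \<Rightarrow> 3 \<Rightarrow> 3 \<Rightarrow> real^3 \<Rightarrow> real" where
  "ddu u i j k \<equiv> pd k (pd j (\<lambda>y. u y $ i))"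

lemma smooth_dd: "smooth f \<Longrightarrow> has_dd (axis j 1) f (pd j f)"
  by (intro has_dd_pd smooth_differentiable)

lemma solution_smooth:
  assumes "smooth_stationary_NS a \<gamma> \<nu> l \<rho> u"
  shows "smooth \<rho>" "smooth (\<lambda>x. u x $ i)" "\<rho> x \<ge> 0"
  using assms by (auto simp: smooth_stationary_NS_def smooth_vec_def)

lemma mass_equation:
  assumes "smooth_stationary_NS a \<gamma> \<nu> l \<rho> u"
  shows "(\<Sum>j\<in>UNIV. pd j \<rho> x * u x $ j + \<rho> x * du u j j x) = 0"
proof -
  note s = solution_smooth[OF assms]
  have "pd j (\<lambda>y. (\<rho> y *\<^sub>R u y) $ j) x = pd j \<rho> x * u x $ j + \<rho> x * du u j j x" for j
  proof (rule pd_eqI)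
    show "(\<lambda>y. (\<rho> y *\<^sub>R u y) $ j) differentiable (at x)" for x
      by (simp, intro differentiable_mult; rule smooth_differentiable; rule s)
    show "has_dd (axis j 1) (\<lambda>y. (\<rho> y *\<^sub>R u y) $ j) (\<lambda>x. pd j \<rho> x * u x $ j + \<rho> x * du u j j x)"
      by (simp, intro has_dd_mult smooth_dd s)
  qed
  moreover have "divergence (\<lambda>y. \<rho> y *\<^sub>R u y) x = 0"
    using assms by (simp add: smooth_stationary_NS_def)
  ultimately show ?thesis by (simp add: divergence_def)
qed

lemma momentum_equation:
  assumes "smooth_stationary_NS a \<gamma> \<nu> l \<rho> u"
  shows "(\<Sum>j\<in>UNIV. pd j \<rho> x * (u x $ i * u x $ j) + \<rho> x * (du u i j x * u x $ j + u x $ i * du u j j x))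
      - \<nu> * (\<Sum>j\<in>UNIV. ddu u i j j x) - (l + \<nu>) * (\<Sum>k\<in>UNIV. ddu u k k i x)
      + pd i (pressure a \<gamma> \<rho>) x = 0"
proof -
  note s = solution_smooth[OF assms]
  have "pd j (\<lambda>y. (\<rho> y *\<^sub>R outer (u y) (u y)) $ i $ j) x
      = pd j \<rho> x * (u x $ i * u x $ j) + \<rho> x * (du u i j x * u x $ j + u x $ i * du u j j x)" for j
    unfolding outer_def
  proof (rule pd_eqI)
    show "(\<lambda>y. (\<rho> y *\<^sub>R (\<chi> i j. u y $ i * u y $ j)) $ i $ j) differentiable (at x)" for x
      by (simp, intro differentiable_mult; rule smooth_differentiable; rule s)
    show "has_dd (axis j 1) (\<lambda>y. (\<rho> y *\<^sub>R (\<chi> i j. u y $ i * u y $ j)) $ i $ j) (\<lambda>x. pd j \<rho> x * (u x $ i * u x $ j)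
        + \<rho> x * (du u i j x * u x $ j + u x $ i * du u j j x))"
      by (simp, intro has_dd_mult smooth_dd s)
  qed
  then have 1: "tensor_div (\<lambda>y. \<rho> y *\<^sub>R outer (u y) (u y)) x $ i
      = (\<Sum>j\<in>UNIV. pd j \<rho> x * (u x $ i * u x $ j) + \<rho> x * (du u i j x * u x $ j + u x $ i * du u j j x))"
    by (simp add: tensor_div_def divergence_def)
  have 2: "grad (divergence u) x $ i = (\<Sum>k\<in>UNIV. ddu u k k i x)"
    unfolding grad_def divergence_def[abs_def] vec_lambda_beta
  proof (rule pd_eqI)
    show "(\<lambda>x. \<Sum>k\<in>UNIV. du u k k x) differentiable (at x)" for x
      by (intro differentiable_sum ballI; (rule smooth_differentiable smooth_pd s finite)+)
    show "has_dd (axis i 1) (\<lambda>x. \<Sum>k\<in>UNIV. du u k k x) (\<lambda>x. \<Sum>k\<in>UNIV. ddu u k k i x)"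
      by (intro has_dd_sum smooth_dd smooth_pd s)
  qed
  have "tensor_div (\<lambda>y. \<rho> y *\<^sub>R outer (u y) (u y)) x
          - \<nu> *\<^sub>R vec_laplacian u x - (l + \<nu>) *\<^sub>R grad (divergence u) x + grad (pressure a \<gamma> \<rho>) x = 0"
    using assms by (simp add: smooth_stationary_NS_def)
  from arg_cong[OF this, of "\<lambda>z. z $ i"] show ?thesis
    by (simp add: 1 2 vec_laplacian_def) (simp add: grad_def)
qed

lemma pressure_has_derivative:
  assumes "smooth_stationary_NS a \<gamma> \<nu> l \<rho> u" "\<gamma> > 1"
  shows "(pressure a \<gamma> \<rho> has_derivative
    (\<lambda>h. a * (frechet_derivative \<rho> (at x) h * (\<gamma> * \<rho> x powr (\<gamma> - 1))))) (at x)"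
proof -
  note s = solution_smooth[OF assms(1)]
  have eq: "pressure a \<gamma> \<rho> = (\<lambda>x. a * max 0 (\<rho> x) powr \<gamma>)"
    using s(3) by (simp add: pressure_def fun_eq_iff)
  have "(\<rho> has_derivative frechet_derivative \<rho> (at x)) (at x)"
    using smooth_differentiable[OF s(1)] by (simp add: frechet_derivative_works)
  from DERIV_compose_FDERIV[OF DERIV_max_powr[OF assms(2)] this]
  show ?thesis unfolding eq using s(3)[of x]
    by (intro has_derivative_mult_right) (simp add: max_def)
qed

lemma pressure_pd:
  assumes "smooth_stationary_NS a \<gamma> \<nu> l \<rho> u" "\<gamma> > 1"
  shows "pd j (pressure a \<gamma> \<rho>) x = a * (\<gamma> * \<rho> x powr (\<gamma> - 1)) * pd j \<rho> x"
  unfolding pd_def frechet_derivative_at[OF pressure_has_derivative[OF assms], symmetric] by simp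

lemma pressure_dd:
  assumes "smooth_stationary_NS a \<gamma> \<nu> l \<rho> u" "\<gamma> > 1"
  shows "has_dd (axis j 1) (pressure a \<gamma> \<rho>) (pd j (pressure a \<gamma> \<rho>))"
  using pressure_has_derivative[OF assms] by (intro has_dd_pd) (auto simp: differentiable_def)

lemma pressure_continuous:
  assumes "smooth_stationary_NS a \<gamma> \<nu> l \<rho> u" "\<gamma> > 1"
  shows "continuous_on UNIV (pressure a \<gamma> \<rho>)" "continuous_on UNIV (pd j (pressure a \<gamma> \<rho>))"
proof -
  note s = solution_smooth[OF assms(1)]
  show "continuous_on UNIV (pressure a \<gamma> \<rho>)"
    using pressure_has_derivative[OF assms]
    by (auto intro!: continuous_at_imp_continuous_on has_derivative_continuous)
  have pw: "continuous_on UNIV (\<lambda>x. \<rho> x powr (\<gamma> - 1))"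
    using s(3) assms(2)
    by (intro continuous_on_powr' smooth_continuous s continuous_on_const) auto
  show "continuous_on UNIV (pd j (pressure a \<gamma> \<rho>))"
    unfolding pressure_pd[OF assms, abs_def]
    by (intro continuous_on_mult continuous_on_const pw smooth_continuous[OF smooth_pd[OF s(1)]])
qed

text \<open>The matrix field whose divergence is the pressure gradient, by the momentum equation.\<close>
definition stress :: "real \<Rightarrow> real \<Rightarrow> (real^3 \<Rightarrow> real) \<Rightarrow> (real^3 \<Rightarrow> real^3) \<Rightarrow> 3 \<Rightarrow> 3 \<Rightarrow> real^3 \<Rightarrow> real" where
  "stress \<nu> l \<rho> u i j x = \<nu> * du u i j x + (if i = j then l + \<nu> else 0) * (\<Sum>k\<in>UNIV. du u k k x)
     - \<rho> x * (u x $ i * u x $ j)"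

lemma pressure_grad_eq_div:
  assumes sol: "smooth_stationary_NS a \<gamma> \<nu> l \<rho> u" and "\<gamma> > 1"
  shows "grad_eq_div (pressure a \<gamma> \<rho>) (stress \<nu> l \<rho> u)"
proof -
  note s = solution_smooth[OF sol]
  define G' where "G' i j x = \<nu> * ddu u i j j x + (if i = j then l + \<nu> else 0) * (\<Sum>k\<in>UNIV. ddu u k k j x)
     - (pd j \<rho> x * (u x $ i * u x $ j) + \<rho> x * (du u i j x * u x $ j + u x $ i * du u j j x))" for i j x
  have "pd i (pressure a \<gamma> \<rho>) x = (\<Sum>j\<in>UNIV. G' i j x)" for i x
  proof -
    have "(\<Sum>j\<in>UNIV. (if i = j then l + \<nu> else 0) * (\<Sum>k\<in>UNIV. ddu u k k j x))
        = (l + \<nu>) * (\<Sum>k\<in>UNIV. ddu u k k i x)"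
      by (simp add: if_distrib[of "\<lambda>c. c * _"] cong: if_cong)
    then have "(\<Sum>j\<in>UNIV. G' i j x) = \<nu> * (\<Sum>j\<in>UNIV. ddu u i j j x) + (l + \<nu>) * (\<Sum>k\<in>UNIV. ddu u k k i x)
      - (\<Sum>j\<in>UNIV. pd j \<rho> x * (u x $ i * u x $ j) + \<rho> x * (du u i j x * u x $ j + u x $ i * du u j j x))"
      unfolding G'_def by (simp only: sum.distrib[of "\<lambda>j. \<nu> * _ j"] sum_subtractf) (simp add: sum.distrib sum_distrib_left)
    then show ?thesis using momentum_equation[OF sol, where i = i and x = x] by linarith
  qed
  then have "has_dd (axis i 1) (pressure a \<gamma> \<rho>) (\<lambda>x. \<Sum>j\<in>UNIV. G' i j x)" for i
    by (rule has_dd_eq[OF pressure_dd[OF assms]])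
  moreover have "has_dd (axis j 1) (stress \<nu> l \<rho> u i j) (G' i j)" for i j
    unfolding stress_def[abs_def] G'_def[abs_def]
    by (intro has_dd_diff has_dd_add has_dd_cmult has_dd_sum has_dd_mult smooth_dd smooth_pd s)
  moreover have "continuous_on UNIV (stress \<nu> l \<rho> u i j)" "continuous_on UNIV (G' i j)" for i j
    unfolding stress_def[abs_def] G'_def[abs_def]
    by (intro continuous_on_diff continuous_on_add continuous_on_mult continuous_on_const
        continuous_on_sum smooth_continuous smooth_pd s)+
  ultimately show ?thesis
    unfolding grad_eq_div_def using pressure_continuous(1)[OF assms] by blast
qed

section \<open>The cutoff function\<close>

text \<open>A continuously differentiable function of \<open>|x|^2 / R^2\<close> that is 1 up to \<open>9/4\<close> and 0 from \<open>13/4\<close> on, hence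
  1 for \<open>|x| \<le> 3R/2\<close> and 0 for \<open>|x| \<ge> 19R/10\<close>.\<close>
definition cutoff :: "real \<Rightarrow> real^3 \<Rightarrow> real" where
  "cutoff R x = pos_sq (1 - pos_sq (1 / R^2 * (x \<bullet> x) - 9/4))"

definition cutoff1 :: "real \<Rightarrow> 3 \<Rightarrow> real^3 \<Rightarrow> real" where
  "cutoff1 R j x = 2 * max 0 (1 - pos_sq (1 / R^2 * (x \<bullet> x) - 9/4))
     * (0 - 2 * max 0 (1 / R^2 * (x \<bullet> x) - 9/4) * (1 / R^2 * (2 * (x \<bullet> axis j 1)) - 0))"

lemma cutoff_dd: "has_dd (axis j 1) (cutoff R) (cutoff1 R j)"
  unfolding cutoff_def[abs_def] cutoff1_def[abs_def]
  by (rule has_dd_chain[OF DERIV_pos_sq has_dd_diff[OF has_dd_const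
        has_dd_chain[OF DERIV_pos_sq has_dd_diff[OF has_dd_cmult[OF has_dd_inner_self] has_dd_const]]]])

lemma cutoff_continuous: "continuous_on UNIV (cutoff R)" "continuous_on UNIV (cutoff1 R j)"
  unfolding cutoff_def[abs_def] cutoff1_def[abs_def] pos_sq_def
  by (intro continuous_on_mult continuous_on_diff continuous_on_const continuous_on_power
      continuous_on_max continuous_on_inner continuous_on_id)+

lemma cutoff_nonneg: "cutoff R x \<ge> 0"
  by (simp add: cutoff_def pos_sq_def)

lemma cutoff_one:
  assumes "R > 0" "norm x \<le> 3/2 * R" shows "cutoff R x = 1" "cutoff1 R j x = 0"
proof -
  have "(norm x)^2 \<le> (3/2 * R)^2" using assms by (intro power_mono) auto
  then have "1 / R^2 * (x \<bullet> x) - 9/4 \<le> 0"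
    using assms unfolding power2_norm_eq_inner[symmetric] by (simp add: power_mult_distrib power_divide field_simps)
  then have "max 0 (1 / R^2 * (x \<bullet> x) - 9/4) = 0" by (rule max_absorb1)
  then show "cutoff R x = 1" "cutoff1 R j x = 0"
    unfolding cutoff_def cutoff1_def pos_sq_def by simp_all
qed

lemma cutoff_zero:
  assumes "R > 0" "19/10 * R \<le> norm x" shows "cutoff R x = 0" "cutoff1 R j x = 0"
proof -
  have "(19/10 * R)^2 \<le> (norm x)^2" using assms by (intro power_mono) auto
  moreover have "13/4 * R^2 \<le> (19/10 * R)^2" by (simp add: power_mult_distrib power_divide)
  ultimately have "13/4 * R^2 \<le> (norm x)^2" by linarith
  then have t: "1 \<le> 1 / R^2 * (x \<bullet> x) - 9/4"
    using assms unfolding power2_norm_eq_inner[symmetric] by (simp add: power_mult_distrib power_divide field_simps)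
  then have "1 \<le> pos_sq (1 / R^2 * (x \<bullet> x) - 9/4)"
    unfolding pos_sq_def by (intro one_le_power) simp
  then have "max 0 (1 - pos_sq (1 / R^2 * (x \<bullet> x) - 9/4)) = 0" by (intro max_absorb1) simp
  then show "cutoff R x = 0" "cutoff1 R j x = 0"
    unfolding cutoff_def cutoff1_def pos_sq_def[of "1 - _"] by simp_all
qed

lemma cutoff1_bound:
  assumes R: "R > 0" shows "\<bar>cutoff1 R j x\<bar> \<le> 16 / R * indicator (shell R) x"
proof (cases "x \<in> shell R")
  case False
  then have "norm x \<le> 3/2 * R \<or> 19/10 * R \<le> norm x" by (auto simp: shell_def)
  then show ?thesis using cutoff_one(2)[OF R] cutoff_zero(2)[OF R] False by fastforce
next
  case True
  define t where "t = max 0 (1 / R^2 * (x \<bullet> x) - 9/4)"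
  define p where "p = max 0 (1 - t^2)"
  have t0: "t \<ge> 0" by (simp add: t_def)
  have p0: "0 \<le> p" "p \<le> 1" by (simp_all add: p_def)
  have pt: "p * t \<le> 1"
  proof (cases "t \<le> 1")
    case True
    then show ?thesis using mult_mono[of p 1 t 1] p0 t0 by simp
  next
    case False
    then have "1 \<le> t^2" by (intro one_le_power) simp
    then have "p = 0" by (simp add: p_def)
    then show ?thesis by simp
  qed
  have xj: "\<bar>x $ j\<bar> \<le> 19/10 * R"
    using component_le_norm_cart[of x j] True by (simp add: shell_def)
  have "\<bar>cutoff1 R j x\<bar> = 8 * (p * t) * (\<bar>x $ j\<bar> / R^2)"
    unfolding cutoff1_def pos_sq_def t_def[symmetric] p_def[symmetric] inner_axis
    using p0 t0 by (simp add: abs_mult)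
  also have "\<dots> \<le> 8 * 1 * (19/10 * R / R^2)"
    using pt xj t0 p0 R by (intro mult_mono divide_right_mono) auto
  also have "\<dots> \<le> 16 / R" using R by (simp add: field_simps power2_eq_square)
  finally show ?thesis using True by simp
qed

lemma cutoff_cont_cpt: "R > 0 \<Longrightarrow> cont_cpt (cutoff R)"
  unfolding cont_cpt_def
  by (intro conjI cutoff_continuous exI[of _ "19/10 * R"]) (auto intro: cutoff_zero)

section \<open>The local energy inequality\<close>

text \<open>The pointwise content of the local energy identity: at a fixed point, \<open>r\<close>, \<open>v\<close>, \<open>d i j\<close> and
  \<open>D i j k\<close> stand for \<open>\<rho>\<close>, \<open>u_i\<close>, \<open>\<partial>_j u_i\<close> and \<open>\<partial>_k \<partial>_j u_i\<close>. The identity is the momentum equation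
  tested with \<open>v\<close>, up to multiples of the mass equation. For the pressure term, \<open>P' = w r'\<close> and
  \<open>r w = \<gamma> P\<close> together with the mass equation give \<open>\<gamma> P div u = - u \<cdot> \<nabla>P\<close>, whence
  \<open>u \<cdot> \<nabla>P = \<gamma> / (\<gamma> - 1) div (P u)\<close>.\<close>
lemma energy_algebra:
  fixes v r' P' :: "3 \<Rightarrow> real" and d :: "3 \<Rightarrow> 3 \<Rightarrow> real" and D :: "3 \<Rightarrow> 3 \<Rightarrow> 3 \<Rightarrow> real"
    and \<nu> l r P w \<gamma> \<kappa> :: real
  assumes mass: "(\<Sum>j\<in>UNIV. r' j * v j + r * d j j) = 0"
    and mom: "\<And>i. (\<Sum>j\<in>UNIV. r' j * (v i * v j) + r * (d i j * v j + v i * d j j))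
      - \<nu> * (\<Sum>j\<in>UNIV. D i j j) - (l + \<nu>) * (\<Sum>k\<in>UNIV. D k k i) + P' i = 0"
    and P': "\<And>j. P' j = w * r' j" "r * w = \<gamma> * P" and \<gamma>: "\<gamma> > 1"
  shows "(\<Sum>j\<in>UNIV. 1/2 * ((r' j * (\<Sum>i\<in>UNIV. v i * v i) + r * (\<Sum>i\<in>UNIV. d i j * v i + v i * d i j)) * v j
        + r * (\<Sum>i\<in>UNIV. v i * v i) * d j j)
      - \<nu> * (\<Sum>i\<in>UNIV. d i j * d i j + v i * D i j j)
      - (l + \<nu>) * ((\<Sum>k\<in>UNIV. D k k j) * v j + (\<Sum>k\<in>UNIV. d k k) * d j j)
      + \<gamma> / (\<gamma> - 1) * ((P' j - \<kappa> * r' j) * v j + (P - \<kappa> * r) * d j j))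
    = - \<nu> * (\<Sum>i\<in>UNIV. \<Sum>j\<in>UNIV. (d i j)^2) - (l + \<nu>) * (\<Sum>k\<in>UNIV. d k k)^2"
proof -
  define S where "S = (\<Sum>j\<in>UNIV. P' j * v j)"
  define \<delta> where "\<delta> = (\<Sum>k\<in>UNIV. d k k)"
  define V where "V = (\<Sum>i\<in>UNIV. v i * v i)"
  define T where "T = (\<Sum>j\<in>UNIV. r' j * v j)"
  define X where "X = (\<Sum>i\<in>UNIV. \<Sum>j\<in>UNIV. v i * v j * d i j)"
  define L where "L = (\<Sum>i\<in>UNIV. \<Sum>j\<in>UNIV. v i * D i j j)"
  define N where "N = (\<Sum>i\<in>UNIV. \<Sum>k\<in>UNIV. v i * D k k i)"
  have m: "T + r * \<delta> = 0"
    using mass by (simp add: T_def \<delta>_def sum.distrib sum_distrib_left)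
  have S: "S = w * T" by (simp add: S_def T_def P' sum_distrib_left mult.assoc)
  have "S + \<gamma> * P * \<delta> = w * (T + r * \<delta>)" using P'(2) by (simp add: S algebra_simps)
  then have "S + \<gamma> * P * \<delta> = 0" using m by simp
  then have P\<delta>: "P * \<delta> = - S / \<gamma>" using \<gamma> by (simp add: field_simps)
  have pr: "\<gamma> / (\<gamma> - 1) * ((S - \<kappa> * T) + (P - \<kappa> * r) * \<delta>) = S"
  proof -
    have "(S - \<kappa> * T) + (P - \<kappa> * r) * \<delta> = S + P * \<delta> - \<kappa> * (T + r * \<delta>)"
      by (simp add: algebra_simps)
    also have "\<dots> = S - S / \<gamma>" using m P\<delta> by simp
    finally show ?thesis using \<gamma> by (simp add: field_simps)
  qed
  have "0 = (\<Sum>i\<in>UNIV. v i * ((\<Sum>j\<in>UNIV. r' j * (v i * v j) + r * (d i j * v j + v i * d j j))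
      - \<nu> * (\<Sum>j\<in>UNIV. D i j j) - (l + \<nu>) * (\<Sum>k\<in>UNIV. D k k i) + P' i))"
    using mom by simp
  also have "\<dots> = V * (T + r * \<delta>) + r * X - \<nu> * L - (l + \<nu>) * N + S"
    unfolding V_def T_def \<delta>_def X_def L_def N_def S_def by (simp add: sum_3 algebra_simps)
  finally have total: "r * X - \<nu> * L - (l + \<nu>) * N + S = 0" using m by simp
  have "(\<Sum>j\<in>UNIV. 1/2 * ((r' j * V + r * (\<Sum>i\<in>UNIV. d i j * v i + v i * d i j)) * v j + r * V * d j j)
      - \<nu> * (\<Sum>i\<in>UNIV. d i j * d i j + v i * D i j j)
      - (l + \<nu>) * ((\<Sum>k\<in>UNIV. D k k j) * v j + \<delta> * d j j)
      + \<gamma> / (\<gamma> - 1) * ((P' j - \<kappa> * r' j) * v j + (P - \<kappa> * r) * d j j))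
    = 1/2 * V * (T + r * \<delta>) + r * X - \<nu> * ((\<Sum>i\<in>UNIV. \<Sum>j\<in>UNIV. (d i j)^2) + L)
      - (l + \<nu>) * (N + \<delta>^2) + \<gamma> / (\<gamma> - 1) * ((S - \<kappa> * T) + (P - \<kappa> * r) * \<delta>)"
  proof -
    have 1: "(\<Sum>j\<in>UNIV. 1/2 * ((r' j * V + r * (\<Sum>i\<in>UNIV. d i j * v i + v i * d i j)) * v j + r * V * d j j))
      = 1/2 * V * (T + r * \<delta>) + r * X"
      unfolding T_def \<delta>_def X_def by (simp add: sum_3 algebra_simps)
    have 2: "(\<Sum>j\<in>UNIV. \<nu> * (\<Sum>i\<in>UNIV. d i j * d i j + v i * D i j j))
      = \<nu> * ((\<Sum>i\<in>UNIV. \<Sum>j\<in>UNIV. (d i j)^2) + L)"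
      unfolding L_def by (simp add: sum_3 algebra_simps power2_eq_square)
    have 3: "(\<Sum>j\<in>UNIV. (l + \<nu>) * ((\<Sum>k\<in>UNIV. D k k j) * v j + \<delta> * d j j)) = (l + \<nu>) * (N + \<delta>^2)"
    proof -
      have "(\<Sum>j\<in>UNIV. (\<Sum>k\<in>UNIV. D k k j) * v j + \<delta> * d j j) = N + \<delta>^2"
        unfolding N_def power2_eq_square by (subst (3) \<delta>_def) (simp add: sum_3 algebra_simps)
      then show ?thesis by (simp add: sum_distrib_left[symmetric])
    qed
    have 4: "(\<Sum>j\<in>UNIV. \<gamma> / (\<gamma> - 1) * ((P' j - \<kappa> * r' j) * v j + (P - \<kappa> * r) * d j j))
      = \<gamma> / (\<gamma> - 1) * ((S - \<kappa> * T) + (P - \<kappa> * r) * \<delta>)"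
    proof -
      have "(\<Sum>j\<in>UNIV. (P' j - \<kappa> * r' j) * v j + (P - \<kappa> * r) * d j j) = (S - \<kappa> * T) + (P - \<kappa> * r) * \<delta>"
        unfolding S_def T_def \<delta>_def by (simp add: sum_3 algebra_simps)
      then show ?thesis by (simp only: sum_distrib_left[symmetric])
    qed
    have split: "(\<Sum>j\<in>UNIV. A j - B j - C j + E j) = sum A UNIV - sum B UNIV - sum C UNIV + sum E UNIV"
      for A B C E :: "3 \<Rightarrow> real" by (simp add: sum.distrib sum_subtractf)
    show ?thesis by (simp only: split 1 2 3 4 right_diff_distrib[symmetric] refl)
  qed
  also have "\<dots> = - \<nu> * (\<Sum>i\<in>UNIV. \<Sum>j\<in>UNIV. (d i j)^2) - (l + \<nu>) * \<delta>^2"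
    unfolding pr m using total by (simp add: algebra_simps)
  finally show ?thesis unfolding V_def \<delta>_def .
qed

text \<open>The constant \<open>\<kappa>\<close> is free since \<open>\<rho> u\<close> is divergence free; it will be adapted to the mean pressure
  on each annulus.\<close>
definition energy_flux :: "real \<Rightarrow> real \<Rightarrow> real \<Rightarrow> real \<Rightarrow> real \<Rightarrow> (real^3 \<Rightarrow> real) \<Rightarrow> (real^3 \<Rightarrow> real^3) \<Rightarrow> 3 \<Rightarrow> real^3 \<Rightarrow> real" where
  "energy_flux a \<gamma> \<nu> l \<kappa> \<rho> u j x = 1/2 * (\<rho> x * (\<Sum>i\<in>UNIV. u x $ i * u x $ i) * u x $ j)
     - \<nu> * (\<Sum>i\<in>UNIV. u x $ i * du u i j x) - (l + \<nu>) * ((\<Sum>k\<in>UNIV. du u k k x) * u x $ j)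
     + \<gamma> / (\<gamma> - 1) * ((pressure a \<gamma> \<rho> x - \<kappa> * \<rho> x) * u x $ j)"

lemma local_energy_identity:
  assumes sol: "smooth_stationary_NS a \<gamma> \<nu> l \<rho> u" and "\<gamma> > 1"
  obtains F where "\<And>j. has_dd (axis j 1) (energy_flux a \<gamma> \<nu> l \<kappa> \<rho> u j) (F j)"
    "\<And>j. continuous_on UNIV (F j)" "\<And>j. continuous_on UNIV (energy_flux a \<gamma> \<nu> l \<kappa> \<rho> u j)"
    "\<And>x. (\<Sum>j\<in>UNIV. F j x) = - \<nu> * grad_sq u x - (l + \<nu>) * (\<Sum>k\<in>UNIV. du u k k x)^2"
proof -
  note s = solution_smooth[OF sol]
  define F where "F j x = 1/2 * ((pd j \<rho> x * (\<Sum>i\<in>UNIV. u x $ i * u x $ i)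
        + \<rho> x * (\<Sum>i\<in>UNIV. du u i j x * u x $ i + u x $ i * du u i j x)) * u x $ j
        + \<rho> x * (\<Sum>i\<in>UNIV. u x $ i * u x $ i) * du u j j x)
      - \<nu> * (\<Sum>i\<in>UNIV. du u i j x * du u i j x + u x $ i * ddu u i j j x)
      - (l + \<nu>) * ((\<Sum>k\<in>UNIV. ddu u k k j x) * u x $ j + (\<Sum>k\<in>UNIV. du u k k x) * du u j j x)
      + \<gamma> / (\<gamma> - 1) * ((pd j (pressure a \<gamma> \<rho>) x - \<kappa> * pd j \<rho> x) * u x $ j
        + (pressure a \<gamma> \<rho> x - \<kappa> * \<rho> x) * du u j j x)" for j x
  show thesis
  proof (rule that)
    show "has_dd (axis j 1) (energy_flux a \<gamma> \<nu> l \<kappa> \<rho> u j) (F j)" for j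
      unfolding energy_flux_def[abs_def] F_def[abs_def]
      by (intro has_dd_add has_dd_diff has_dd_cmult has_dd_sum has_dd_mult smooth_dd smooth_pd s
          pressure_dd[OF assms])
    show "continuous_on UNIV (F j)" for j
      unfolding F_def[abs_def]
      by (intro continuous_on_diff continuous_on_add continuous_on_mult continuous_on_const
          continuous_on_sum pressure_continuous[OF assms] smooth_continuous[OF s(1)]
          smooth_continuous[OF s(2)] smooth_continuous[OF smooth_pd[OF s(1)]]
          smooth_continuous[OF smooth_pd[OF s(2)]] smooth_continuous[OF smooth_pd[OF smooth_pd[OF s(2)]]])
    show "continuous_on UNIV (energy_flux a \<gamma> \<nu> l \<kappa> \<rho> u j)" for j
      unfolding energy_flux_def[abs_def]
      by (intro continuous_on_diff continuous_on_add continuous_on_mult continuous_on_const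
          continuous_on_sum pressure_continuous[OF assms] smooth_continuous[OF s(1)]
          smooth_continuous[OF s(2)] smooth_continuous[OF smooth_pd[OF s(2)]])
    show "(\<Sum>j\<in>UNIV. F j x) = - \<nu> * grad_sq u x - (l + \<nu>) * (\<Sum>k\<in>UNIV. du u k k x)^2" for x
      unfolding F_def grad_sq_def
    proof (rule energy_algebra[OF mass_equation[OF sol] momentum_equation[OF sol]])
      show "pd j (pressure a \<gamma> \<rho>) x = a * (\<gamma> * \<rho> x powr (\<gamma> - 1)) * pd j \<rho> x" for j
        by (rule pressure_pd[OF assms])
      show "\<rho> x * (a * (\<gamma> * \<rho> x powr (\<gamma> - 1))) = \<gamma> * pressure a \<gamma> \<rho> x"
        using s(3)[of x] powr_mult_base[of "\<rho> x" "\<gamma> - 1"] by (simp add: pressure_def)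
    qed (fact assms)
  qed
qed

lemma grad_sq_continuous:
  assumes "smooth_stationary_NS a \<gamma> \<nu> l \<rho> u"
  shows "continuous_on UNIV (grad_sq u)"
  unfolding grad_sq_def[abs_def]
  by (intro continuous_on_sum continuous_on_power smooth_continuous smooth_pd solution_smooth[OF assms])

lemma grad_sq_nonneg: "grad_sq u x \<ge> 0"
  unfolding grad_sq_def by (intro sum_nonneg) auto

lemma velocity_continuous:
  assumes "smooth_stationary_NS a \<gamma> \<nu> l \<rho> u"
  shows "continuous_on UNIV u"
proof -
  have "continuous_on UNIV (\<lambda>x. \<chi> i. u x $ i)"
    by (intro continuous_on_vec_lambda smooth_continuous solution_smooth[OF assms])
  then show ?thesis by simp
qed

text \<open>The term \<open>(l + \<nu>) (div u)^2\<close> has a favourable sign and is dropped.\<close>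
lemma cutoff_energy_inequality:
  assumes sol: "smooth_stationary_NS a \<gamma> \<nu> l \<rho> u" and g: "\<gamma> > 1" and l: "l + \<nu> \<ge> 0" and R: "R > 0"
  shows "\<nu> * (\<integral>x. cutoff R x * grad_sq u x \<partial>lborel)
    \<le> (\<integral>x. (\<Sum>j\<in>UNIV. cutoff1 R j x * energy_flux a \<gamma> \<nu> l \<kappa> \<rho> u j x) \<partial>lborel)"
proof -
  obtain F where F: "\<And>j. has_dd (axis j 1) (energy_flux a \<gamma> \<nu> l \<kappa> \<rho> u j) (F j)"
    "\<And>j. continuous_on UNIV (F j)" "\<And>j. continuous_on UNIV (energy_flux a \<gamma> \<nu> l \<kappa> \<rho> u j)"
    "\<And>x. (\<Sum>j\<in>UNIV. F j x) = - \<nu> * grad_sq u x - (l + \<nu>) * (\<Sum>k\<in>UNIV. du u k k x)^2"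
    using local_energy_identity[OF sol g, where \<kappa> = \<kappa>] by blast
  note c = cutoff_cont_cpt[OF R]
  have c1: "cont_cpt (cutoff1 R j)" for j by (rule cont_cpt_dd[OF c cutoff_dd cutoff_continuous(2)])
  have div: "continuous_on UNIV (\<lambda>x. (\<Sum>k\<in>UNIV. du u k k x)^2)"
    by (intro continuous_on_sum continuous_on_power smooth_continuous smooth_pd solution_smooth[OF sol])
  have i: "integrable lborel (\<lambda>x. cutoff R x * f x)" if "continuous_on UNIV f" for f
    by (intro cont_cpt_integrable cont_cpt_mult_left c that)
  have "(\<integral>x. (\<Sum>j\<in>UNIV. cutoff1 R j x * energy_flux a \<gamma> \<nu> l \<kappa> \<rho> u j x) \<partial>lborel)
      = (\<Sum>j\<in>UNIV. \<integral>x. cutoff1 R j x * energy_flux a \<gamma> \<nu> l \<kappa> \<rho> u j x \<partial>lborel)"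
    by (rule Bochner_Integration.integral_sum) (intro cont_cpt_integrable cont_cpt_mult_left c1 F)
  also have "\<dots> = (\<Sum>j\<in>UNIV. - (\<integral>x. cutoff R x * F j x \<partial>lborel))"
    by (intro sum.cong refl integral_by_parts[OF c cutoff_dd cutoff_continuous(2) F(3,1,2)])
  also have "\<dots> = - (\<integral>x. (\<Sum>j\<in>UNIV. cutoff R x * F j x) \<partial>lborel)"
    using i F(2) by (simp add: sum_negf)
  also have "(\<lambda>x. \<Sum>j\<in>UNIV. cutoff R x * F j x)
      = (\<lambda>x. - (\<nu> * (cutoff R x * grad_sq u x)) - (l + \<nu>) * (cutoff R x * (\<Sum>k\<in>UNIV. du u k k x)^2))"
    unfolding sum_distrib_left[symmetric] F(4) by (simp add: fun_eq_iff algebra_simps)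
  also have "- (\<integral>x. - (\<nu> * (cutoff R x * grad_sq u x)) - (l + \<nu>) * (cutoff R x * (\<Sum>k\<in>UNIV. du u k k x)^2) \<partial>lborel)
      = \<nu> * (\<integral>x. cutoff R x * grad_sq u x \<partial>lborel)
        + (l + \<nu>) * (\<integral>x. cutoff R x * (\<Sum>k\<in>UNIV. du u k k x)^2 \<partial>lborel)"
    using i[OF grad_sq_continuous[OF sol]] i[OF div] by simp
  moreover have "(l + \<nu>) * (\<integral>x. cutoff R x * (\<Sum>k\<in>UNIV. du u k k x)^2 \<partial>lborel) \<ge> 0"
    by (intro mult_nonneg_nonneg l integral_nonneg_AE AE_I2) (simp_all add: cutoff_nonneg)
  ultimately show ?thesis by linarith
qed

lemma du_bound: "\<bar>du u i j x\<bar> \<le> sqrt (grad_sq u x)"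
proof (rule real_le_rsqrt)
  have "(du u i j x)^2 \<le> (\<Sum>j\<in>UNIV. (du u i j x)^2)" by (rule member_le_sum) auto
  also have "\<dots> \<le> grad_sq u x"
    unfolding grad_sq_def by (rule member_le_sum) (auto intro!: sum_nonneg)
  finally show "\<bar>du u i j x\<bar>^2 \<le> grad_sq u x" by simp
qed

lemma div_bound: "\<bar>\<Sum>k\<in>UNIV. du u k k x\<bar> \<le> 3 * sqrt (grad_sq u x)"
proof -
  have "\<bar>\<Sum>k\<in>UNIV. du u k k x\<bar> \<le> (\<Sum>k\<in>(UNIV::3 set). sqrt (grad_sq u x))"
    by (intro order_trans[OF sum_abs] sum_mono du_bound)
  then show ?thesis by simp
qed

lemma flux_bound:
  assumes nu: "\<nu> \<ge> 0" "l + \<nu> \<ge> 0" and rho: "0 \<le> \<rho> x" "\<rho> x \<le> K" and g: "\<gamma> > 1"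
    and k: "\<bar>pressure a \<gamma> \<rho> x - \<kappa> * \<rho> x\<bar> \<le> \<bar>pressure a \<gamma> \<rho> x - c\<bar>"
  shows "\<bar>energy_flux a \<gamma> \<nu> l \<kappa> \<rho> u j x\<bar> \<le> K * ((norm (u x))^2 * norm (u x))
    + 3 * (\<nu> + (l + \<nu>)) * (sqrt (grad_sq u x) * norm (u x))
    + \<gamma> / (\<gamma> - 1) * (\<bar>pressure a \<gamma> \<rho> x - c\<bar> * norm (u x))"
proof -
  let ?U = "norm (u x)" and ?g = "sqrt (grad_sq u x)"
  have g0: "?g \<ge> 0" by (simp add: grad_sq_nonneg)
  have u: "\<bar>u x $ i\<bar> \<le> ?U" for i by (rule component_le_norm_cart)
  have V: "(\<Sum>i\<in>UNIV. u x $ i * u x $ i) = ?U^2"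
    by (simp add: power2_norm_eq_inner inner_vec_def)
  have 1: "\<bar>1/2 * (\<rho> x * (\<Sum>i\<in>UNIV. u x $ i * u x $ i) * u x $ j)\<bar> \<le> K * (?U^2 * ?U)"
  proof -
    have "\<bar>\<rho> x * ?U^2 * u x $ j\<bar> \<le> K * ?U^2 * ?U"
      unfolding abs_mult using rho u by (intro mult_mono) auto
    moreover have "\<bar>1/2 * y\<bar> \<le> \<bar>y\<bar>" for y :: real by simp
    ultimately show ?thesis unfolding V by (metis order_trans mult.assoc)
  qed
  have 2: "\<bar>\<nu> * (\<Sum>i\<in>UNIV. u x $ i * du u i j x)\<bar> \<le> 3 * \<nu> * (?g * ?U)"
  proof -
    have "\<bar>\<Sum>i\<in>UNIV. u x $ i * du u i j x\<bar> \<le> (\<Sum>i\<in>(UNIV::3 set). ?U * ?g)"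
      by (intro order_trans[OF sum_abs] sum_mono) (unfold abs_mult, intro mult_mono u du_bound; simp)
    then have "\<nu> * \<bar>\<Sum>i\<in>UNIV. u x $ i * du u i j x\<bar> \<le> \<nu> * (3 * (?U * ?g))"
      using nu by (intro mult_left_mono) auto
    then show ?thesis using nu by (simp add: abs_mult mult_ac)
  qed
  have 3: "\<bar>(l + \<nu>) * ((\<Sum>k\<in>UNIV. du u k k x) * u x $ j)\<bar> \<le> 3 * (l + \<nu>) * (?g * ?U)"
  proof -
    have "\<bar>(\<Sum>k\<in>UNIV. du u k k x) * u x $ j\<bar> \<le> 3 * ?g * ?U"
      unfolding abs_mult by (intro mult_mono div_bound u) (auto simp: grad_sq_nonneg)
    then have "(l + \<nu>) * \<bar>(\<Sum>k\<in>UNIV. du u k k x) * u x $ j\<bar> \<le> (l + \<nu>) * (3 * ?g * ?U)"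
      using nu by (intro mult_left_mono) auto
    also have "\<dots> = 3 * (l + \<nu>) * (?g * ?U)" by (simp only: mult_ac)
    moreover have "\<bar>(l + \<nu>) * y\<bar> = (l + \<nu>) * \<bar>y\<bar>" for y using nu by (simp add: abs_mult)
    ultimately show ?thesis by (simp only:)
  qed
  have 4: "\<bar>\<gamma> / (\<gamma> - 1) * ((pressure a \<gamma> \<rho> x - \<kappa> * \<rho> x) * u x $ j)\<bar>
      \<le> \<gamma> / (\<gamma> - 1) * (\<bar>pressure a \<gamma> \<rho> x - c\<bar> * ?U)"
  proof -
    have "\<bar>(pressure a \<gamma> \<rho> x - \<kappa> * \<rho> x) * u x $ j\<bar> \<le> \<bar>pressure a \<gamma> \<rho> x - c\<bar> * ?U"
      unfolding abs_mult by (intro mult_mono k u) auto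
    then have "\<gamma> / (\<gamma> - 1) * \<bar>(pressure a \<gamma> \<rho> x - \<kappa> * \<rho> x) * u x $ j\<bar>
        \<le> \<gamma> / (\<gamma> - 1) * (\<bar>pressure a \<gamma> \<rho> x - c\<bar> * ?U)"
      using g by (intro mult_left_mono) auto
    then show ?thesis using g by (simp add: abs_mult)
  qed
  have tri: "\<bar>A - B - C + E\<bar> \<le> \<bar>A\<bar> + \<bar>B\<bar> + \<bar>C\<bar> + \<bar>E\<bar>" for A B C E :: real by linarith
  have "3 * (\<nu> + (l + \<nu>)) * (?g * ?U) = 3 * \<nu> * (?g * ?U) + 3 * (l + \<nu>) * (?g * ?U)"
    by (simp only: distrib_left distrib_right)
  then show ?thesis
    unfolding energy_flux_def using order_trans[OF tri add_mono[OF add_mono[OF add_mono[OF 1 2] 3] 4]] by simp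
qed

lemma stress_energy_bound:
  assumes sol: "smooth_stationary_NS a \<gamma> \<nu> l \<rho> u" and nu: "\<nu> \<ge> 0" "l + \<nu> \<ge> 0"
    and K: "\<And>x. \<rho> x \<le> K"
  shows "stress_energy (stress \<nu> l \<rho> u) (annulus R)
    \<le> 18 * ((3 * (\<nu> + (l + \<nu>)))^2 * (\<integral>x. indicator (annulus R) x * grad_sq u x \<partial>lborel)
      + K^2 * (\<integral>x. indicator (annulus R) x * norm (u x)^4 \<partial>lborel))"
proof -
  define b where "b = 3 * (\<nu> + (l + \<nu>))"
  note s = solution_smooth[OF sol]
  let ?d = "\<integral>x. indicator (annulus R) x * grad_sq u x \<partial>lborel"
  let ?x = "\<integral>x. indicator (annulus R) x * norm (u x)^4 \<partial>lborel"
  have pw: "(stress \<nu> l \<rho> u i j x)^2 \<le> 2 * (b^2 * grad_sq u x + K^2 * norm (u x)^4)" for i j x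
  proof -
    let ?g = "sqrt (grad_sq u x)"
    have g0: "?g \<ge> 0" by (simp add: grad_sq_nonneg)
    have "\<bar>\<nu> * du u i j x\<bar> \<le> \<nu> * ?g"
      unfolding abs_mult using nu by (simp add: mult_left_mono du_bound)
    moreover have "\<bar>(if i = j then l + \<nu> else 0) * (\<Sum>k\<in>UNIV. du u k k x)\<bar> \<le> (l + \<nu>) * (3 * ?g)"
      unfolding abs_mult using nu g0 by (intro mult_mono div_bound) auto
    moreover have "\<bar>\<rho> x * (u x $ i * u x $ j)\<bar> \<le> K * (norm (u x) * norm (u x))"
      unfolding abs_mult using s(3)[of x] K[of x]
      by (intro mult_mono component_le_norm_cart) auto
    moreover have "\<nu> * ?g + (l + \<nu>) * (3 * ?g) \<le> b * ?g"
    proof -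
      have "\<nu> + (l + \<nu>) * 3 \<le> b" using nu by (simp add: b_def)
      from mult_right_mono[OF this g0] show ?thesis by (simp add: algebra_simps)
    qed
    ultimately have "\<bar>stress \<nu> l \<rho> u i j x\<bar> \<le> b * ?g + K * (norm (u x) * norm (u x))"
      unfolding stress_def by linarith
    then have "\<bar>stress \<nu> l \<rho> u i j x\<bar>^2 \<le> (b * ?g + K * (norm (u x) * norm (u x)))^2"
      by (intro power_mono) auto
    also have "\<dots> \<le> 2 * ((b * ?g)^2 + (K * (norm (u x) * norm (u x)))^2)"
      using zero_le_power2[of "b * ?g - K * (norm (u x) * norm (u x))"]
      by (simp add: power2_sum power2_diff)
    also have "\<dots> = 2 * (b^2 * grad_sq u x + K^2 * norm (u x)^4)"
      by (simp add: power_mult_distrib grad_sq_nonneg flip: power_add)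
    finally show ?thesis by simp
  qed
  have id: "integrable lborel (\<lambda>x. indicator (annulus R) x * grad_sq u x)"
    by (intro integrable_indicator_continuous compact_annuli grad_sq_continuous[OF sol])
  have ix: "integrable lborel (\<lambda>x. indicator (annulus R) x * norm (u x)^4)"
    by (intro integrable_indicator_continuous compact_annuli continuous_on_power continuous_on_norm
        velocity_continuous[OF sol])
  have "stress_energy (stress \<nu> l \<rho> u) (annulus R)
      \<le> (\<Sum>i\<in>(UNIV::3 set). \<Sum>j\<in>(UNIV::3 set). 2 * (b^2 * ?d + K^2 * ?x))"
    unfolding stress_energy_def
  proof (intro sum_mono)
    fix i j
    have "(\<integral>x. indicator (annulus R) x * (stress \<nu> l \<rho> u i j x)^2 \<partial>lborel)
      \<le> (\<integral>x. 2 * (b^2 * (indicator (annulus R) x * grad_sq u x)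
          + K^2 * (indicator (annulus R) x * norm (u x)^4)) \<partial>lborel)"
    proof (rule integral_mono)
      show "integrable lborel (\<lambda>x. indicator (annulus R) x * (stress \<nu> l \<rho> u i j x)^2)"
        unfolding stress_def[abs_def]
        by (intro integrable_indicator_continuous compact_annuli continuous_on_power continuous_on_diff
            continuous_on_add continuous_on_mult continuous_on_const continuous_on_sum
            smooth_continuous[OF s(1)] smooth_continuous[OF s(2)] smooth_continuous[OF smooth_pd[OF s(2)]])
      show "integrable lborel (\<lambda>x. 2 * (b^2 * (indicator (annulus R) x * grad_sq u x)
          + K^2 * (indicator (annulus R) x * norm (u x)^4)))"
        using id ix by simp
      show "indicator (annulus R) x * (stress \<nu> l \<rho> u i j x)^2
          \<le> 2 * (b^2 * (indicator (annulus R) x * grad_sq u x) + K^2 * (indicator (annulus R) x * norm (u x)^4))" for x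
        using pw[of i j x] by (simp add: indicator_def)
    qed
    also have "\<dots> = 2 * (b^2 * ?d + K^2 * ?x)" using id ix by simp
    finally show "(\<integral>x. indicator (annulus R) x * (stress \<nu> l \<rho> u i j x)^2 \<partial>lborel)
      \<le> 2 * (b^2 * ?d + K^2 * ?x)" .
  qed
  then show ?thesis by (simp add: b_def)
qed

text \<open>Each part of the flux pairs \<open>|u|\<close> with one of \<open>|u|^2\<close>, \<open>|\<nabla>u|\<close> and \<open>|P - c|\<close>, so by Cauchy-Schwarz only
  the \<open>L^2\<close> norms of these appear; for the last one the pressure estimate reduces to the
  first two. The factor 48 is three components times the bound 16 for the gradient of the
  cutoff.\<close>
lemma Caccioppoli_inequality:
  assumes sol: "smooth_stationary_NS a \<gamma> \<nu> l \<rho> u" and a: "a > 0" and g: "\<gamma> > 1"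
    and nu: "\<nu> > 0" "l + \<nu> \<ge> 0" and K: "\<And>x. \<rho> x \<le> K"
  shows "\<exists>C\<ge>0. \<forall>R>0. (\<integral>x. indicator (cball 0 R) x * grad_sq u x \<partial>lborel)
    \<le> C / R * sqrt (\<integral>x. indicator (annulus R) x * (norm (u x))^2 \<partial>lborel)
      * (sqrt (\<integral>x. indicator (annulus R) x * norm (u x)^4 \<partial>lborel)
        + sqrt (\<integral>x. indicator (annulus R) x * grad_sq u x \<partial>lborel))"
proof -
  note s = solution_smooth[OF sol]
  have K0: "K \<ge> 0" using s(3)[of 0] K[of 0] by linarith
  define b where "b = 3 * (\<nu> + (l + \<nu>))"
  have b0: "b \<ge> 0" using nu by (simp add: b_def)
  define \<gamma>' where "\<gamma>' = \<gamma> / (\<gamma> - 1)"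
  have g0: "\<gamma>' \<ge> 0" using g by (simp add: \<gamma>'_def)
  let ?P = "pressure a \<gamma> \<rho>"
  obtain Cp where Cp: "Cp > 0" and press: "\<And>R P G. R > 0 \<Longrightarrow> grad_eq_div P G \<Longrightarrow> (\<And>x. P x \<ge> 0) \<Longrightarrow>
    \<exists>c\<ge>0. (\<integral>x. indicator (shell R) x * (P x - c)^2 \<partial>lborel) \<le> Cp * stress_energy G (annulus R)"
    using pressure_L2_annulus by blast
  define C3 where "C3 = sqrt (18 * Cp)"
  have C30: "C3 \<ge> 0" using Cp by (simp add: C3_def)
  define C where "C = 48 * ((K + b) * (1 + \<gamma>' * C3)) / \<nu>"
  have "C \<ge> 0" using K0 b0 g0 C30 nu by (simp add: C_def)
  moreover have "(\<integral>x. indicator (cball 0 R) x * grad_sq u x \<partial>lborel) \<le> C / R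
      * sqrt (\<integral>x. indicator (annulus R) x * (norm (u x))^2 \<partial>lborel)
      * (sqrt (\<integral>x. indicator (annulus R) x * norm (u x)^4 \<partial>lborel)
        + sqrt (\<integral>x. indicator (annulus R) x * grad_sq u x \<partial>lborel))" if R: "R > 0" for R
  proof -
    let ?A = "indicator (annulus R) :: real^3 \<Rightarrow> real" and ?S = "indicator (shell R) :: real^3 \<Rightarrow> real"
    define Z where "Z = sqrt (\<integral>x. ?A x * (norm (u x))^2 \<partial>lborel)"
    define X where "X = sqrt (\<integral>x. ?A x * norm (u x)^4 \<partial>lborel)"
    define d where "d = sqrt (\<integral>x. ?A x * grad_sq u x \<partial>lborel)"
    have nn: "(\<integral>x. ?A x * norm (u x)^4 \<partial>lborel) \<ge> 0" "(\<integral>x. ?A x * grad_sq u x \<partial>lborel) \<ge> 0"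
      "(\<integral>x. ?A x * (norm (u x))^2 \<partial>lborel) \<ge> 0"
      by (intro integral_nonneg_AE AE_I2; simp add: grad_sq_nonneg)+
    have pos: "Z \<ge> 0" "X \<ge> 0" "d \<ge> 0" using nn by (simp_all add: Z_def X_def d_def)
    obtain c where c: "c \<ge> 0" and osc: "(\<integral>x. ?S x * (?P x - c)^2 \<partial>lborel)
        \<le> Cp * stress_energy (stress \<nu> l \<rho> u) (annulus R)"
      using press[OF R pressure_grad_eq_div[OF sol g]] a by (auto simp: pressure_def)
    obtain \<kappa> where \<kappa>: "\<And>s. s \<ge> 0 \<Longrightarrow> \<bar>a * s powr \<gamma> - \<kappa> * s\<bar> \<le> \<bar>a * s powr \<gamma> - c\<bar>"
      using pressure_oscillation_bound[OF a g c] by blast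
    have u: "continuous_on UNIV u" by (rule velocity_continuous[OF sol])
    have P: "continuous_on UNIV ?P" by (rule pressure_continuous[OF sol g])
    have gs: "continuous_on UNIV (grad_sq u)" by (rule grad_sq_continuous[OF sol])
    note CS1 = Cauchy_Schwarz_indicator[OF compact_annuli(1,1), of "\<lambda>x. (norm (u x))^2" "\<lambda>x. norm (u x)" R R]
    note CS2 = Cauchy_Schwarz_indicator[OF compact_annuli(1,1), of "\<lambda>x. sqrt (grad_sq u x)" "\<lambda>x. norm (u x)" R R]
    note CS3 = Cauchy_Schwarz_indicator[OF compact_annuli(2,1), of "\<lambda>x. \<bar>?P x - c\<bar>" "\<lambda>x. norm (u x)" R R]
    have cont: "continuous_on UNIV (\<lambda>x. (norm (u x))^2)" "continuous_on UNIV (\<lambda>x. norm (u x))"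
      "continuous_on UNIV (\<lambda>x. sqrt (grad_sq u x))" "continuous_on UNIV (\<lambda>x. \<bar>?P x - c\<bar>)"
      by (intro continuous_intros u P gs)+
    note CS1 = CS1[OF cont(1,2)] and CS2 = CS2[OF cont(3,2)] and CS3 = CS3[OF cont(4,2)]
    let ?f1 = "\<lambda>x. (?A x * (norm (u x))^2) * (?A x * norm (u x))"
    let ?f2 = "\<lambda>x. (?A x * sqrt (grad_sq u x)) * (?A x * norm (u x))"
    let ?f3 = "\<lambda>x. (?S x * \<bar>?P x - c\<bar>) * (?A x * norm (u x))"
    have I1: "(\<integral>x. ?f1 x \<partial>lborel) \<le> X * Z"
      using CS1(2) by (simp add: X_def Z_def flip: power_mult)
    have I2: "(\<integral>x. ?f2 x \<partial>lborel) \<le> d * Z"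
      using CS2(2) by (simp add: d_def Z_def grad_sq_nonneg)
    have I3: "(\<integral>x. ?f3 x \<partial>lborel) \<le> C3 * (b * d + K * X) * Z"
    proof -
      have "(\<integral>x. ?S x * \<bar>?P x - c\<bar>^2 \<partial>lborel) \<le> Cp * (18 * (b^2 * d^2 + K^2 * X^2))"
        using order_trans[OF osc mult_left_mono[OF stress_energy_bound[OF sol _ nu(2) K, of R] less_imp_le[OF Cp]]] nu(1) nn
        by (simp add: b_def X_def d_def)
      also have "\<dots> \<le> Cp * (18 * (b * d + K * X)^2)"
        using Cp b0 K0 pos by (intro mult_left_mono) (auto simp: power2_sum power_mult_distrib)
      also have "\<dots> = (C3 * (b * d + K * X))^2"
        using Cp by (simp add: C3_def power_mult_distrib)
      finally have "sqrt (\<integral>x. ?S x * \<bar>?P x - c\<bar>^2 \<partial>lborel) \<le> C3 * (b * d + K * X)"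
        by (rule real_le_lsqrt[rotated -1]) (use C30 b0 K0 pos in auto)
      then have "sqrt (\<integral>x. ?S x * \<bar>?P x - c\<bar>^2 \<partial>lborel) * Z \<le> C3 * (b * d + K * X) * Z"
        using pos(1) by (rule mult_right_mono)
      with CS3(2) show ?thesis by (simp add: Z_def)
    qed
    have "\<nu> * (\<integral>x. indicator (cball 0 R) x * grad_sq u x \<partial>lborel) \<le> \<nu> * (\<integral>x. cutoff R x * grad_sq u x \<partial>lborel)"
    proof (intro mult_left_mono integral_mono)
      show "integrable lborel (\<lambda>x. indicator (cball 0 R) x * grad_sq u x)"
        by (intro integrable_indicator_continuous gs) simp
      show "integrable lborel (\<lambda>x. cutoff R x * grad_sq u x)"
        by (intro cont_cpt_integrable cont_cpt_mult_left cutoff_cont_cpt R gs)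
      show "indicator (cball 0 R) x * grad_sq u x \<le> cutoff R x * grad_sq u x" for x
        using cutoff_one(1)[OF R, of x] R
        by (intro mult_right_mono) (auto simp: indicator_def cutoff_nonneg grad_sq_nonneg)
    qed (use nu in simp)
    also have "\<dots> \<le> (\<integral>x. (\<Sum>j\<in>UNIV. cutoff1 R j x * energy_flux a \<gamma> \<nu> l \<kappa> \<rho> u j x) \<partial>lborel)"
      by (rule cutoff_energy_inequality[OF sol g nu(2) R])
    also have "\<dots> \<le> (\<integral>x. 48 / R * (K * ?f1 x + b * ?f2 x + \<gamma>' * ?f3 x) \<partial>lborel)"
    proof (rule integral_mono)
      have c1: "cont_cpt (cutoff1 R j)" for j
        by (rule cont_cpt_dd[OF cutoff_cont_cpt[OF R] cutoff_dd cutoff_continuous(2)])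
      obtain F where "\<And>j. continuous_on UNIV (energy_flux a \<gamma> \<nu> l \<kappa> \<rho> u j)"
        using local_energy_identity[OF sol g, where \<kappa> = \<kappa>] by blast
      then show "integrable lborel (\<lambda>x. \<Sum>j\<in>UNIV. cutoff1 R j x * energy_flux a \<gamma> \<nu> l \<kappa> \<rho> u j x)"
        by (intro cont_cpt_integrable cont_cpt_sum cont_cpt_mult_left c1)
      show "integrable lborel (\<lambda>x. 48 / R * (K * ?f1 x + b * ?f2 x + \<gamma>' * ?f3 x))"
        using CS1(1) CS2(1) CS3(1) by (intro integrable_mult_right Bochner_Integration.integrable_add)
      show "(\<Sum>j\<in>UNIV. cutoff1 R j x * energy_flux a \<gamma> \<nu> l \<kappa> \<rho> u j x)
          \<le> 48 / R * (K * ?f1 x + b * ?f2 x + \<gamma>' * ?f3 x)" for x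
      proof (cases "x \<in> shell R")
        case True
        then have xA: "x \<in> annulus R" using shell_annulus[OF R] by blast
        have fb: "\<bar>energy_flux a \<gamma> \<nu> l \<kappa> \<rho> u j x\<bar> \<le> K * ?f1 x + b * ?f2 x + \<gamma>' * ?f3 x" for j
          using flux_bound[OF _ nu(2) s(3) K g, where a = a and x = x and \<kappa> = \<kappa> and c = c and u = u and j = j] \<kappa>[OF s(3)[of x]] nu(1) True xA
          by (simp add: b_def \<gamma>'_def pressure_def)
        have "(\<Sum>j\<in>UNIV. cutoff1 R j x * energy_flux a \<gamma> \<nu> l \<kappa> \<rho> u j x)
            \<le> (\<Sum>j\<in>(UNIV::3 set). 16 / R * (K * ?f1 x + b * ?f2 x + \<gamma>' * ?f3 x))"
        proof (rule sum_mono)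
          fix j
          have "\<bar>cutoff1 R j x * energy_flux a \<gamma> \<nu> l \<kappa> \<rho> u j x\<bar>
              \<le> 16 / R * (K * ?f1 x + b * ?f2 x + \<gamma>' * ?f3 x)"
            unfolding abs_mult using cutoff1_bound[OF R, of j x] True R
            by (intro mult_mono fb) auto
          then show "cutoff1 R j x * energy_flux a \<gamma> \<nu> l \<kappa> \<rho> u j x
              \<le> 16 / R * (K * ?f1 x + b * ?f2 x + \<gamma>' * ?f3 x)" by linarith
        qed
        also have "\<dots> = 48 / R * (K * ?f1 x + b * ?f2 x + \<gamma>' * ?f3 x)" by simp
        finally show ?thesis .
      next
        case False
        then have "cutoff1 R j x = 0" for j using cutoff1_bound[OF R, of j x] by simp
        then show ?thesis using R K0 b0 g0 by (simp add: grad_sq_nonneg)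
      qed
    qed
    also have "\<dots> = 48 / R * (K * (\<integral>x. ?f1 x \<partial>lborel) + b * (\<integral>x. ?f2 x \<partial>lborel) + \<gamma>' * (\<integral>x. ?f3 x \<partial>lborel))"
      using CS1(1) CS2(1) CS3(1) by simp
    also have "\<dots> \<le> 48 / R * (K * (X * Z) + b * (d * Z) + \<gamma>' * (C3 * (b * d + K * X) * Z))"
      using R K0 b0 g0 by (intro mult_left_mono add_mono I1 I2 I3) auto
    also have "\<dots> = 48 / R * (Z * ((K * X + b * d) * (1 + \<gamma>' * C3)))"
      by (simp add: algebra_simps)
    also have "\<dots> \<le> 48 / R * (Z * (((K + b) * (X + d)) * (1 + \<gamma>' * C3)))"
    proof -
      have "K * X + b * d \<le> (K + b) * (X + d)"
        using K0 b0 pos by (simp add: distrib_left distrib_right)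
      then show ?thesis using R pos g0 C30 by (intro mult_left_mono mult_right_mono) auto
    qed
    also have "\<dots> = \<nu> * (C / R * Z * (X + d))"
      using nu R by (simp add: C_def)
    finally have "(\<integral>x. indicator (cball 0 R) x * grad_sq u x \<partial>lborel) \<le> C / R * Z * (X + d)"
      by (rule mult_left_le_imp_le) (rule nu)
    then show ?thesis by (simp add: Z_def X_def d_def)
  qed
  ultimately show ?thesis by blast
qed

section \<open>Growth of the energy and the Liouville theorem\<close>

lemma in_Linfinity_bound:
  assumes f: "continuous_on UNIV f" and "in_Linfinity f"
  obtains K where "\<And>x. f x \<le> K"
proof -
  obtain K where "AE x in lebesgue. \<bar>f x\<bar> \<le> K" using assms(2) by (auto simp: in_Linfinity_def)
  then have "AE x in lborel. \<bar>f x\<bar> \<le> K" by (simp add: AE_completion_iff)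
  then have ae: "AE x in lborel. max 0 (f x - K) = 0" by eventually_elim simp
  have "max 0 (f x - K) = 0" for x
    by (rule continuous_AE_zero[OF _ ae]) (intro continuous_intros f)
  then have "f x \<le> K" for x by (metis diff_le_0_iff_le max.cobounded2)
  then show thesis by (rule that)
qed

text \<open>By the \<open>L^4\<close> bound, the norms of \<open>|u|^2\<close> and \<open>|u|\<close> on the annulus are of order \<open>Y^2 R powr (1/6)\<close> and
  \<open>Y R powr (5/6)\<close>, so the nonlinear term is of order \<open>Y^3\<close>, independent of \<open>R\<close>, while
  the term linear in \<open>\<nabla>u\<close> gains \<open>R powr (- 1/6)\<close>. The constants 260 and 46 are roundings of square roots of
  66560 and \<open>8 \<cdot> 260\<close>.\<close>
lemma energy_growth:
  assumes sol: "smooth_stationary_NS a \<gamma> \<nu> l \<rho> u" and a: "a > 0" and g: "\<gamma> > 1"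
    and nu: "\<nu> > 0" "l + \<nu> \<ge> 0" and rho: "in_Linfinity \<rho>"
    and int: "integrable lborel (grad_sq u)" and p: "9/2 \<le> p" and q: "3 \<le> q"
  shows "\<exists>C\<ge>0. \<forall>R>0. \<forall>Y>0. M_pq p q u R \<le> ennreal Y \<longrightarrow>
    (\<integral>x. indicator (cball 0 R) x * grad_sq u x \<partial>lborel)
      \<le> C * (Y^3 + Y * sqrt (\<integral>x. grad_sq u x \<partial>lborel) * R powr (-1/6))"
proof -
  note s = solution_smooth[OF sol]
  obtain K where K: "\<And>x. \<rho> x \<le> K"
    using in_Linfinity_bound[OF smooth_continuous[OF s(1)] rho] by blast
  define D where "D = (\<integral>x. grad_sq u x \<partial>lborel)"
  have D: "D \<ge> 0" unfolding D_def by (intro integral_nonneg_AE AE_I2) (rule grad_sq_nonneg)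
  have u: "continuous_on UNIV u" by (rule velocity_continuous[OF sol])
  obtain C where C: "C \<ge> 0" and cacc: "\<And>R. R > 0 \<Longrightarrow> (\<integral>x. indicator (cball 0 R) x * grad_sq u x \<partial>lborel)
    \<le> C / R * sqrt (\<integral>x. indicator (annulus R) x * (norm (u x))^2 \<partial>lborel)
      * (sqrt (\<integral>x. indicator (annulus R) x * norm (u x)^4 \<partial>lborel)
        + sqrt (\<integral>x. indicator (annulus R) x * grad_sq u x \<partial>lborel))"
    using Caccioppoli_inequality[OF sol a g nu K] by blast
  have "(\<integral>x. indicator (cball 0 R) x * grad_sq u x \<partial>lborel)
      \<le> 11960 * C * (Y^3 + Y * sqrt D * R powr (-1/6))"
    if R: "R > 0" and Y: "Y > 0" and M: "M_pq p q u R \<le> ennreal Y" for R Y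
  proof -
    let ?A = "indicator (annulus R) :: real^3 \<Rightarrow> real"
    define x2 where "x2 = (\<integral>x. ?A x * (norm (u x))^2 \<partial>lborel)"
    define x4 where "x4 = (\<integral>x. ?A x * norm (u x)^4 \<partial>lborel)"
    have x4: "x4 \<le> 66560 * Y^4 * R powr (1/3)"
      unfolding x4_def by (rule annulus_L4_bound[OF p q u R Y M])
    have X: "sqrt x4 \<le> 260 * Y^2 * R powr (1/6)"
    proof (rule real_le_lsqrt)
      have "(R powr (1/6))^2 = R powr (1/3)" using R by (simp add: powr_power)
      then have sq: "(260 * Y^2 * R powr (1/6))^2 = 67600 * (Y^4 * R powr (1/3))"
        by (simp add: power_mult_distrib flip: power_mult)
      have "x4 \<le> 66560 * (Y^4 * R powr (1/3))" using x4 by (simp add: mult.assoc)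
      also have "\<dots> \<le> 67600 * (Y^4 * R powr (1/3))"
        by (intro mult_right_mono) auto
      finally show "x4 \<le> (260 * Y^2 * R powr (1/6))^2" unfolding sq .
    qed (use Y in auto)
    have Z: "sqrt x2 \<le> 46 * Y * R powr (5/6)"
    proof (rule real_le_lsqrt)
      have "(\<integral>x. (?A x * 1) * (?A x * (norm (u x))^2) \<partial>lborel)
          \<le> sqrt (\<integral>x. ?A x * 1^2 \<partial>lborel) * sqrt (\<integral>x. ?A x * ((norm (u x))^2)^2 \<partial>lborel)"
        by (rule Cauchy_Schwarz_indicator(2)[OF compact_annuli(1,1)]) (intro continuous_intros u)+
      moreover have "(\<lambda>x. (?A x * 1) * (?A x * (norm (u x))^2)) = (\<lambda>x. ?A x * (norm (u x))^2)"
        by (simp add: indicator_def fun_eq_iff)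
      moreover have "(\<integral>x. ?A x * 1^2 \<partial>lborel) = measure lborel (annulus R)"
        using compact_annuli(1)[of R] by (simp add: compact_imp_closed)
      ultimately have "x2 \<le> sqrt (measure lborel (annulus R)) * sqrt x4"
        unfolding x2_def x4_def by (simp only: power_mult[symmetric]) simp
      also have "\<dots> \<le> sqrt (64 * R^3) * (260 * Y^2 * R powr (1/6))"
        using R by (intro mult_mono X real_sqrt_le_mono measure_annulus_le) (auto simp: x4_def intro!: integral_nonneg_AE)
      also have "sqrt (64 * R^3) = 8 * R powr (3/2)"
      proof (rule real_sqrt_unique)
        show "(8 * R powr (3/2))^2 = 64 * R^3"
          using R by (simp add: power_mult_distrib powr_power powr_numeral)
      qed simp
      also have "8 * R powr (3/2) * (260 * Y^2 * R powr (1/6)) = 2080 * Y^2 * R powr (5/3)"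
        by (simp flip: powr_add)
      also have "\<dots> \<le> 2116 * Y^2 * R powr (5/3)" by (intro mult_right_mono) auto
      also have "\<dots> = (46 * Y * R powr (5/6))^2"
        using R by (simp add: power_mult_distrib powr_power)
      finally show "x2 \<le> (46 * Y * R powr (5/6))^2" .
    qed (use Y in auto)
    have d: "sqrt (\<integral>x. ?A x * grad_sq u x \<partial>lborel) \<le> sqrt D"
      unfolding D_def
    proof (intro real_sqrt_le_mono integral_mono int)
      show "integrable lborel (\<lambda>x. ?A x * grad_sq u x)"
        by (intro integrable_indicator_continuous compact_annuli grad_sq_continuous[OF sol])
      show "?A x * grad_sq u x \<le> grad_sq u x" for x
        by (simp add: indicator_def grad_sq_nonneg)
    qed
    have "(\<integral>x. indicator (cball 0 R) x * grad_sq u x \<partial>lborel)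
        \<le> C / R * sqrt x2 * (sqrt x4 + sqrt (\<integral>x. ?A x * grad_sq u x \<partial>lborel))"
      unfolding x2_def x4_def by (rule cacc[OF R])
    also have "\<dots> \<le> C / R * (46 * Y * R powr (5/6)) * (260 * Y^2 * R powr (1/6) + sqrt D)"
    proof (intro mult_mono add_mono X Z d order_refl)
      show "0 \<le> sqrt x4 + sqrt (\<integral>x. ?A x * grad_sq u x \<partial>lborel)"
        unfolding x4_def by (intro add_nonneg_nonneg real_sqrt_ge_zero integral_nonneg_AE AE_I2)
          (simp_all add: grad_sq_nonneg)
      show "0 \<le> sqrt x2" unfolding x2_def by (intro real_sqrt_ge_zero integral_nonneg_AE AE_I2) simp
    qed (use C R Y in auto)
    also have "\<dots> = C * (11960 * Y^3 * (R powr (-1) * R powr (5/6) * R powr (1/6))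
        + 46 * Y * sqrt D * (R powr (-1) * R powr (5/6)))"
      using R by (simp add: powr_minus field_simps power2_eq_square power3_eq_cube)
    also have "R powr (-1) * R powr (5/6) * R powr (1/6) = 1"
      using R by (simp flip: powr_add)
    also have "R powr (-1) * R powr (5/6) = R powr (-1/6)"
      unfolding powr_add[symmetric] by simp
    also have "C * (11960 * Y^3 * 1 + 46 * Y * sqrt D * R powr (-1/6))
        \<le> C * (11960 * Y^3 * 1 + 11960 * (Y * sqrt D * R powr (-1/6)))"
    proof -
      have "46 * (Y * sqrt D * R powr (-1/6)) \<le> 11960 * (Y * sqrt D * R powr (-1/6))"
        using Y D by (intro mult_right_mono) auto
      then show ?thesis using C by (intro mult_left_mono add_left_mono) (simp_all add: mult.assoc)
    qed
    finally show ?thesis by (simp add: algebra_simps)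
  qed
  then show ?thesis unfolding D_def[symmetric] using C by (intro exI[of _ "11960 * C"]) auto
qed

text \<open>If \<open>C y\<close> were smaller than the total energy, then for all large \<open>R\<close> the energy in the ball
  of radius \<open>R\<close> would exceed the bound with \<open>Y^3 = y\<close>, so \<open>M R\<close> could not be at most \<open>Y\<close> for any large
  \<open>R\<close>, and the limit inferior would be at least \<open>y\<close>.\<close>
lemma energy_le_Liminf:
  fixes u :: "real^3 \<Rightarrow> real^3"
  assumes int: "integrable lborel (grad_sq u)" and C: "C \<ge> 0"
    and growth: "\<And>R Y. R > 0 \<Longrightarrow> Y > 0 \<Longrightarrow> M R \<le> ennreal Y \<Longrightarrow>
      (\<integral>x. indicator (cball 0 R) x * grad_sq u x \<partial>lborel) \<le> C * (Y^3 + Y * B * R powr (-1/6))"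
    and y: "Liminf at_top (\<lambda>R. M R ^ 3) < ennreal y"
  shows "(\<integral>x. grad_sq u x \<partial>lborel) \<le> C * y"
proof (rule ccontr)
  define D where "D = (\<integral>x. grad_sq u x \<partial>lborel)"
  assume "\<not> (\<integral>x. grad_sq u x \<partial>lborel) \<le> C * y"
  then have D: "C * y < D" by (simp add: D_def)
  have y0: "y > 0" using y by (metis ennreal_neg not_gr_zero not_le not_less_zero less_le_not_le)
  define Y where "Y = y powr (1/3)"
  have Y: "Y > 0" "Y^3 = y" using y0 by (simp_all add: Y_def powr_power)
  have lim1: "((\<lambda>R. \<integral>x. indicator (cball 0 R) x * grad_sq u x \<partial>lborel) \<longlongrightarrow> D) at_top"
    unfolding D_def
  proof (rule integral_dominated_convergence_at_top[where w = "grad_sq u"])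
    show "AE x in lborel. ((\<lambda>R. indicator (cball 0 R) x * grad_sq u x) \<longlongrightarrow> grad_sq u x) at_top"
    proof (rule AE_I2)
      fix x :: "real^3"
      show "((\<lambda>R. indicator (cball 0 R) x * grad_sq u x) \<longlongrightarrow> grad_sq u x) at_top"
        by (rule tendsto_eventually)
          (use eventually_ge_at_top[of "norm x"] in eventually_elim, simp add: indicator_def)
    qed
    show "\<forall>\<^sub>F R in at_top. AE x in lborel. norm (indicator (cball 0 R) x * grad_sq u x) \<le> grad_sq u x"
      by (intro always_eventually allI AE_I2) (simp add: indicator_def grad_sq_nonneg)
    have bm: "grad_sq u \<in> borel_measurable lborel" using int by (rule borel_measurable_integrable)
    then show "grad_sq u \<in> borel_measurable lborel" .
    show "(\<lambda>x. indicator (cball 0 R) x * grad_sq u x) \<in> borel_measurable lborel" for R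
      by (intro borel_measurable_times borel_measurable_indicator bm) simp
  qed (rule int)
  have "((\<lambda>R::real. R powr (-1/6)) \<longlongrightarrow> 0) at_top"
    by (rule tendsto_neg_powr) (auto intro: filterlim_ident)
  then have "((\<lambda>R. C * (y + Y * B * R powr (-1/6))) \<longlongrightarrow> C * (y + Y * B * 0)) at_top"
    by (intro tendsto_intros)
  then have lim2: "((\<lambda>R. (\<integral>x. indicator (cball 0 R) x * grad_sq u x \<partial>lborel) - C * (y + Y * B * R powr (-1/6)))
      \<longlongrightarrow> D - C * y) at_top"
    using tendsto_diff[OF lim1] by fastforce
  have "\<forall>\<^sub>F R in at_top. (\<integral>x. indicator (cball 0 R) x * grad_sq u x \<partial>lborel) - C * (y + Y * B * R powr (-1/6)) > 0"
    using order_tendstoD(1)[OF lim2, of 0] D by simp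
  then have "\<forall>\<^sub>F R in at_top. ennreal y \<le> M R ^ 3"
    using eventually_gt_at_top[of 0]
  proof eventually_elim
    case (elim R)
    have "\<not> M R \<le> ennreal Y" using growth[OF elim(2) Y(1)] elim(1) Y(2) by auto
    then have "ennreal Y ^ 3 \<le> M R ^ 3" by (intro power_mono) auto
    then show ?case using Y by (simp add: ennreal_power)
  qed
  then have "ennreal y \<le> Liminf at_top (\<lambda>R. M R ^ 3)" by (rule Liminf_bounded)
  with y show False by simp
qed

lemma zero_gradient_imp_constant:
  assumes f: "\<And>x. f differentiable (at x)" and z: "\<And>i x. pd i f x = 0"
  shows "f x = f (0 :: real^3)"
proof -
  have "(f has_derivative (\<lambda>h. 0)) (at x)" for x
  proof -
    have d: "(f has_derivative frechet_derivative f (at x)) (at x)"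
      using f by (simp add: frechet_derivative_works)
    have "frechet_derivative f (at x) = (\<lambda>h. 0)"
    proof (rule linear_eq_stdbasis)
      show "linear (frechet_derivative f (at x))" using d by (rule has_derivative_linear)
      show "linear (\<lambda>h::real^3. 0::real)" by (simp add: linear_iff)
      fix b :: "real^3" assume "b \<in> Basis"
      then obtain i where "b = axis i 1" by (auto simp: Basis_vec_def)
      then show "frechet_derivative f (at x) b = 0" using z[of i x] by (simp add: pd_def)
    qed
    with d show ?thesis by simp
  qed
  then show ?thesis
    using has_derivative_zero_unique[of UNIV f x 0] by (auto simp: convex_UNIV)
qed

lemma measure_annulus_ge:
  assumes "R > 0" shows "R^3 / 1000 \<le> measure lborel (annulus R)"
proof -
  have sub: "cbox (vec R) (vec (11/10 * R)) \<subseteq> annulus R"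
  proof
    fix x :: "real^3" assume "x \<in> cbox (vec R) (vec (11/10 * R))"
    then have x: "R \<le> x $ i" "x $ i \<le> 11/10 * R" for i by (simp_all add: mem_box_cart)
    have lo: "R \<le> norm x" using x(1)[of 1] component_le_norm_cart[of x 1] by linarith
    have "(norm x)^2 = (\<Sum>i\<in>UNIV. (x $ i)^2)"
      unfolding power2_norm_eq_inner inner_vec_def by (simp add: power2_eq_square)
    also have "\<dots> \<le> (\<Sum>i\<in>(UNIV::3 set). (11/10 * R)^2)"
    proof (intro sum_mono power_mono)
      show "0 \<le> x $ i" for i using x(1)[of i] assms by linarith
    qed (rule x)
    also have "\<dots> \<le> (2 * R)^2" by (simp add: power_mult_distrib power_divide)
    finally have "norm x \<le> 2 * R" by (rule power2_le_imp_le) (use assms in simp)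
    with lo show "x \<in> annulus R" by (simp add: annulus_def)
  qed
  have "measure lborel (cbox (vec R) (vec (11/10 * R)) :: (real^3) set) = (\<Prod>i\<in>(UNIV::3 set). 11/10 * R - R)"
    using assms by (subst content_cbox_cart) (auto simp: interval_ne_empty_cart)
  also have "\<dots> = R^3 / 1000" by (simp add: power3_eq_cube)
  finally show ?thesis
    using measure_mono_fmeasurable[OF sub _ fmeasurable_compact[OF compact_annuli(1)]] by simp
qed

text \<open>The \<open>L^4\<close> norm of a nonzero constant over the annulus contradicts \<open>annulus_L4_bound\<close> for large
  \<open>R\<close>, since \<open>R^3\<close> outgrows \<open>R powr (1/3)\<close>.\<close>
lemma nonzero_constant_velocity_excluded:
  fixes u :: "real^3 \<Rightarrow> real^3"
  assumes p: "9/2 \<le> p" and q: "3 \<le> q" and const: "\<And>x. u x = c"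
    and L: "Liminf at_top (\<lambda>R. M_pq p q u R ^ 3) < 1"
  shows "c = 0"
proof (rule ccontr)
  assume "c \<noteq> 0"
  have "\<forall>\<^sub>F R in at_top. 66560 * 1000 / norm c ^ 4 < R powr (8/3)"
    using eventually_gt_at_top[of "66560 * 1000 / norm c ^ 4"] eventually_ge_at_top[of 1]
  proof eventually_elim
    case (elim R)
    have "R powr 1 \<le> R powr (8/3)" using elim(2) by (intro powr_mono) auto
    then show ?case using elim by simp
  qed
  then have "\<forall>\<^sub>F R in at_top. 1 \<le> M_pq p q u R ^ 3"
    using eventually_gt_at_top[of 0]
  proof eventually_elim
    case (elim R)
    have "\<not> M_pq p q u R \<le> ennreal 1"
    proof
      assume M: "M_pq p q u R \<le> ennreal 1"
      have "continuous_on UNIV u" using const by (simp add: continuous_on_def)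
      from annulus_L4_bound[OF p q this elim(2) _ M]
      have "measure lborel (annulus R) * norm c ^ 4 \<le> 66560 * R powr (1/3)"
        using compact_annuli(1)[of R] by (simp add: const compact_imp_closed)
      moreover have "R^3 / 1000 * norm c ^ 4 \<le> measure lborel (annulus R) * norm c ^ 4"
        by (intro mult_right_mono measure_annulus_ge elim(2)) simp
      ultimately have "R^3 * norm c ^ 4 \<le> (66560 * 1000) * R powr (1/3)" by simp
      also have "R^3 = R powr (8/3) * R powr (1/3)"
        using elim(2) by (simp add: powr_numeral flip: powr_add)
      finally have "(R powr (8/3) * norm c ^ 4) * R powr (1/3) \<le> (66560 * 1000) * R powr (1/3)"
        by (simp only: mult_ac)
      then have "R powr (8/3) * norm c ^ 4 \<le> 66560 * 1000"
        using elim(2) by (simp add: mult_le_cancel_right)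
      then show False using elim(1) \<open>c \<noteq> 0\<close> by (simp add: field_simps)
    qed
    then have "1 \<le> M_pq p q u R" by simp
    then show ?case by (rule one_le_power)
  qed
  then have "1 \<le> Liminf at_top (\<lambda>R. M_pq p q u R ^ 3)" by (rule Liminf_bounded)
  with L show False by simp
qed

lemma zero_velocity_imp_constant_density:
  assumes sol: "smooth_stationary_NS a \<gamma> \<nu> l \<rho> u" and a: "a > 0" and g: "\<gamma> > 1"
    and u: "\<And>x. u x = 0"
  shows "\<rho> x = \<rho> 0"
proof -
  note s = solution_smooth[OF sol]
  have zero: "pd j (\<lambda>y. 0) = (\<lambda>y. 0)" for j
    by (simp add: pd_def fun_eq_iff)
  have "pd i (pressure a \<gamma> \<rho>) x = 0" for i x
    using momentum_equation[OF sol, where i = i and x = x] by (simp add: u zero)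
  then have "pressure a \<gamma> \<rho> x = pressure a \<gamma> \<rho> 0"
    using pressure_has_derivative[OF sol g]
    by (intro zero_gradient_imp_constant) (auto simp: differentiable_def)
  then have "(\<rho> x powr \<gamma>) powr (1 / \<gamma>) = (\<rho> 0 powr \<gamma>) powr (1 / \<gamma>)"
    using a by (simp add: pressure_def)
  then show ?thesis using s(3) g by (simp add: powr_powr)
qed

theorem theorem1p2:
  fixes a \<gamma> \<nu> l p :: real and q :: ennreal
    and \<rho> :: "real^3 \<Rightarrow> real" and u :: "real^3 \<Rightarrow> real^3"
  assumes "a > 0" and "\<gamma> > 1" and "\<nu> > 0" and "l + 2/3 * \<nu> > 0"
    and "smooth_stationary_NS a \<gamma> \<nu> l \<rho> u"
    and "in_Linfinity \<rho>"
    and "integrable lebesgue (grad_sq u)"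
    and "9/2 \<le> p" and "3 \<le> q"
    and "Liminf at_top (M_pq p q u) < \<infinity>"
  shows "\<exists>C0>0.
     ennreal (dirichlet u) \<le> ennreal C0 * Liminf at_top (\<lambda>R. M_pq p q u R ^ 3) \<and>
     (\<forall>\<delta>. 0 < \<delta> \<and> \<delta> < 1 / C0 \<and>
          Liminf at_top (\<lambda>R. M_pq p q u R ^ 3) \<le> ennreal (\<delta> * dirichlet u)
        \<longrightarrow> (\<forall>x. u x = 0) \<and> (\<exists>c. \<forall>x. \<rho> x = c))"
proof -
  note a = assms(1) and g = assms(2) and nu = assms(3) and sol = assms(5)
  have lnu: "l + \<nu> \<ge> 0" using assms(3,4) by linarith
  note s = solution_smooth[OF sol]
  have gs: "continuous_on UNIV (grad_sq u)" by (rule grad_sq_continuous[OF sol])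
  have [measurable]: "grad_sq u \<in> borel_measurable borel" using gs by (rule borel_measurable_continuous_onI)
  have int: "integrable lborel (grad_sq u)" using assms(7) by (simp add: integrable_completion)
  define D where "D = dirichlet u"
  have D_eq: "D = (\<integral>x. grad_sq u x \<partial>lborel)"
    unfolding D_def dirichlet_def by (rule integral_completion) simp
  have D0: "D \<ge> 0" unfolding D_eq by (intro integral_nonneg_AE AE_I2) (rule grad_sq_nonneg)
  define L where "L = Liminf at_top (\<lambda>R. M_pq p q u R ^ 3)"
  obtain C where C: "C \<ge> 0" and growth: "\<And>R Y. R > 0 \<Longrightarrow> Y > 0 \<Longrightarrow> M_pq p q u R \<le> ennreal Y \<Longrightarrow>
    (\<integral>x. indicator (cball 0 R) x * grad_sq u x \<partial>lborel)
      \<le> C * (Y^3 + Y * sqrt (\<integral>x. grad_sq u x \<partial>lborel) * R powr (-1/6))"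
    using energy_growth[OF sol a g nu lnu assms(6) int assms(8,9)] by blast
  have main: "ennreal D \<le> ennreal (C + 1) * L"
  proof (cases L)
    case (real y)
    \<comment> \<open>The strict inequality is needed to apply the growth bound along arbitrarily large radii.\<close>
    have "D \<le> C * z" if "z > y" for z
    proof -
      have "L < ennreal z" using real that by (simp add: ennreal_less_iff)
      then show ?thesis
        unfolding D_eq L_def
        using energy_le_Liminf[OF int C, of "M_pq p q u"] growth by blast
    qed
    then have "D \<le> C * y + e" if "e > 0" for e
    proof -
      have "D \<le> C * (y + e / (C + 1))" using \<open>\<And>z. z > y \<Longrightarrow> D \<le> C * z\<close> that C by simp
      also have "\<dots> \<le> C * y + e" using that C by (simp add: field_simps)
      finally show ?thesis .
    qed
    then have "D \<le> C * y" by (rule field_le_epsilon)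
    also have "\<dots> \<le> (C + 1) * y" using real by (intro mult_right_mono) auto
    finally have "ennreal D \<le> ennreal ((C + 1) * y)" by (rule ennreal_leI)
    also have "\<dots> = ennreal (C + 1) * L"
      unfolding real(2) by (rule ennreal_mult) (use C real(1) in auto)
    finally show ?thesis .
  next
    case top
    then show ?thesis using C by (simp add: ennreal_mult_top)
  qed
  have "(\<forall>x. u x = 0) \<and> (\<exists>c. \<forall>x. \<rho> x = c)"
    if d: "0 < \<delta>" "\<delta> < 1 / (C + 1)" and small: "L \<le> ennreal (\<delta> * D)" for \<delta>
  proof -
    have "ennreal D \<le> ennreal (C + 1) * ennreal (\<delta> * D)"
      using main mult_left_mono[OF small] by (rule order_trans) simp
    also have "\<dots> = ennreal ((C + 1) * (\<delta> * D))"
      by (rule ennreal_mult[symmetric]) (use C d D0 in auto)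
    finally have "D \<le> (C + 1) * (\<delta> * D)"
      using C d D0 by (subst (asm) ennreal_le_iff) auto
    moreover have "(C + 1) * \<delta> < 1" using C d(2) by (simp add: field_simps)
    ultimately have "D = 0"
      using D0 mult_strict_right_mono[of "(C + 1) * \<delta>" 1 D] by (cases "D = 0") auto
    then have "AE x in lborel. grad_sq u x = 0"
      using integral_nonneg_eq_0_iff_AE[OF int] by (simp add: D_eq grad_sq_nonneg)
    then have g0: "grad_sq u x = 0" for x by (rule continuous_AE_zero[OF gs])
    have "du u i j x = 0" for i j x using du_bound[where u = u and i = i and j = j and x = x] g0[of x] by simp
    then have "u x $ i = u 0 $ i" for x i
      by (intro zero_gradient_imp_constant smooth_differentiable s)
    then have const: "u x = u 0" for x by (simp add: vec_eq_iff)
    have "L < 1" using small \<open>D = 0\<close> by (simp add: le_less_trans)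
    then have "u 0 = 0"
      unfolding L_def by (rule nonzero_constant_velocity_excluded[OF assms(8,9) const])
    then have u0: "u x = 0" for x using const by simp
    then show ?thesis using zero_velocity_imp_constant_density[OF sol a g u0] by blast
  qed
  then show ?thesis
    using main C unfolding D_def L_def by (intro exI[of _ "C + 1"]) auto
qed

end
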